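(* The following rules hold for the characters of the truncations $\mathcal{M}(\mathbf{R},J)$ (and so give an inductive character formula for any truncation $\mathcal{M}(\mathbf{R},J)$): (1) $\operatorname{ch}\mathcal{M}(\varnothing,J)=1$ for any upward-closed set $J\subseteq I\dot{\times}\mathbb{Z}$. (2) Suppose $J$ is an upward-closed set containing $\operatorname{Supp}\mathbf{R}$, and $\mathbf{Q}$ is a finite multiset with $\operatorname{Supp}\mathbf{Q}\subseteq\partial J$. Then $\operatorname{ch}\mathcal{M}(\mathbf{R}+\mathbf{Q},J)=e^{\operatorname{wt}(\mathbf{Q})}\cdot\operatorname{ch}\mathcal{M}(\mathbf{R},J)$. (3) Suppose $J$ is an upward-closed set containing $\operatorname{Supp}\mathbf{R}$, and $J'=J\cup\{(i,k)\}$ is another upward-closed set such that $J'\setminus J=\{(i,k)\}$. Then $\operatorname{ch}\mathcal{M}(\mathbf{R},J')=\pi_i\operatorname{ch}\mathcal{M}(\mathbf{R},J)$.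
   Context: Setting. $G$ is a reductive algebraic group over $\mathbb{C}$ with a fixed maximal torus and Borel subgroup, weight lattice $P$, simple roots $\alpha_i\in P$ and simple coroots $\alpha_i^\vee$ ($i\in I$), pairing $\langle\cdot,\cdot\rangle$, dominant weights $P^+$, simple reflections $s_i$. $G$ is simply-laced (Cartan matrix symmetric with off-diagonal entries $0$ or $-1$), and the Dynkin diagram (vertex set $I$, $i\sim j$ iff $\langle\alpha_i^\vee,\alpha_j\rangle=-1$) is connected. Fix a two-colouring of the Dynkin diagram into even and odd vertices, and let $I\dot{\times}\mathbb{Z}=\{(i,c)\in I\times\mathbb{Z}: i,c\text{ have the same parity}\}$. Fix fundamental weights $\varpi_i\in P\otimes\mathbb{Q}$ with $\langle\alpha_i^\vee,\varpi_j\rangle=\delta_{ij}$. Multisets. A finite multiset based in $I\dot{\times}\mathbb{Z}$ is a finitely supported function $\mathbf{R}:I\dot{\times}\mathbb{Z}\to\mathbb{N}$, with values $\mathbf{R}[i,c]$; $\mathbf{R}+\mathbf{Q}$ is the sum of functions. For the multisets $\mathbf R,\mathbf Q$ it is assumed that $\mathbf{R}[i,c]\varpi_i\in P$ and $\mathbf{Q}[i,c]\varpi_i\in P$ for all $(i,c)$. Put $\operatorname{wt}(\mathbf{R})=\sum\mathbf{R}[i,c]\varpi_i$. Monomial crystal. Let $\mathcal{M}$ be the multiplicative abelian group of formal monomials $p=e^{\operatorname{wt}(p)}\prod_{(i,c)}y_{i,c}^{p[i,c]}$, with $\operatorname{wt}(p)\in P$ and $p[i,c]\in\mathbb{Z}$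 for $(i,c)\in I\dot{\times}\mathbb{Z}$, finitely many nonzero, such that $\langle\alpha_i^\vee,\operatorname{wt}(p)\rangle=\sum_c p[i,c]$ for all $i$. For $(i,k)\in I\dot{\times}\mathbb{Z}$ let $z_{i,k}=e^{\alpha_i}y_{i,k}y_{i,k+2}\prod_{j\sim i}y_{j,k+1}^{-1}$. Put $\varphi_i^k(p)=\sum_{l\ge k}p[i,l]$, $\varphi_i(p)=\max_k\varphi_i^k(p)$, $\varepsilon_i^k(p)=-\sum_{l\le k}p[i,l]$, $\varepsilon_i(p)=\max_k\varepsilon_i^k(p)$. If $\varphi_i(p)=0$ then $f_i(p)=0$; otherwise $f_i(p)=p\,z_{i,F-2}^{-1}$ with $F$ the largest $k$ such that $\varphi_i^k(p)=\varphi_i(p)$. If $\varepsilon_i(p)=0$ then $e_i(p)=0$; otherwise $e_i(p)=p\,z_{i,E}$ with $E$ the smallest $k$ such that $\varepsilon_i^k(p)=\varepsilon_i(p)$. This makes $\mathcal{M}$ a $G$-crystal (known). Product monomial crystal. For $n\ge0$ with $n\varpi_i\in P$, $\mathcal{M}(i,c)^n$ is the subcrystal of $\mathcal{M}$ generated by $e^{n\varpi_i}y_{i,c}^n$. Set $\mathcal{M}(\mathbf{R})=\prod_{(i,c)}\mathcal{M}(i,c)^{\mathbf{R}[i,c]}$, the set of all products of monomials taken one from each factor; $\mathcal{M}(\varnothing)=\{1\}$. It is known that $\mathcal{M}(\mathbf{R})$ is a subcrystal of $\mathcal{M}$. With $y_{\mathbf{R}}=e^{\operatorname{wt}(\mathbf{R})}\prod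 y_{i,c}^{\mathbf{R}[i,c]}$ and $z_{\mathbf{S}}=\prod z_{i,k}^{\mathbf{S}[i,k]}$, each $p\in\mathcal{M}(\mathbf{R})$ is $p=y_{\mathbf{R}}z_{\mathbf{S}}^{-1}$ for a unique finite multiset $\mathbf{S}$ based in $I\dot{\times}\mathbb{Z}$; put $\operatorname{Supp}_{\mathbf{R}}(p)=\operatorname{Supp}\mathbf{R}\cup\operatorname{Supp}\mathbf{S}$. Truncations. Let $\le$ be the partial order on $I\dot{\times}\mathbb{Z}$ generated by $(i,c)\le(i,c+2)$ and $(i,c)\le(j,c+1)$ for $j\sim i$; upward-closed is with respect to $\le$. The boundary $\partial J$ of an upward-closed set $J$ is the set of $(i,k)\in J$ with $(i,k-2)\notin J$. For an upward-closed $J\supseteq\operatorname{Supp}\mathbf{R}$, the truncation is $\mathcal{M}(\mathbf{R},J)=\{p\in\mathcal{M}(\mathbf{R}):\operatorname{Supp}_{\mathbf{R}}(p)\subseteq J\}$. Characters. For a finite subset $X$ of a crystal, $\operatorname{ch}X=\sum_{x\in X}e^{\operatorname{wt}(x)}\in\mathbb{Z}[P]$. The Demazure operator $\pi_i:\mathbb{Z}[P]\to\mathbb{Z}[P]$ is the $\mathbb{Z}$-linear map $\pi_i(e^\lambda)=\dfrac{e^\lambda-e^{s_i\lambda-\alpha_i}}{1-e^{-\alpha_i}}$. *)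

theory Defs
  imports
    "HOL-Analysis.Finite_Cartesian_Product"
    "HOL-Library.Poly_Mapping"
    "HOL-Library.Multiset"
    "HOL-Library.Set_Algebras"
begin

section \<open>Root data\<close>

text \<open>
  A connected reductive group over the complex numbers with a maximal torus and a Borel subgroup
  enters only through its based root datum. A basis of the weight lattice \<open>P\<close> is chosen, together
  with the dual basis of the coweight lattice: both lattices become \<^typ>\<open>int ^ 'r\<close>, where \<open>'r\<close> is
  an arbitrary finite index type, the pairing becomes the standard one, and \<open>P \<otimes> \<rat>\<close> becomes
  \<^typ>\<open>rat ^ 'r\<close>. The type \<open>'i\<close> is the vertex set \<open>I\<close> of the Dynkin diagram.
\<close>

definition pairing :: "int ^ 'r::finite \<Rightarrow> int ^ 'r \<Rightarrow> int"
  where "pairing h \<mu> = (\<Sum>k\<in>UNIV. h $ k * \<mu> $ k)"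

definition rat_pairing :: "int ^ 'r::finite \<Rightarrow> rat ^ 'r \<Rightarrow> rat"
  where "rat_pairing h v = (\<Sum>k\<in>UNIV. of_int (h $ k) * v $ k)"

definition to_rat :: "int ^ 'r::finite \<Rightarrow> rat ^ 'r"
  where "to_rat \<mu> = (\<chi> k. of_int (\<mu> $ k))"

record ('r::finite, 'i) crystal_datum =
  roots :: "(int ^ 'r) set"
  coroot :: "int ^ 'r \<Rightarrow> int ^ 'r"
  simple_root :: "'i \<Rightarrow> int ^ 'r"
  even_vertex :: "'i \<Rightarrow> bool"
  fund_weight :: "'i \<Rightarrow> rat ^ 'r"

text \<open>The function \<^const>\<open>coroot\<close> is only meaningful on \<^const>\<open>roots\<close>.\<close>

definition root_datum :: "('r::finite, 'i) crystal_datum \<Rightarrow> bool"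
  where "root_datum D \<longleftrightarrow>
    finite (roots D) \<and>
    inj_on (coroot D) (roots D) \<and>
    (\<forall>\<beta>\<in>roots D. pairing (coroot D \<beta>) \<beta> = 2) \<and>
    (\<forall>\<beta>\<in>roots D. \<forall>\<gamma>\<in>roots D. \<gamma> - pairing (coroot D \<beta>) \<gamma> *s \<beta> \<in> roots D) \<and>
    (\<forall>\<beta>\<in>roots D. \<forall>\<gamma>\<in>roots D.
       coroot D \<gamma> - pairing (coroot D \<gamma>) \<beta> *s coroot D \<beta> \<in> coroot D ` roots D)"

definition reduced_root_datum :: "('r::finite, 'i) crystal_datum \<Rightarrow> bool"
  where "reduced_root_datum D \<longleftrightarrow>
    root_datum D \<and>
    (\<forall>\<beta>\<in>roots D. \<forall>\<gamma>\<in>roots D. \<forall>a b. a \<noteq> 0 \<and> a *s \<beta> = b *s \<gamma> \<longrightarrow> \<gamma> = \<beta> \<or> \<gamma> = - \<beta>)"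

definition based_root_datum :: "('r::finite, 'i::finite) crystal_datum \<Rightarrow> bool"
  where "based_root_datum D \<longleftrightarrow>
    reduced_root_datum D \<and>
    range (simple_root D) \<subseteq> roots D \<and>
    (\<forall>a :: 'i \<Rightarrow> int. (\<Sum>i\<in>UNIV. a i *s simple_root D i) = 0 \<longrightarrow> (\<forall>i. a i = 0)) \<and>
    (\<forall>\<beta>\<in>roots D. \<exists>a :: 'i \<Rightarrow> int.
       \<beta> = (\<Sum>i\<in>UNIV. a i *s simple_root D i) \<and> ((\<forall>i. a i \<ge> 0) \<or> (\<forall>i. a i \<le> 0)))"

definition simple_coroot :: "('r::finite, 'i) crystal_datum \<Rightarrow> 'i \<Rightarrow> int ^ 'r"
  where "simple_coroot D i = coroot D (simple_root D i)"

definition cartan :: "('r::finite, 'i) crystal_datum \<Rightarrow> 'i \<Rightarrow> 'i \<Rightarrow> int"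
  where "cartan D i j = pairing (simple_coroot D i) (simple_root D j)"

definition simply_laced :: "('r::finite, 'i) crystal_datum \<Rightarrow> bool"
  where "simply_laced D \<longleftrightarrow>
    (\<forall>i j. cartan D i j = cartan D j i) \<and> (\<forall>i j. i \<noteq> j \<longrightarrow> cartan D i j \<in> {0, -1})"

definition adj :: "('r::finite, 'i) crystal_datum \<Rightarrow> 'i \<Rightarrow> 'i \<Rightarrow> bool"
  where "adj D i j \<longleftrightarrow> cartan D i j = -1"

definition dynkin_connected :: "('r::finite, 'i) crystal_datum \<Rightarrow> bool"
  where "dynkin_connected D \<longleftrightarrow> (\<forall>i j. (adj D)\<^sup>*\<^sup>* i j)"

definition two_colouring :: "('r::finite, 'i) crystal_datum \<Rightarrow> bool"
  where "two_colouring D \<longleftrightarrow> (\<forall>i j. adj D i j \<longrightarrow> even_vertex D i \<noteq> even_vertex D j)"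

definition fundamental_weights :: "('r::finite, 'i) crystal_datum \<Rightarrow> bool"
  where "fundamental_weights D \<longleftrightarrow>
    (\<forall>i j. rat_pairing (simple_coroot D i) (fund_weight D j) = (if i = j then 1 else 0))"

definition simple_refl :: "('r::finite, 'i) crystal_datum \<Rightarrow> 'i \<Rightarrow> int ^ 'r \<Rightarrow> int ^ 'r"
  where "simple_refl D i \<mu> = \<mu> - pairing (simple_coroot D i) \<mu> *s simple_root D i"

text \<open>The set \<open>I \<times>\<cdot> \<int>\<close> of pairs of equal parity.\<close>

definition parity_pairs :: "('r::finite, 'i) crystal_datum \<Rightarrow> ('i \<times> int) set"
  where "parity_pairs D = {(i, c). even_vertex D i \<longleftrightarrow> even c}"


section \<open>Monomials\<close>

datatype ('r::finite, 'i) monomial = Monomial (wt: "int ^ 'r") (expo: "('i \<times> int) \<Rightarrow>\<^sub>0 int")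

instantiation monomial :: (finite, type) "{comm_monoid_mult, inverse}"
begin

definition one_monomial :: "('a, 'b) monomial"
  where "1 = Monomial 0 0"

definition times_monomial :: "('a, 'b) monomial \<Rightarrow> ('a, 'b) monomial \<Rightarrow> ('a, 'b) monomial"
  where "p * q = Monomial (wt p + wt q) (expo p + expo q)"

definition inverse_monomial :: "('a, 'b) monomial \<Rightarrow> ('a, 'b) monomial"
  where "inverse p = Monomial (- wt p) (- expo p)"

definition divide_monomial :: "('a, 'b) monomial \<Rightarrow> ('a, 'b) monomial \<Rightarrow> ('a, 'b) monomial"
  where "p div q = p * inverse (q :: ('a, 'b) monomial)"

instance
  by standard (simp_all add: times_monomial_def one_monomial_def ac_simps)

end

lemma monomial_inverse_right: "(p :: ('r::finite, 'i) monomial) * inverse p = 1"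
  by (simp add: times_monomial_def inverse_monomial_def one_monomial_def)

text \<open>
  The type \<^typ>\<open>('r, 'i) monomial\<close> is the group of all expressions \<open>e\<^sup>\<mu> \<Prod> y\<^bsub>i,c\<^esub>\<^sup>a\<close>, without any
  condition linking weight and exponents. It contains \<open>e\<^sup>\<mu>\<close> and \<open>y\<^bsub>i,c\<^esub>\<close> separately. The group
  \<open>\<M>\<close> is the subgroup \<open>monomial_crystal\<close>.
\<close>

definition wexp :: "int ^ 'r \<Rightarrow> ('r::finite, 'i) monomial"
  where "wexp \<mu> = Monomial \<mu> 0"

definition yvar :: "'i \<times> int \<Rightarrow> ('r::finite, 'i) monomial"
  where "yvar x = Monomial 0 (Poly_Mapping.single x 1)"

definition expn :: "('r::finite, 'i) monomial \<Rightarrow> 'i \<Rightarrow> int \<Rightarrow> int"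
  where "expn p i c = Poly_Mapping.lookup (expo p) (i, c)"

definition monomial_crystal :: "('r::finite, 'i) crystal_datum \<Rightarrow> ('r, 'i) monomial set"
  where "monomial_crystal D = {p.
    Poly_Mapping.keys (expo p) \<subseteq> parity_pairs D \<and>
    (\<forall>i. pairing (simple_coroot D i) (wt p) = (\<Sum>c | expn p i c \<noteq> 0. expn p i c))}"

definition zvar :: "('r::finite, 'i::finite) crystal_datum \<Rightarrow> 'i \<times> int \<Rightarrow> ('r, 'i) monomial"
  where "zvar D = (\<lambda>(i, k).
    wexp (simple_root D i) * yvar (i, k) * yvar (i, k + 2) *
    (\<Prod>j | adj D j i. inverse (yvar (j, k + 1))))"

definition phi_at :: "('r::finite, 'i) monomial \<Rightarrow> 'i \<Rightarrow> int \<Rightarrow> int"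
  where "phi_at p i k = (\<Sum>l | k \<le> l \<and> expn p i l \<noteq> 0. expn p i l)"

definition eps_at :: "('r::finite, 'i) monomial \<Rightarrow> 'i \<Rightarrow> int \<Rightarrow> int"
  where "eps_at p i k = - (\<Sum>l | l \<le> k \<and> expn p i l \<noteq> 0. expn p i l)"

definition phi :: "('r::finite, 'i) crystal_datum \<Rightarrow> 'i \<Rightarrow> ('r, 'i) monomial \<Rightarrow> int"
  where "phi D i p = (MAX k\<in>{k. (i, k) \<in> parity_pairs D}. phi_at p i k)"

definition eps :: "('r::finite, 'i) crystal_datum \<Rightarrow> 'i \<Rightarrow> ('r, 'i) monomial \<Rightarrow> int"
  where "eps D i p = (MAX k\<in>{k. (i, k) \<in> parity_pairs D}. eps_at p i k)"

text \<open>\<^const>\<open>None\<close> plays the role of the extra element \<open>0\<close> of the crystal operators.\<close>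

definition f_op :: "('r::finite, 'i::finite) crystal_datum \<Rightarrow> 'i \<Rightarrow> ('r, 'i) monomial \<Rightarrow> ('r, 'i) monomial option"
  where "f_op D i p =
    (if phi D i p = 0 then None
     else let F = (GREATEST k. (i, k) \<in> parity_pairs D \<and> phi_at p i k = phi D i p)
          in Some (p * inverse (zvar D (i, F - 2))))"

definition e_op :: "('r::finite, 'i::finite) crystal_datum \<Rightarrow> 'i \<Rightarrow> ('r, 'i) monomial \<Rightarrow> ('r, 'i) monomial option"
  where "e_op D i p =
    (if eps D i p = 0 then None
     else let E = (LEAST k. (i, k) \<in> parity_pairs D \<and> eps_at p i k = eps D i p)
          in Some (p * zvar D (i, E)))"

definition subcrystal :: "('r::finite, 'i::finite) crystal_datum \<Rightarrow> ('r, 'i) monomial set \<Rightarrow> bool"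
  where "subcrystal D X \<longleftrightarrow>
    X \<subseteq> monomial_crystal D \<and>
    (\<forall>p\<in>X. \<forall>i q. (e_op D i p = Some q \<or> f_op D i p = Some q) \<longrightarrow> q \<in> X)"

definition generated_subcrystal :: "('r::finite, 'i::finite) crystal_datum \<Rightarrow> ('r, 'i) monomial \<Rightarrow> ('r, 'i) monomial set"
  where "generated_subcrystal D p = \<Inter> {X. subcrystal D X \<and> p \<in> X}"


section \<open>The product monomial crystal\<close>

definition in_weight_lattice :: "rat ^ 'r::finite \<Rightarrow> bool"
  where "in_weight_lattice v \<longleftrightarrow> v \<in> range to_rat"

text \<open>The element of \<open>P\<close> given by an element of \<open>P \<otimes> \<rat>\<close>; meaningful only under
  \<^const>\<open>in_weight_lattice\<close>.\<close>

definition lattice_elt :: "rat ^ 'r::finite \<Rightarrow> int ^ 'r"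
  where "lattice_elt v = (THE \<mu>. to_rat \<mu> = v)"

definition admissible :: "('r::finite, 'i) crystal_datum \<Rightarrow> ('i \<times> int) multiset \<Rightarrow> bool"
  where "admissible D R \<longleftrightarrow>
    set_mset R \<subseteq> parity_pairs D \<and>
    (\<forall>(i, c)\<in>parity_pairs D. in_weight_lattice (of_nat (count R (i, c)) *s fund_weight D i))"

definition mset_wt :: "('r::finite, 'i) crystal_datum \<Rightarrow> ('i \<times> int) multiset \<Rightarrow> int ^ 'r"
  where "mset_wt D R =
    lattice_elt (\<Sum>(i, c)\<in>set_mset R. of_nat (count R (i, c)) *s fund_weight D i)"

definition y_mset :: "('r::finite, 'i) crystal_datum \<Rightarrow> ('i \<times> int) multiset \<Rightarrow> ('r, 'i) monomial"
  where "y_mset D R = wexp (mset_wt D R) * (\<Prod>x\<in>set_mset R. yvar x ^ count R x)"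

definition z_mset :: "('r::finite, 'i::finite) crystal_datum \<Rightarrow> ('i \<times> int) multiset \<Rightarrow> ('r, 'i) monomial"
  where "z_mset D S = (\<Prod>x\<in>set_mset S. zvar D x ^ count S x)"

definition fund_crystal :: "('r::finite, 'i::finite) crystal_datum \<Rightarrow> 'i \<times> int \<Rightarrow> nat \<Rightarrow> ('r, 'i) monomial set"
  where "fund_crystal D = (\<lambda>(i, c) n.
    generated_subcrystal D (wexp (lattice_elt (of_nat n *s fund_weight D i)) * yvar (i, c) ^ n))"

text \<open>The product of sets is the elementwise one of \<^theory>\<open>HOL-Library.Set_Algebras\<close>, with empty
  product \<open>{1}\<close>.\<close>

definition product_crystal :: "('r::finite, 'i::finite) crystal_datum \<Rightarrow> ('i \<times> int) multiset \<Rightarrow> ('r, 'i) monomial set"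
  where "product_crystal D R = (\<Prod>x\<in>set_mset R. fund_crystal D x (count R x))"

definition z_part :: "('r::finite, 'i::finite) crystal_datum \<Rightarrow> ('i \<times> int) multiset \<Rightarrow> ('r, 'i) monomial \<Rightarrow> ('i \<times> int) multiset"
  where "z_part D R p =
    (THE S. set_mset S \<subseteq> parity_pairs D \<and> p = y_mset D R * inverse (z_mset D S))"

definition Supp :: "('r::finite, 'i::finite) crystal_datum \<Rightarrow> ('i \<times> int) multiset \<Rightarrow> ('r, 'i) monomial \<Rightarrow> ('i \<times> int) set"
  where "Supp D R p = set_mset R \<union> set_mset (z_part D R p)"


section \<open>Truncations\<close>

inductive cover :: "('r::finite, 'i) crystal_datum \<Rightarrow> 'i \<times> int \<Rightarrow> 'i \<times> int \<Rightarrow> bool"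
  for D
  where
    "cover D (i, c) (i, c + 2)"
  | "adj D j i \<Longrightarrow> cover D (i, c) (j, c + 1)"

text \<open>Under \<^const>\<open>two_colouring\<close>, generating steps starting in \<^const>\<open>parity_pairs\<close> stay there.\<close>

definition upward_closed :: "('r::finite, 'i) crystal_datum \<Rightarrow> ('i \<times> int) set \<Rightarrow> bool"
  where "upward_closed D J \<longleftrightarrow>
    J \<subseteq> parity_pairs D \<and> (\<forall>x y. x \<in> J \<and> (cover D)\<^sup>*\<^sup>* x y \<longrightarrow> y \<in> J)"

definition bdry :: "('i \<times> int) set \<Rightarrow> ('i \<times> int) set"
  where "bdry J = {(i, k). (i, k) \<in> J \<and> (i, k - 2) \<notin> J}"

definition truncation :: "('r::finite, 'i::finite) crystal_datum \<Rightarrow> ('i \<times> int) multiset \<Rightarrow> ('i \<times> int) set \<Rightarrow> ('r, 'i) monomial set"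
  where "truncation D R J = {p \<in> product_crystal D R. Supp D R p \<subseteq> J}"


section \<open>Characters\<close>

text \<open>The group ring \<open>\<int>[P]\<close> is \<^typ>\<open>(int ^ 'r) \<Rightarrow>\<^sub>0 int\<close> with its convolution product.\<close>

definition gexp :: "int ^ 'r::finite \<Rightarrow> (int ^ 'r) \<Rightarrow>\<^sub>0 int"
  where "gexp \<mu> = Poly_Mapping.single \<mu> 1"

text \<open>Meaningful for finite \<open>X\<close>, which all truncations are since the root datum is of finite type.\<close>

definition ch :: "('r::finite, 'i) monomial set \<Rightarrow> (int ^ 'r) \<Rightarrow>\<^sub>0 int"
  where "ch X = (\<Sum>p\<in>X. gexp (wt p))"

text \<open>The fraction is the unique element of \<open>\<int>[P]\<close> whose product with \<open>1 - e\<^sup>-\<^sup>\<alpha>\<close> is the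
  numerator.\<close>

definition demazure_exp :: "('r::finite, 'i) crystal_datum \<Rightarrow> 'i \<Rightarrow> int ^ 'r \<Rightarrow> (int ^ 'r) \<Rightarrow>\<^sub>0 int"
  where "demazure_exp D i \<mu> =
    (THE g. g * (1 - gexp (- simple_root D i)) =
            gexp \<mu> - gexp (simple_refl D i \<mu> - simple_root D i))"

definition demazure :: "('r::finite, 'i) crystal_datum \<Rightarrow> 'i \<Rightarrow> ((int ^ 'r) \<Rightarrow>\<^sub>0 int) \<Rightarrow> (int ^ 'r) \<Rightarrow>\<^sub>0 int"
  where "demazure D i f =
    (\<Sum>\<mu>\<in>Poly_Mapping.keys f. of_int (Poly_Mapping.lookup f \<mu>) * demazure_exp D i \<mu>)"

end

(*
  Call a set of monomials strongly closed if p[i,l] > 0 implies that it contains p z_{i,l-2}^{-1}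
  and p[i,l] < 0 implies that it contains p z_{i,l}, for each p in the set. A strongly closed set is
  closed under all crystal operators, and a product of strongly closed sets is strongly closed, since
  a sum with a given sign has a summand with that sign. So M(R) is a subcrystal as soon as each
  fundamental crystal is contained in a strongly closed set of monomials y_x z_S^{-1}, S >= 0, with
  y_x its only highest weight element. Such a set is given by the graded dimensions S of the
  submodules of the cofree module with frame x over the graded preprojective algebra, over the field
  with two elements: in row i the maps V_{i,l-2} -> U_l -> V_{i,l}, where U_l collects the neighbouring spaces
  and the frame, form a complex with injective first map, V_{i,l-2} may be enlarged to the kernel and
  V_{i,l} shrunk to the image, and p[i,l] = dim U_l - dim V_{i,l} - dim V_{i,l-2}.

  Rule (2): a nonzero submodule contains its socle degree, which lies outside J.
  Rule (3): M(R,J') is a union of i-strings. As (i,k) is lowest in its row, f_i uses z_{i,k} either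
  at the very start of a string or never, so M(R,J) meets each string in its highest weight element
  or in all of it, and in both cases the Demazure operator yields the full string.
  Finiteness: the weights of M(R) lie in the ball of radius |wt(R)| of the Weyl-invariant form
  sum <b^,x><b^,y> over all roots b, hence |S| is bounded.
*)
theory Submission
  imports Defs "HOL-Library.Z2" "HOL-Library.Function_Algebras"
begin

text \<open>That M(R) is a subcrystal, that \<open>S\<close> is unique and that M(R) is finite are
  not part of the definitions and have to be proved; finiteness matters because \<open>ch\<close> is
  a sum over a set and would be 0 on an infinite one. Submodules serve only as witnesses:
  \<open>fund_dim\<close> quantifies them away, so what counts is which dimension vectors occur. The
  field with two elements helps twice. The preprojective relation carries no signs, and every space
  is a finite set, so dimension estimates become inequalities between cardinalities that are powers
  of 2. Since \<open>S\<close> can be read off from the monomial, sets of monomials are replaced by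
  sets of multisets \<open>S\<close>, and truncating to \<open>J\<close> becomes
  \<open>set_mset S \<subseteq> J\<close>. The invariant form is only semidefinite when the centre
  of the group has positive dimension. It then bounds pairings with coroots but not the weights
  themselves, so finiteness goes from pairings to the size of \<open>S\<close>, and from there to a
  finite window of levels below \<open>R\<close>.\<close>

text \<open>The exponent of \<open>y\<^bsub>i,c\<^esub>\<close> in \<open>y\<^bsub>R\<^esub> z\<^bsub>S\<^esub>\<inverse>\<close>.\<close>

definition row_coeff ::
  "('r::finite, 'i::finite) crystal_datum \<Rightarrow> ('i \<times> int) multiset \<Rightarrow> ('i \<times> int) multiset \<Rightarrow> 'i \<Rightarrow> int \<Rightarrow> int"
  where "row_coeff D R S i c =
    int (count R (i, c)) + (\<Sum>j | adj D i j. int (count S (j, c - 1)))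
      - int (count S (i, c)) - int (count S (i, c - 2))"

lemma row_coeff_empty [simp]: "row_coeff D {#} {#} i c = 0"
  by (simp add: row_coeff_def)

lemma row_coeff_add: "row_coeff D (R + Q) (S + T) i c = row_coeff D R S i c + row_coeff D Q T i c"
  by (simp add: row_coeff_def sum.distrib)

text \<open>For \<open>R = {#x#}\<close> and a representation of dimension \<open>S\<close>, the two
  sums are the binary logarithms of the sizes of \<open>envelope D x V i l\<close> and of
  \<open>V i l\<close> times \<open>V i (l + 2)\<close>. The shift by 2 is the degree of the mesh
  map.\<close>

lemma row_coeff_plus_2:
  "row_coeff D R S i (l + 2) =
    int (count R (i, l + 2) + (\<Sum>j | adj D i j. count S (j, l + 1))) -
    int (count S (i, l) + count S (i, l + 2))"
  by (simp add: row_coeff_def algebra_simps)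


section \<open>Elementary abelian 2-groups\<close>

text \<open>Over the field with two elements closure under addition already gives a linear subspace;
  finiteness lets \<open>card\<close> stand in for the dimension.\<close>

definition bit_subspace :: "('a \<Rightarrow> bit) set \<Rightarrow> bool"
  where "bit_subspace V \<longleftrightarrow> finite V \<and> 0 \<in> V \<and> (\<forall>u\<in>V. \<forall>v\<in>V. u + v \<in> V)"

lemma bit_fun_add_self [simp]: "(v :: 'a \<Rightarrow> bit) + v = 0"
  by (rule ext) (simp add: plus_fun_def)

lemma bit_fun_add_cancel [simp]: "(v :: 'a \<Rightarrow> bit) + (v + u) = u"
  by (simp flip: add.assoc)

lemma bit_fun_add_cancel_right [simp]: "(u :: 'a \<Rightarrow> bit) + v + v = u"
  by (simp add: add.assoc)

lemma UNIV_bit: "(UNIV :: bit set) = {0, 1}"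
  by auto

instance bit :: finite
  by standard (simp add: UNIV_bit)

lemma bit_subspace_zero [simp]: "bit_subspace {0}"
  by (simp add: bit_subspace_def)

lemma bit_subspace_sum:
  assumes "bit_subspace V" "\<And>j. j \<in> A \<Longrightarrow> f j \<in> V"
  shows "sum f A \<in> V"
  using assms by (induction A rule: infinite_finite_induct) (auto simp: bit_subspace_def)

lemma bit_subspace_card_pos: "bit_subspace V \<Longrightarrow> card V > 0"
  by (auto simp: bit_subspace_def card_gt_0_iff)

text \<open>Adjoining one vector \<open>t\<close> adds exactly one coset \<open>t + V\<close>, since
  \<open>t + t = 0\<close>.\<close>

lemma bit_subspace_extend:
  assumes V: "bit_subspace V" and T: "bit_subspace T" and "V \<subset> T"
  obtains V' where "bit_subspace V'" "V \<subseteq> V'" "V' \<subseteq> T" "card V' = 2 * card V"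
proof -
  obtain t where t: "t \<in> T" "t \<notin> V" using \<open>V \<subset> T\<close> by blast
  let ?W = "(\<lambda>v. t + v) ` V"
  have disj: "V \<inter> ?W = {}"
  proof (rule ccontr)
    assume "V \<inter> ?W \<noteq> {}"
    then obtain v where v: "v \<in> V" "t + v \<in> V" by blast
    then have "(t + v) + v \<in> V" using V unfolding bit_subspace_def by blast
    with t show False by simp
  qed
  have inj: "inj_on (\<lambda>v. t + v) V" by (rule inj_onI) simp
  have fin: "finite V" using V by (simp add: bit_subspace_def)
  have card: "card (V \<union> ?W) = 2 * card V"
    using card_Un_disjoint[OF fin _ disj] fin card_image[OF inj] by simp
  have closed: "u + v \<in> V \<union> ?W" if "u \<in> V \<union> ?W" "v \<in> V \<union> ?W" for u v
  proof -
    have add: "a + b \<in> V" if "a \<in> V" "b \<in> V" for a b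
      using V that unfolding bit_subspace_def by blast
    have "\<exists>a\<in>V. u = a \<or> u = t + a" "\<exists>b\<in>V. v = b \<or> v = t + b" using that by auto
    then obtain a b where ab: "a \<in> V" "b \<in> V" "u = a \<or> u = t + a" "v = b \<or> v = t + b" by blast
    have "u + v = a + b \<or> u + v = t + (a + b)"
    proof -
      have "(t + a) + (t + b) = a + b"
      proof -
        have "(t + a) + (t + b) = t + (t + (a + b))" by (simp only: ac_simps)
        then show ?thesis by simp
      qed
      moreover have "a + (t + b) = t + (a + b)" by (simp only: ac_simps)
      moreover have "(t + a) + b = t + (a + b)" by (simp only: ac_simps)
      ultimately show ?thesis using ab(3,4) by metis
    qed
    then show ?thesis using add[OF ab(1,2)] by auto
  qed
  show thesis
  proof (rule that[of "V \<union> ?W"])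
    show "bit_subspace (V \<union> ?W)"
      using closed V unfolding bit_subspace_def by blast
    show "V \<union> ?W \<subseteq> T" using \<open>V \<subset> T\<close> T t unfolding bit_subspace_def by blast
  qed (use card in auto)
qed

text \<open>Repeated doubling upwards from \<open>B\<close> must reach \<open>V\<close>; the last
  subspace before \<open>V\<close> has index 2.\<close>

lemma bit_subspace_shrink:
  assumes "bit_subspace B" "bit_subspace V" "B \<subset> V"
  obtains V' where "bit_subspace V'" "B \<subseteq> V'" "V' \<subseteq> V" "card V = 2 * card V'"
proof -
  have "\<exists>V'. bit_subspace V' \<and> B \<subseteq> V' \<and> V' \<subseteq> V \<and> card V = 2 * card V'"
    using assms
  proof (induction "card V - card B" arbitrary: B rule: less_induct)
    case less
    obtain B' where B': "bit_subspace B'" "B \<subseteq> B'" "B' \<subseteq> V" "card B' = 2 * card B"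
      using bit_subspace_extend less.prems by metis
    show ?case
    proof (cases "B' = V")
      case True
      then show ?thesis using less.prems B' by blast
    next
      case False
      then have "B' \<subset> V" using B' by blast
      moreover have "finite V" using less.prems by (simp add: bit_subspace_def)
      ultimately have "card B' < card V" by (simp add: psubset_card_mono)
      moreover have "card B < card B'" using B' bit_subspace_card_pos[OF less.prems(1)] by simp
      ultimately have "card V - card B' < card V - card B" by simp
      from less.hyps[OF this B'(1) less.prems(2) \<open>B' \<subset> V\<close>] show ?thesis using B' by blast
    qed
  qed
  then show thesis using that by blast
qed

lemma bit_subspace_kernel:
  assumes "bit_subspace U" "\<And>u v. h (u + v) = h u + h v" "h 0 = (0 :: 'b \<Rightarrow> bit)"
  shows "bit_subspace {v \<in> U. h v = 0}"
  using assms by (auto simp: bit_subspace_def)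

lemma bit_subspace_image:
  assumes "bit_subspace U" "\<And>u v. h (u + v) = h u + h v" "h 0 = (0 :: 'b \<Rightarrow> bit)"
  shows "bit_subspace (h ` U)"
proof -
  have "0 \<in> h ` U" using assms(1,3) by (metis bit_subspace_def imageI)
  moreover have "a + b \<in> h ` U" if "a \<in> h ` U" "b \<in> h ` U" for a b
    using that assms(1,2) by (auto simp: bit_subspace_def simp flip: assms(2))
  ultimately show ?thesis using assms(1) by (simp add: bit_subspace_def)
qed

text \<open>Rank and nullity in multiplicative form: every nonempty fibre is a translate of the
  kernel. In characteristic 2 the translation is its own inverse.\<close>

lemma card_kernel_image:
  assumes U: "bit_subspace U" and add: "\<And>u v. h (u + v) = h u + h v"
    and zero: "h 0 = (0 :: 'b \<Rightarrow> bit)"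
  shows "card U = card {v \<in> U. h v = 0} * card (h ` U)"
proof -
  have fin: "finite U" using U by (simp add: bit_subspace_def)
  have fibre: "card {v \<in> U. h v = b} = card {v \<in> U. h v = 0}" if "b \<in> h ` U" for b
  proof -
    obtain u where u: "u \<in> U" "h u = b" using \<open>b \<in> h ` U\<close> by blast
    have "bij_betw (\<lambda>v. u + v) {v \<in> U. h v = b} {v \<in> U. h v = 0}"
    proof (rule bij_betw_byWitness[where f' = "\<lambda>v. u + v"])
      show "(\<lambda>v. u + v) ` {v \<in> U. h v = b} \<subseteq> {v \<in> U. h v = 0}"
        using u U add by (auto simp: bit_subspace_def)
      show "(\<lambda>v. u + v) ` {v \<in> U. h v = 0} \<subseteq> {v \<in> U. h v = b}"
        using u U add by (auto simp: bit_subspace_def)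
    qed auto
    then show ?thesis by (rule bij_betw_same_card)
  qed
  have "card U = (\<Sum>b\<in>h ` U. card {v \<in> U. h v = b})"
    using sum.image_gen[OF fin, of "\<lambda>_. 1::nat" h] by simp
  also have "\<dots> = (\<Sum>b\<in>h ` U. card {v \<in> U. h v = 0})" using fibre by (intro sum.cong) auto
  finally show ?thesis by (simp add: mult.commute)
qed


section \<open>Graded representations\<close>

text \<open>
  An element of the cofree module is a function on words: its value at \<open>[j\<^sub>1, \<dots>, j\<^sub>n]\<close> is the
  component in the frame after moving along the path through the vertices \<open>j\<^sub>1, \<dots>, j\<^sub>n\<close>.
  The arrow to the vertex \<open>j\<close> becomes \<open>shift j\<close>, and \<open>mesh\<close> is the preprojective relation, for
  which no signs are needed in characteristic 2. The envelope of \<open>V\<close> in degree \<open>(i, l)\<close> is the sum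
  of the frame and the neighbouring spaces in level \<open>l + 1\<close>.
\<close>

definition shift :: "'i \<Rightarrow> ('i list \<Rightarrow> bit) \<Rightarrow> 'i list \<Rightarrow> bit"
  where "shift j v = (\<lambda>w. v (j # w))"

definition mesh :: "('r::finite, 'i::finite) crystal_datum \<Rightarrow> 'i \<Rightarrow> ('i list \<Rightarrow> bit) \<Rightarrow> 'i list \<Rightarrow> bit"
  where "mesh D i v = (\<Sum>j | adj D i j. shift i (shift j v))"

definition envelope ::
  "('r::finite, 'i::finite) crystal_datum \<Rightarrow> 'i \<times> int \<Rightarrow> ('i \<Rightarrow> int \<Rightarrow> ('i list \<Rightarrow> bit) set) \<Rightarrow>
    'i \<Rightarrow> int \<Rightarrow> ('i list \<Rightarrow> bit) set"
  where "envelope D x V i l = {v.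
    ((i, l + 2) \<noteq> x \<longrightarrow> v [] = 0) \<and>
    (\<forall>j. adj D i j \<longrightarrow> shift j v \<in> V j (l + 1)) \<and> (\<forall>j. \<not> adj D i j \<longrightarrow> shift j v = 0)}"

text \<open>\<open>S\<close> is the graded dimension, stored as exponents of 2. The frame component
  is allowed only in degree \<open>(i, l)\<close> with \<open>x = (i, l + 2)\<close>; this offset is
  that of \<open>f_op\<close>, which reacts to an exponent at \<open>(i, F)\<close> with the inverse
  of \<open>zvar D (i, F - 2)\<close>.\<close>

definition is_rep ::
  "('r::finite, 'i::finite) crystal_datum \<Rightarrow> 'i \<times> int \<Rightarrow> ('i \<Rightarrow> int \<Rightarrow> ('i list \<Rightarrow> bit) set) \<Rightarrow>
    ('i \<times> int) multiset \<Rightarrow> bool"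
  where "is_rep D x V S \<longleftrightarrow> (\<forall>i l.
    bit_subspace (V i l) \<and> card (V i l) = 2 ^ count S (i, l) \<and>
    V i l \<subseteq> {v \<in> envelope D x V i l. mesh D i v = 0})"

lemma shift_add: "shift j (u + v) = shift j u + shift j v"
  by (simp add: shift_def plus_fun_def)

lemma shift_zero [simp]: "shift j 0 = 0"
  by (simp add: shift_def zero_fun_def)

lemma mesh_add: "mesh D i (u + v) = mesh D i u + mesh D i v"
  by (simp add: mesh_def shift_add sum.distrib)

lemma mesh_zero [simp]: "mesh D i 0 = 0"
  by (simp add: mesh_def)

text \<open>Cofreeness: an element whose frame component and arrows all vanish is zero, so each
  space embeds into its envelope.\<close>

lemma word_fun_eqI:
  assumes "u [] = v []" "\<And>j. shift j u = shift j v"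
  shows "u = v"
proof
  fix w show "u w = v w"
    using assms by (cases w) (auto simp: shift_def dest: fun_cong)
qed

text \<open>The envelope is the product of the frame, one bit or zero, with the neighbouring spaces:
  a function on words amounts to its value at the empty word together with its shifts.\<close>

lemma card_envelope:
  fixes D :: "('r::finite, 'i::finite) crystal_datum"
  assumes V: "\<And>j. bit_subspace (V j (l + 1))" and S: "\<And>j. card (V j (l + 1)) = 2 ^ count S (j, l + 1)"
  shows "card (envelope D x V i l) = 2 ^ (count {#x#} (i, l + 2) + (\<Sum>j | adj D i j. count S (j, l + 1)))"
    and "finite (envelope D x V i l)"
proof -
  let ?A = "{j. adj D i j}"
  define W where "W = (if (i, l + 2) = x then UNIV else {0 :: bit})"
  define f where "f v = (v [], \<lambda>j\<in>?A. shift j v)" for v :: "'i list \<Rightarrow> bit"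
  \<comment> \<open>The inverse of \<open>f\<close>: the empty word returns the frame bit, and a
    word \<open>j # t\<close> is read off the component at \<open>j\<close>. Letters that are not
    neighbours give 0, as the envelope demands.\<close>
  define g where "g = (\<lambda>(a :: bit, u :: 'i \<Rightarrow> 'i list \<Rightarrow> bit) w.
    case w of [] \<Rightarrow> a | j # t \<Rightarrow> if j \<in> ?A then u j t else 0)"
  have shift_g: "shift j (g (a, u)) = (if adj D i j then u j else 0)" for j a u
    by (rule ext) (simp add: g_def shift_def zero_fun_def)
  have g_Nil: "g (a, u) [] = a" for a u by (simp add: g_def)
  let ?P = "W \<times> PiE ?A (\<lambda>j. V j (l + 1))"
  have bij: "bij_betw f (envelope D x V i l) ?P"
  proof (rule bij_betw_byWitness[where f' = g])
    show "\<forall>v\<in>envelope D x V i l. g (f v) = v"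
    proof
      fix v assume v: "v \<in> envelope D x V i l"
      have "shift j (g (f v)) = shift j v" for j
        using v unfolding f_def shift_g by (simp add: envelope_def)
      then show "g (f v) = v" by (rule word_fun_eqI[rotated]) (simp add: f_def g_Nil)
    qed
    show "\<forall>y\<in>?P. f (g y) = y"
    proof (rule ballI, clarify)
      fix a u assume u: "u \<in> PiE ?A (\<lambda>j. V j (l + 1))"
      have "(\<lambda>j\<in>?A. shift j (g (a, u))) = u"
        unfolding shift_g using PiE_arb[OF u] by (intro ext) auto
      then show "f (g (a, u)) = (a, u)" unfolding f_def g_Nil by simp
    qed
    show "f ` envelope D x V i l \<subseteq> ?P"
    proof (rule image_subsetI)
      fix v assume v: "v \<in> envelope D x V i l"
      have "v [] \<in> W" using v by (simp add: envelope_def W_def)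
      moreover have "(\<lambda>j\<in>?A. shift j v) \<in> PiE ?A (\<lambda>j. V j (l + 1))"
        using v by (intro PiE_I) (auto simp: envelope_def)
      ultimately show "f v \<in> ?P" unfolding f_def by (rule SigmaI)
    qed
    show "g ` ?P \<subseteq> envelope D x V i l"
    proof (rule image_subsetI, clarify)
      fix a u assume a: "a \<in> W" and u: "u \<in> PiE ?A (\<lambda>j. V j (l + 1))"
      show "g (a, u) \<in> envelope D x V i l"
        using a PiE_mem[OF u] by (simp add: envelope_def shift_g g_Nil W_def split: if_splits)
    qed
  qed
  have "finite (V j (l + 1))" for j using V by (simp add: bit_subspace_def)
  then have "finite ?P" by (intro finite_cartesian_product finite_PiE) (auto simp: W_def)
  with bij show "finite (envelope D x V i l)" by (simp add: bij_betw_finite)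
  have bits: "card (UNIV :: bit set) = 2" by (simp add: UNIV_bit)
  have "card (envelope D x V i l) = card ?P" using bij by (rule bij_betw_same_card)
  also have "\<dots> = 2 ^ count {#x#} (i, l + 2) * (\<Prod>j\<in>?A. 2 ^ count S (j, l + 1))"
    using bits by (simp add: W_def card_cartesian_product card_PiE S)
  finally show "card (envelope D x V i l) = 2 ^ (count {#x#} (i, l + 2) + (\<Sum>j\<in>?A. count S (j, l + 1)))"
    by (simp add: power_add power_sum)
qed

lemma envelope_add:
  assumes "\<And>j. bit_subspace (V j (l + 1))" "u \<in> envelope D x V i l" "v \<in> envelope D x V i l"
  shows "u + v \<in> envelope D x V i l"
  using assms by (auto simp: envelope_def shift_add bit_subspace_def)

locale rep_setting =
  fixes D :: "('r::finite, 'i::finite) crystal_datum"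
  assumes adj_sym: "adj D i j \<Longrightarrow> adj D j i" and adj_irrefl: "\<not> adj D i i"
begin

lemma bit_subspace_envelope:
  assumes "is_rep D x V S"
  shows "bit_subspace (envelope D x V i l)"
proof -
  have "bit_subspace (V j (l + 1))" "card (V j (l + 1)) = 2 ^ count S (j, l + 1)" for j
    using assms by (auto simp: is_rep_def)
  then have "finite (envelope D x V i l)" "0 \<in> envelope D x V i l"
    using card_envelope(2)[of V l S D x i] by (auto simp: envelope_def bit_subspace_def)
  moreover have "u + v \<in> envelope D x V i l" if "u \<in> envelope D x V i l" "v \<in> envelope D x V i l" for u v
    using envelope_add[OF _ that] assms unfolding is_rep_def by blast
  ultimately show ?thesis by (simp add: bit_subspace_def)
qed

text \<open>Makes the mesh map the second arrow of the complex: an envelope element moves to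
  \<open>V j (l + 1)\<close>, and from there, adjacency being symmetric, into
  \<open>V i (l + 2)\<close>.\<close>

lemma mesh_envelope:
  assumes rep: "is_rep D x V S" and v: "v \<in> envelope D x V i l"
  shows "mesh D i v \<in> V i (l + 2)"
  unfolding mesh_def
proof (rule bit_subspace_sum)
  show "bit_subspace (V i (l + 2))" using rep by (simp add: is_rep_def)
  fix j assume "j \<in> {j. adj D i j}"
  then have j: "adj D i j" by simp
  then have "shift j v \<in> V j (l + 1)" using v by (auto simp: envelope_def)
  then have "shift j v \<in> envelope D x V j (l + 1)" using rep by (auto simp: is_rep_def)
  then have "adj D j i \<longrightarrow> shift i (shift j v) \<in> V i (l + 1 + 1)"
    unfolding envelope_def by blast
  with adj_sym[OF j] show "shift i (shift j v) \<in> V i (l + 2)" by (simp add: add.assoc )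
qed

lemma card_envelope_split:
  assumes rep: "is_rep D x V S"
  shows "2 ^ (count {#x#} (i, l + 2) + (\<Sum>j | adj D i j. count S (j, l + 1)))
    = card {v \<in> envelope D x V i l. mesh D i v = 0} * card (mesh D i ` envelope D x V i l)"
proof -
  have "card (envelope D x V i l) = 2 ^ (count {#x#} (i, l + 2) + (\<Sum>j | adj D i j. count S (j, l + 1)))"
    using rep by (intro card_envelope) (auto simp: is_rep_def)
  then show ?thesis
    using card_kernel_image[OF bit_subspace_envelope[OF rep, of i l], of "mesh D i"] by (simp add: mesh_add)
qed

text \<open>If \<open>V i l\<close> were the whole kernel, the envelope would have at most
  \<open>card (V i l) * card (V i (l + 2))\<close> elements, against the positive coefficient. So
  one more dimension fits inside the kernel.\<close>

lemma rep_lower: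
  assumes rep: "is_rep D x V S" and pos: "row_coeff D {#x#} S i (l + 2) > 0"
  shows "\<exists>V'. is_rep D x V' (add_mset (i, l) S)"
proof -
  let ?H = "envelope D x V i l"
  let ?K = "{v \<in> ?H. mesh D i v = 0}"
  have sub: "bit_subspace (V j m)" and card: "card (V j m) = 2 ^ count S (j, m)"
    and le: "V j m \<subseteq> {v \<in> envelope D x V j m. mesh D j v = 0}" for j m
    using rep by (auto simp: is_rep_def)
  have K: "bit_subspace ?K"
    by (intro bit_subspace_kernel bit_subspace_envelope[OF rep] mesh_add mesh_zero)
  have "V i l \<noteq> ?K"
  proof
    assume eq: "V i l = ?K"
    have "mesh D i ` ?H \<subseteq> V i (l + 2)" using mesh_envelope[OF rep] by blast
    then have "card (mesh D i ` ?H) \<le> 2 ^ count S (i, l + 2)"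
      using card_mono sub card by (metis bit_subspace_def)
    then have "2 ^ (count {#x#} (i, l + 2) + (\<Sum>j | adj D i j. count S (j, l + 1)))
        \<le> (2 :: nat) ^ (count S (i, l) + count S (i, l + 2))"
      using card_envelope_split[OF rep, of i l] card[of i l] eq by (simp add: power_add)
    then have "count {#x#} (i, l + 2) + (\<Sum>j | adj D i j. count S (j, l + 1))
        \<le> count S (i, l) + count S (i, l + 2)"
      by (subst (asm) power_increasing_iff) auto
    with pos show False unfolding row_coeff_plus_2 by linarith
  qed
  with le[of i l] have "V i l \<subset> ?K" by blast
  from bit_subspace_extend[OF sub K this]
  obtain V1 where V1: "bit_subspace V1" "V i l \<subseteq> V1" "V1 \<subseteq> ?K" "card V1 = 2 * card (V i l)" .
  define V' where "V' = V(i := (V i)(l := V1))"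
  have V'_same: "V' i l = V1" and V'_other: "(j, m) \<noteq> (i, l) \<Longrightarrow> V' j m = V j m" for j m
    by (auto simp: V'_def)
  have mono: "V j m \<subseteq> V' j m" for j m using V1 V'_same V'_other by (cases "(j, m) = (i, l)") auto
  \<comment> \<open>Enlarging a space only weakens the conditions on the spaces mapping into it,
    while the envelope in degree \<open>(i, l)\<close> depends on level \<open>l + 1\<close>
    alone.\<close>
  have envelope_mono: "envelope D x V j m \<subseteq> envelope D x V' j m" for j m
    using mono unfolding envelope_def by blast
  have "is_rep D x V' (add_mset (i, l) S)"
    unfolding is_rep_def
  proof (intro allI)
    fix j m
    show "bit_subspace (V' j m) \<and> card (V' j m) = 2 ^ count (add_mset (i, l) S) (j, m) \<and>
      V' j m \<subseteq> {v \<in> envelope D x V' j m. mesh D j v = 0}"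
    proof (cases "(j, m) = (i, l)")
      case True
      then have "V' j m \<subseteq> {v \<in> envelope D x V' j m. mesh D j v = 0}"
        using V1(3) V'_same envelope_mono[of i l] by blast
      then show ?thesis using True V1(1,4) V'_same card by simp
    next
      case False
      then have "V' j m \<subseteq> {v \<in> envelope D x V' j m. mesh D j v = 0}"
        using V'_other[OF False] le[of j m] envelope_mono[of j m] by blast
      then show ?thesis using False V'_other[OF False] sub card by auto
    qed
  qed
  then show ?thesis by blast
qed

lemma rep_raise:
  assumes rep: "is_rep D x V S" and neg: "row_coeff D {#x#} S i (l + 2) < 0"
  shows "(i, l + 2) \<in># S \<and> (\<exists>V'. is_rep D x V' (S - {#(i, l + 2)#}))"
proof -
  let ?H = "envelope D x V i l"
  let ?B = "mesh D i ` ?H"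
  have sub: "bit_subspace (V j m)" and card: "card (V j m) = 2 ^ count S (j, m)"
    and le: "V j m \<subseteq> {v \<in> envelope D x V j m. mesh D j v = 0}" for j m
    using rep by (auto simp: is_rep_def)
  have B: "bit_subspace ?B" by (intro bit_subspace_image bit_subspace_envelope[OF rep] mesh_add mesh_zero)
  have Bsub: "?B \<subseteq> V i (l + 2)" using mesh_envelope[OF rep] by blast
  have "?B \<noteq> V i (l + 2)"
  proof
    assume eq: "?B = V i (l + 2)"
    have "finite ?H" using bit_subspace_envelope[OF rep] by (auto simp: bit_subspace_def)
    then have "2 ^ count S (i, l) \<le> card {v \<in> ?H. mesh D i v = 0}"
      using card_mono[OF _ le[of i l]] card[of i l] by simp
    then have "(2 :: nat) ^ (count S (i, l) + count S (i, l + 2))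
        \<le> 2 ^ (count {#x#} (i, l + 2) + (\<Sum>j | adj D i j. count S (j, l + 1)))"
      using card_envelope_split[OF rep, of i l] card[of i "l + 2"] eq by (simp add: power_add)
    then have "count S (i, l) + count S (i, l + 2)
        \<le> count {#x#} (i, l + 2) + (\<Sum>j | adj D i j. count S (j, l + 1))"
      by (subst (asm) power_increasing_iff) auto
    with neg show False unfolding row_coeff_plus_2 by linarith
  qed
  with Bsub have "?B \<subset> V i (l + 2)" by blast
  from bit_subspace_shrink[OF B sub this]
  obtain V1 where V1: "bit_subspace V1" "?B \<subseteq> V1" "V1 \<subseteq> V i (l + 2)"
    "card (V i (l + 2)) = 2 * card V1" .
  have count: "count S (i, l + 2) > 0"
    using V1(4) card[of i "l + 2"] by (cases "count S (i, l + 2)") auto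
  define V' where "V' = V(i := (V i)(l + 2 := V1))"
  have V'_same: "V' i (l + 2) = V1" and V'_other: "(j, m) \<noteq> (i, l + 2) \<Longrightarrow> V' j m = V j m" for j m
    by (auto simp: V'_def)
  have V'_le: "V' j m \<subseteq> V j m" for j m using V1 V'_same V'_other by (cases "(j, m) = (i, l + 2)") auto
  \<comment> \<open>The delicate point of shrinking: arrows into degree \<open>(i, l + 2)\<close>
    must still land in the smaller space.\<close>
  have target: "v \<in> envelope D x V' j m" if v: "v \<in> V j m" for j m v
  proof -
    have vh: "v \<in> envelope D x V j m" using le v by blast
    have "shift k v \<in> V' k (m + 1)" if k: "adj D j k" for k
    proof (cases "(k, m + 1) = (i, l + 2)")
      case False
      then show ?thesis using vh k V'_other[OF False] by (auto simp: envelope_def)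
    next
      case True
      then have ki: "k = i" and m: "m = l + 1" by auto
      have ij: "adj D i j" using adj_sym k ki by simp
      \<comment> \<open>\<open>u\<close> has \<open>v\<close> as its component at \<open>j\<close>
        and zero elsewhere. Its mesh is the single arrow \<open>shift i v\<close>, which therefore
        lies in the image \<open>?B\<close> that was kept.\<close>
      define u where "u = (\<lambda>w. case w of [] \<Rightarrow> 0 | j' # t \<Rightarrow> if j' = j then v t else 0)"
      have su: "shift j' u = (if j' = j then v else 0)" for j'
        by (auto simp: u_def shift_def fun_eq_iff)
      have "u [] = 0" by (simp add: u_def)
      then have "u \<in> ?H" using su v m sub ij by (auto simp: envelope_def bit_subspace_def)
      moreover have "mesh D i u = shift i v"
      proof -
        have "mesh D i u = (\<Sum>j' | adj D i j'. if j' = j then shift i v else 0)"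
          unfolding mesh_def by (intro sum.cong) (auto simp: su)
        then show ?thesis using ij by simp
      qed
      ultimately have "shift i v \<in> ?B" by (metis imageI)
      then show ?thesis using V1 ki m V'_same by (auto simp: add.commute)
    qed
    then show ?thesis using vh unfolding envelope_def by auto
  qed
  have "is_rep D x V' (S - {#(i, l + 2)#})"
    unfolding is_rep_def
  proof (intro allI)
    fix j m
    have "V' j m \<subseteq> {v \<in> envelope D x V' j m. mesh D j v = 0}"
      using V'_le[of j m] le[of j m] target[of _ j m] by blast
    moreover have "card (V' j m) = 2 ^ count (S - {#(i, l + 2)#}) (j, m)"
    proof (cases "(j, m) = (i, l + 2)")
      case True
      then show ?thesis using V1(4) card[of i "l + 2"] count V'_same
        by (cases "count S (i, l + 2)") auto
    next
      case False
      then show ?thesis using V'_other[OF False] card by auto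
    qed
    moreover have "bit_subspace (V' j m)"
      using V1 V'_same V'_other sub by (cases "(j, m) = (i, l + 2)") auto
    ultimately show "bit_subspace (V' j m) \<and> card (V' j m) = 2 ^ count (S - {#(i, l + 2)#}) (j, m) \<and>
      V' j m \<subseteq> {v \<in> envelope D x V' j m. mesh D j v = 0}" by blast
  qed
  with count show ?thesis by auto
qed

lemma rep_empty: "is_rep D x (\<lambda>_ _. {0}) {#}"
  by (simp add: is_rep_def envelope_def)

text \<open>A nonzero element has a nonzero frame component or a nonzero arrow, by
  \<open>word_fun_eqI\<close>. All restrictions on the position of \<open>S\<close> come from
  this.\<close>

lemma rep_support:
  assumes rep: "is_rep D x V S" and S: "(i, l) \<in># S"
  shows "(i, l + 2) = x \<or> (\<exists>j. adj D i j \<and> (j, l + 1) \<in># S)"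
proof -
  have sub: "bit_subspace (V j m)" and card: "card (V j m) = 2 ^ count S (j, m)"
    and le: "V j m \<subseteq> {v \<in> envelope D x V j m. mesh D j v = 0}" for j m
    using rep by (auto simp: is_rep_def)
  have "count S (i, l) \<noteq> 0" using S by simp
  then have "card (V i l) \<noteq> 1" unfolding card by simp
  then have "V i l \<noteq> {0}" by auto
  then obtain v where v: "v \<in> V i l" "v \<noteq> 0" using sub[of i l] unfolding bit_subspace_def by blast
  have vh: "v \<in> envelope D x V i l" using v le by blast
  show ?thesis
  proof (cases "v [] = 0")
    case False
    then show ?thesis using vh by (auto simp: envelope_def)
  next
    case True
    then obtain j where j: "shift j v \<noteq> 0" using v(2) word_fun_eqI[of v 0] by force
    then have "adj D i j" "shift j v \<in> V j (l + 1)" using vh by (auto simp: envelope_def split: if_splits)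
    moreover have "(j, l + 1) \<in># S"
    proof (rule ccontr)
      assume "(j, l + 1) \<notin># S"
      then have "card (V j (l + 1)) = 1" using card by (simp add: not_in_iff)
      then obtain a where "V j (l + 1) = {a}" by (auto simp: card_1_singleton_iff)
      then show False using \<open>shift j v \<in> V j (l + 1)\<close> j sub[of j "l + 1"]
        by (auto simp: bit_subspace_def)
    qed
    ultimately show ?thesis by blast
  qed
qed

end


section \<open>Sums of fundamental representations\<close>

definition fund_dim :: "('r::finite, 'i::finite) crystal_datum \<Rightarrow> 'i \<times> int \<Rightarrow> ('i \<times> int) multiset \<Rightarrow> bool"
  where "fund_dim D x S \<longleftrightarrow> (\<exists>V. is_rep D x V S)"

text \<open>\<open>M\<close> attaches a submodule dimension to each element of \<open>R\<close>,
  counted with multiplicity. Single elements are used as frames although one fundamental weight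
  alone need not lie in P; weights are only assigned to the whole of \<open>R\<close>.\<close>

definition rep_dim ::
  "('r::finite, 'i::finite) crystal_datum \<Rightarrow> ('i \<times> int) multiset \<Rightarrow> ('i \<times> int) multiset \<Rightarrow> bool"
  where "rep_dim D R S \<longleftrightarrow> (\<exists>M. image_mset fst M = R \<and> (\<Sum>y\<in>#M. snd y) = S \<and>
    (\<forall>y\<in>#M. fund_dim D (fst y) (snd y)))"

lemma row_coeff_sum_mset:
  "row_coeff D (image_mset fst M) (\<Sum>y\<in>#M. snd y) i c = (\<Sum>y\<in>#M. row_coeff D {#fst y#} (snd y) i c)"
proof (induction M)
  case (add y M)
  have "row_coeff D (image_mset fst (add_mset y M)) (\<Sum>y\<in>#add_mset y M. snd y) i c
      = row_coeff D ({#fst y#} + image_mset fst M) (snd y + (\<Sum>y\<in>#M. snd y)) i c" by simp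
  also have "\<dots> = (\<Sum>y\<in>#add_mset y M. row_coeff D {#fst y#} (snd y) i c)"
    unfolding row_coeff_add using add by simp
  finally show ?case .
qed simp

lemma sum_mset_neg_imp:
  fixes f :: "'a \<Rightarrow> int"
  assumes "(\<Sum>y\<in>#M. f y) < 0"
  shows "\<exists>y\<in>#M. f y < 0"
  using assms by (induction M) (auto simp: not_less, fastforce)

lemma sum_mset_pos_imp:
  fixes f :: "'a \<Rightarrow> int"
  assumes "(\<Sum>y\<in>#M. f y) > 0"
  shows "\<exists>y\<in>#M. f y > 0"
  using assms by (induction M) (auto simp: not_less, fastforce)

lemma rep_dim_add_iff:
  "rep_dim D (R + Q) S \<longleftrightarrow> (\<exists>S1 S2. S = S1 + S2 \<and> rep_dim D R S1 \<and> rep_dim D Q S2)"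
proof
  assume "rep_dim D (R + Q) S"
  then obtain M where M: "image_mset fst M = R + Q" "(\<Sum>y\<in>#M. snd y) = S"
    "\<forall>y\<in>#M. fund_dim D (fst y) (snd y)" by (auto simp: rep_dim_def)
  obtain M1 M2 where split: "M = M1 + M2" "image_mset fst M1 = R" "image_mset fst M2 = Q"
    using image_mset_eq_plusD[OF M(1)] by blast
  show "\<exists>S1 S2. S = S1 + S2 \<and> rep_dim D R S1 \<and> rep_dim D Q S2"
  proof (intro exI conjI)
    show "S = (\<Sum>y\<in>#M1. snd y) + (\<Sum>y\<in>#M2. snd y)" using M(2) split(1) by simp
    show "rep_dim D R (\<Sum>y\<in>#M1. snd y)" "rep_dim D Q (\<Sum>y\<in>#M2. snd y)"
      unfolding rep_dim_def using M(3) split by auto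
  qed
next
  assume "\<exists>S1 S2. S = S1 + S2 \<and> rep_dim D R S1 \<and> rep_dim D Q S2"
  then obtain M1 M2 where "image_mset fst M1 = R" "image_mset fst M2 = Q"
    "S = (\<Sum>y\<in>#M1. snd y) + (\<Sum>y\<in>#M2. snd y)"
    "\<forall>y\<in>#M1. fund_dim D (fst y) (snd y)" "\<forall>y\<in>#M2. fund_dim D (fst y) (snd y)"
    by (auto simp: rep_dim_def)
  then show "rep_dim D (R + Q) S"
    unfolding rep_dim_def by (intro exI[of _ "M1 + M2"]) auto
qed

lemma rep_dim_empty_iff [simp]: "rep_dim D {#} S \<longleftrightarrow> S = {#}"
  by (auto simp: rep_dim_def)

context rep_setting
begin

lemma rep_dim_zero: "rep_dim D R {#}"
  unfolding rep_dim_def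
  by (intro exI[of _ "image_mset (\<lambda>x. (x, {#})) R"])
    (auto simp: fund_dim_def multiset.map_comp comp_def intro: rep_empty)

lemma rep_dim_lower:
  assumes "rep_dim D R S" "row_coeff D R S i l > 0"
  shows "rep_dim D R (add_mset (i, l - 2) S)"
proof -
  obtain M where M: "image_mset fst M = R" "(\<Sum>y\<in>#M. snd y) = S"
    "\<forall>y\<in>#M. fund_dim D (fst y) (snd y)" using assms(1) by (auto simp: rep_dim_def)
  have "(\<Sum>y\<in>#M. row_coeff D {#fst y#} (snd y) i l) > 0"
    using assms(2) row_coeff_sum_mset[of D M i l] M by simp
  from sum_mset_pos_imp[OF this] obtain x T where xT: "(x, T) \<in># M" "row_coeff D {#x#} T i l > 0" by auto
  obtain V where "is_rep D x V T" using M(3) xT(1) by (auto simp: fund_dim_def)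
  with rep_lower[of x V T i "l - 2"] xT have "fund_dim D x (add_mset (i, l - 2) T)"
    by (auto simp: fund_dim_def)
  moreover obtain M' where "M = add_mset (x, T) M'" using xT(1) by (metis insert_DiffM)
  ultimately show ?thesis
    unfolding rep_dim_def using M by (intro exI[of _ "add_mset (x, add_mset (i, l - 2) T) M'"]) auto
qed

lemma rep_dim_raise:
  assumes "rep_dim D R S" "row_coeff D R S i l < 0"
  shows "(i, l) \<in># S" "rep_dim D R (S - {#(i, l)#})"
proof -
  obtain M where M: "image_mset fst M = R" "(\<Sum>y\<in>#M. snd y) = S"
    "\<forall>y\<in>#M. fund_dim D (fst y) (snd y)" using assms(1) by (auto simp: rep_dim_def)
  have "(\<Sum>y\<in>#M. row_coeff D {#fst y#} (snd y) i l) < 0"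
    using assms(2) row_coeff_sum_mset[of D M i l] M by simp
  from sum_mset_neg_imp[OF this] obtain x T where xT: "(x, T) \<in># M" "row_coeff D {#x#} T i l < 0" by auto
  obtain V where "is_rep D x V T" using M(3) xT(1) by (auto simp: fund_dim_def)
  with rep_raise[of x V T i "l - 2"] xT have T: "(i, l) \<in># T" "fund_dim D x (T - {#(i, l)#})"
    by (auto simp: fund_dim_def)
  obtain M' where M': "M = add_mset (x, T) M'" using xT(1) by (metis insert_DiffM)
  then show "(i, l) \<in># S" using M(2) T(1) by auto
  have "S = T + (\<Sum>y\<in>#M'. snd y)" using M(2) M' by simp
  then have "S - {#(i, l)#} = (T - {#(i, l)#}) + (\<Sum>y\<in>#M'. snd y)"
    using T(1) by (metis insert_DiffM add_mset_remove_trivial union_mset_add_mset_left)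
  then show "rep_dim D R (S - {#(i, l)#})"
    unfolding rep_dim_def using M M' T
    by (intro exI[of _ "add_mset (x, T - {#(i, l)#}) M'"]) auto
qed

section \<open>Where a dimension vector can be supported\<close>

lemma rep_dim_support:
  assumes "rep_dim D R S" "(i, l) \<in># S"
  shows "(i, l + 2) \<in># R \<or> (\<exists>j. adj D i j \<and> (j, l + 1) \<in># S)"
proof -
  obtain M where M: "image_mset fst M = R" "(\<Sum>y\<in>#M. snd y) = S"
    "\<forall>y\<in>#M. fund_dim D (fst y) (snd y)" using assms(1) by (auto simp: rep_dim_def)
  have S: "z \<in># S \<longleftrightarrow> (\<exists>y\<in>#M. z \<in># snd y)" for z
    unfolding M(2)[symmetric] by (induction M) auto
  obtain x T where xT: "(x, T) \<in># M" "(i, l) \<in># T" using assms(2) S by auto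
  obtain V where "is_rep D x V T" using M(3) xT(1) by (auto simp: fund_dim_def)
  from rep_support[OF this xT(2)] have "(i, l + 2) = x \<or> (\<exists>j. adj D i j \<and> (j, l + 1) \<in># T)" .
  moreover have "x \<in># R" using M(1) xT(1) by force
  ultimately show ?thesis using S xT(1) by force
qed

text \<open>The levels occurring in \<open>S\<close> are bounded above, so one may induct towards the frame.\<close>

lemma rep_dim_support_induct [consumes 2, case_names base step]:
  assumes "rep_dim D R S" "(i, l) \<in># S"
    and "\<And>i l. (i, l) \<in># S \<Longrightarrow> (i, l + 2) \<in># R \<Longrightarrow> P i l"
    and "\<And>i l j. (i, l) \<in># S \<Longrightarrow> adj D i j \<Longrightarrow> (j, l + 1) \<in># S \<Longrightarrow> P j (l + 1) \<Longrightarrow> P i l"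
  shows "P i l"
proof -
  define N where "N = (\<Sum>y\<in>set_mset S. nat \<bar>snd y\<bar>)"
  have bound: "l' \<le> int N" if "(i', l') \<in># S" for i' l'
  proof -
    have "nat \<bar>snd (i', l')\<bar> \<le> N"
      unfolding N_def using that by (intro member_le_sum) auto
    then show ?thesis by simp
  qed
  show ?thesis using assms(2)
  proof (induction "nat (int N - l)" arbitrary: i l rule: less_induct)
    case less
    consider "(i, l + 2) \<in># R" | j where "adj D i j" "(j, l + 1) \<in># S"
      using rep_dim_support[OF assms(1) less.prems] by blast
    then show ?case
    proof cases
      case 1
      then show ?thesis using assms(3) less.prems by blast
    next
      case 2
      have "P j (l + 1)" using less.hyps[OF _ 2(2)] bound[OF 2(2)] by linarith
      then show ?thesis using assms(4) less.prems 2 by blast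
    qed
  qed
qed

text \<open>Following nonzero arrows upwards from any occupied degree ends just below the
  frame.\<close>

lemma rep_dim_socle:
  assumes "rep_dim D R S" "S \<noteq> {#}"
  shows "\<exists>i l. (i, l) \<in># S \<and> (i, l + 2) \<in># R"
proof -
  obtain i l where "(i, l) \<in># S" using assms(2) by (metis multiset_nonemptyE surj_pair)
  with assms(1) show ?thesis by (induction rule: rep_dim_support_induct) auto
qed

lemma rep_dim_level_le:
  assumes "rep_dim D R S" "(i, l) \<in># S"
  shows "\<exists>x\<in>#R. l + 2 \<le> snd x"
  using assms by (induction rule: rep_dim_support_induct) force+

text \<open>The levels below the frame are occupied without gaps.\<close>

lemma rep_dim_level_ge:
  assumes "rep_dim D R S" "(i, l) \<in># S"
  shows "\<exists>x\<in>#R. snd x \<le> l + 1 + int (size S)"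
proof -
  \<comment> \<open>Strengthened for the induction: all \<open>snd x - 1 - l\<close> levels from
    \<open>l\<close> to \<open>snd x - 2\<close> are occupied, and their number is at most the size
    of \<open>S\<close>.\<close>
  have "\<exists>x\<in>#R. l + 2 \<le> snd x \<and> {l..snd x - 2} \<subseteq> snd ` set_mset S"
    using assms
  proof (induction rule: rep_dim_support_induct)
    case (base i l)
    then show ?case by (intro bexI[of _ "(i, l + 2)"]) force+
  next
    case (step i l j)
    then obtain x where x: "x \<in># R" "l + 1 + 2 \<le> snd x" "{l + 1..snd x - 2} \<subseteq> snd ` set_mset S" by blast
    have "{l..snd x - 2} = insert l {l + 1..snd x - 2}" using x(2) by auto
    moreover have "l \<in> snd ` set_mset S" using step(1) by force
    ultimately show ?case using x by (intro bexI[of _ x]) auto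
  qed
  then obtain x where x: "x \<in># R" "l + 2 \<le> snd x" "{l..snd x - 2} \<subseteq> snd ` set_mset S" by blast
  have "card {l..snd x - 2} \<le> card (set_mset S)"
    using card_mono[OF _ x(3)] card_image_le[of "set_mset S" snd] by simp
  also have "card (set_mset S) = (\<Sum>y\<in>set_mset S. 1)" by simp
  also have "\<dots> \<le> size S"
    unfolding size_multiset_overloaded_eq by (intro sum_mono) (simp add: Suc_le_eq)
  finally show ?thesis using x by (intro bexI[of _ x]) auto
qed

end

lemma finite_bounded_msets:
  assumes "finite A"
  shows "finite {S. set_mset S \<subseteq> A \<and> size S \<le> n}"
proof -
  have "{S. set_mset S \<subseteq> A \<and> size S \<le> n} \<subseteq> mset ` {xs. set xs \<subseteq> A \<and> length xs \<le> n}"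
  proof
    fix S assume "S \<in> {S. set_mset S \<subseteq> A \<and> size S \<le> n}"
    moreover obtain xs where "S = mset xs" by (metis ex_mset)
    ultimately show "S \<in> mset ` {xs. set xs \<subseteq> A \<and> length xs \<le> n}" by auto
  qed
  then show ?thesis using finite_lists_length_le[OF assms] finite_surj by blast
qed

text \<open>The two level bounds confine \<open>S\<close> to a finite window around the levels of
  \<open>R\<close> once its size is bounded.\<close>

lemma (in rep_setting) finite_rep_dim_if_bounded:
  assumes bound: "\<And>S. rep_dim D R S \<Longrightarrow> size S \<le> n"
  shows "finite {S. rep_dim D R S}"
proof -
  define A where "A = (UNIV :: 'i set) \<times> {Min (snd ` set_mset R) - 1 - int n..Max (snd ` set_mset R)}"
  have "set_mset S \<subseteq> A" if S: "rep_dim D R S" for S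
  proof
    fix y assume "y \<in> set_mset S"
    then obtain i l where y: "y = (i, l)" "(i, l) \<in># S" by (metis surj_pair)
    obtain x x' where x: "x \<in># R" "l + 2 \<le> snd x" "x' \<in># R" "snd x' \<le> l + 1 + int (size S)"
      using rep_dim_level_le[OF S y(2)] rep_dim_level_ge[OF S y(2)] by blast
    have "snd x \<le> Max (snd ` set_mset R)" "Min (snd ` set_mset R) \<le> snd x'"
      using x by (intro Max_ge Min_le; simp)+
    then have "Min (snd ` set_mset R) - 1 - int n \<le> l" "l \<le> Max (snd ` set_mset R)"
      using x(2,4) bound[OF S] by linarith+
    then show "y \<in> A" by (simp add: A_def y(1))
  qed
  then have "{S. rep_dim D R S} \<subseteq> {S. set_mset S \<subseteq> A \<and> size S \<le> n}" using bound by blast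
  moreover have "finite A" by (simp add: A_def)
  ultimately show ?thesis using finite_bounded_msets finite_subset by blast
qed


section \<open>Monomials\<close>

lemma wt_simps [simp]:
  "wt (p * q) = wt p + wt q" "wt (inverse p) = - wt p" "wt 1 = 0"
  "wt (wexp \<mu>) = \<mu>" "wt (yvar x) = 0"
  by (simp_all add: times_monomial_def inverse_monomial_def one_monomial_def wexp_def yvar_def)

lemma expn_simps [simp]:
  "expn (p * q) i c = expn p i c + expn q i c" "expn (inverse p) i c = - expn p i c"
  "expn 1 i c = 0" "expn (wexp \<mu>) i c = 0" "expn (yvar x) i c = of_bool (x = (i, c))"
  by (simp_all add: expn_def times_monomial_def inverse_monomial_def one_monomial_def wexp_def
      yvar_def lookup_add lookup_single when_def)

lemma wt_prod: "wt (prod f A) = (\<Sum>a\<in>A. wt (f a))"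
  by (induction A rule: infinite_finite_induct) auto

lemma expn_prod: "expn (prod f A) i c = (\<Sum>a\<in>A. expn (f a) i c)"
  by (induction A rule: infinite_finite_induct) auto

lemma monomial_eqI:
  assumes "wt p = wt q" "\<And>i c. expn p i c = expn q i c"
  shows "p = q"
  using assms by (cases p; cases q) (auto simp: expn_def intro!: poly_mapping_eqI)

lemma monomial_cancel [simp]:
  "p * inverse q * q = (p :: ('r::finite, 'i) monomial)" "p * q * inverse q = p"
  by (auto intro: monomial_eqI)

lemma finite_expn [simp]: "finite {c. expn p i c \<noteq> 0}"
proof -
  have "{c. expn p i c \<noteq> 0} \<subseteq> snd ` Poly_Mapping.keys (expo p)"
    by (force simp: expn_def in_keys_iff)
  then show ?thesis by (rule finite_subset) simp
qed

definition row_sum :: "('r::finite, 'i) monomial \<Rightarrow> 'i \<Rightarrow> int"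
  where "row_sum p i = (\<Sum>c | expn p i c \<noteq> 0. expn p i c)"

text \<open>The index set of nonzero exponents varies with the monomial; a common finite superset
  makes these sums additive in \<open>p\<close>.\<close>

lemma sum_expn_superset:
  assumes "finite A" "{c. Q c \<and> expn p i c \<noteq> 0} \<subseteq> A"
  shows "(\<Sum>c | Q c \<and> expn p i c \<noteq> 0. expn p i c) = (\<Sum>c\<in>A. if Q c then expn p i c else 0)"
proof -
  have "(\<Sum>c\<in>A. if Q c then expn p i c else 0)
      = (\<Sum>c\<in>{c. Q c \<and> expn p i c \<noteq> 0}. if Q c then expn p i c else 0)"
    using assms by (intro sum.mono_neutral_right) auto
  also have "\<dots> = (\<Sum>c | Q c \<and> expn p i c \<noteq> 0. expn p i c)" by (intro sum.cong) auto
  finally show ?thesis by simp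
qed

lemma sum_expn_times:
  "(\<Sum>c | Q c \<and> expn (p * q) i c \<noteq> 0. expn (p * q) i c) =
    (\<Sum>c | Q c \<and> expn p i c \<noteq> 0. expn p i c) + (\<Sum>c | Q c \<and> expn q i c \<noteq> 0. expn q i c)"
proof -
  let ?A = "{c. expn p i c \<noteq> 0} \<union> {c. expn q i c \<noteq> 0}"
  have A: "finite ?A" by simp
  have "(\<Sum>c\<in>?A. if Q c then expn (p * q) i c else 0)
      = (\<Sum>c\<in>?A. if Q c then expn p i c else 0) + (\<Sum>c\<in>?A. if Q c then expn q i c else 0)"
    unfolding sum.distrib[symmetric] by (intro sum.cong) auto
  moreover have "{c. Q c \<and> expn (p * q) i c \<noteq> 0} \<subseteq> ?A" "{c. Q c \<and> expn p i c \<noteq> 0} \<subseteq> ?A"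
    "{c. Q c \<and> expn q i c \<noteq> 0} \<subseteq> ?A" by auto
  note this[THEN sum_expn_superset[OF A]]
  ultimately show ?thesis by simp
qed

lemma row_sum_simps [simp]:
  "row_sum (p * q) i = row_sum p i + row_sum q i" "row_sum (inverse p) i = - row_sum p i"
  "row_sum 1 i = 0" "row_sum (wexp \<mu>) i = 0"
proof -
  show "row_sum (p * q) i = row_sum p i + row_sum q i"
    using sum_expn_times[where Q = "\<lambda>_. True" and p = p and q = q and i = i] by (simp add: row_sum_def)
qed (simp_all add: row_sum_def sum_negf)

lemma row_sum_yvar [simp]: "row_sum (yvar x) i = of_bool (fst x = i)"
proof -
  have "{c. expn (yvar x) i c \<noteq> 0} = (if fst x = i then {snd x} else {})" by (cases x) auto
  then show ?thesis by (cases x) (simp add: row_sum_def)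
qed

lemma row_sum_prod: "row_sum (prod f A) i = (\<Sum>a\<in>A. row_sum (f a) i)"
  by (induction A rule: infinite_finite_induct) auto

lemma wt_zvar [simp]: "wt (zvar D x) = simple_root D (fst x)"
  by (cases x) (simp add: zvar_def wt_prod)

lemma z_mset_alt: "z_mset D S = prod_mset (image_mset (zvar D) S)"
  by (simp only: z_mset_def image_prod_mset_multiplicity)

lemma z_mset_simps [simp]:
  "z_mset D {#} = 1" "z_mset D (add_mset x S) = zvar D x * z_mset D S"
  by (simp_all add: z_mset_alt)

lemma z_mset_add: "z_mset D (S + T) = z_mset D S * z_mset D T"
  by (simp add: z_mset_alt)

lemma wt_z_mset: "wt (z_mset D S) = (\<Sum>x\<in>#S. simple_root D (fst x))"
  by (induction S) auto

lemma y_mset_alt: "y_mset D R = wexp (mset_wt D R) * prod_mset (image_mset yvar R)"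
  by (simp add: y_mset_def image_prod_mset_multiplicity)

lemma wt_y_mset [simp]: "wt (y_mset D R) = mset_wt D R"
proof -
  have "wt (prod_mset (image_mset yvar R)) = 0" by (induction R) auto
  then show ?thesis by (simp add: y_mset_alt)
qed

lemma expn_y_mset [simp]: "expn (y_mset D R) i c = int (count R (i, c))"
proof -
  have "expn (prod_mset (image_mset yvar R)) i c = int (count R (i, c))"
    by (induction R) auto
  then show ?thesis by (simp add: y_mset_alt)
qed

lemma row_sum_y_mset [simp]: "row_sum (y_mset D R) i = int (size {#x \<in># R. fst x = i#})"
proof -
  have "row_sum (prod_mset (image_mset yvar R)) i = int (size {#x \<in># R. fst x = i#})"
    by (induction R) auto
  then show ?thesis by (simp add: y_mset_alt)
qed

definition rep_monomial ::
  "('r::finite, 'i::finite) crystal_datum \<Rightarrow> ('i \<times> int) multiset \<Rightarrow> ('i \<times> int) multiset \<Rightarrow> ('r, 'i) monomial"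
  where "rep_monomial D R S = y_mset D R * inverse (z_mset D S)"

lemma rep_monomial_lower:
  "rep_monomial D R (add_mset x S) = rep_monomial D R S * inverse (zvar D x)"
  by (rule monomial_eqI) (simp_all add: rep_monomial_def)

lemma rep_monomial_raise:
  assumes "x \<in># S"
  shows "rep_monomial D R (S - {#x#}) = rep_monomial D R S * zvar D x"
  using rep_monomial_lower[of D R x "S - {#x#}"] assms by simp


section \<open>Weights\<close>

lemma pairing_add [simp]: "pairing h (\<mu> + \<nu>) = pairing h \<mu> + pairing h \<nu>"
  and pairing_uminus [simp]: "pairing h (- \<mu>) = - pairing h \<mu>"
  and pairing_zero [simp]: "pairing h 0 = 0"
  and pairing_diff [simp]: "pairing h (\<mu> - \<nu>) = pairing h \<mu> - pairing h \<nu>"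
  and pairing_scale [simp]: "pairing h (a *s \<mu>) = a * pairing h \<mu>"
  by (simp_all add: pairing_def algebra_simps sum.distrib sum_negf sum_subtractf sum_distrib_left)

lemma pairing_left [simp]:
  "pairing (g - h) \<mu> = pairing g \<mu> - pairing h \<mu>" "pairing (a *s h) \<mu> = a * pairing h \<mu>"
  by (simp_all add: pairing_def algebra_simps sum_subtractf sum_distrib_left)

lemma rat_pairing_add [simp]: "rat_pairing h (u + v) = rat_pairing h u + rat_pairing h v"
  and rat_pairing_zero [simp]: "rat_pairing h 0 = 0"
  by (simp_all add: rat_pairing_def algebra_simps sum.distrib)

lemma rat_pairing_to_rat: "rat_pairing h (to_rat \<mu>) = of_int (pairing h \<mu>)"
  by (simp add: rat_pairing_def to_rat_def pairing_def)

lemma to_rat_add: "to_rat (\<mu> + \<nu>) = to_rat \<mu> + to_rat \<nu>"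
  and to_rat_zero [simp]: "to_rat 0 = 0"
  by (simp_all add: to_rat_def vec_eq_iff)

lemma to_rat_inject [simp]: "to_rat \<mu> = to_rat \<nu> \<longleftrightarrow> \<mu> = \<nu>"
  by (simp add: to_rat_def vec_eq_iff)

lemma to_rat_lattice_elt: "in_weight_lattice v \<Longrightarrow> to_rat (lattice_elt v) = v"
  by (auto simp: in_weight_lattice_def lattice_elt_def)

lemma in_weight_lattice_add: "in_weight_lattice u \<Longrightarrow> in_weight_lattice v \<Longrightarrow> in_weight_lattice (u + v)"
  unfolding in_weight_lattice_def by (auto simp flip: to_rat_add)

lemma in_weight_lattice_sum:
  "(\<And>x. x \<in> A \<Longrightarrow> in_weight_lattice (f x)) \<Longrightarrow> in_weight_lattice (sum f A)"
proof (induction A rule: infinite_finite_induct)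
  case (insert x A)
  then show ?case by (simp add: in_weight_lattice_add)
qed (auto simp: in_weight_lattice_def intro: image_eqI[of _ _ 0])

text \<open>Additive in \<open>R\<close> without any integrality; \<open>mset_wt\<close> inherits
  this through the injective \<open>to_rat\<close>.\<close>

definition rat_wt :: "('r::finite, 'i) crystal_datum \<Rightarrow> ('i \<times> int) multiset \<Rightarrow> rat ^ 'r"
  where "rat_wt D R = (\<Sum>x\<in>#R. fund_weight D (fst x))"

lemma rat_wt_eq_sum:
  "rat_wt D R = (\<Sum>(i, c)\<in>set_mset R. of_nat (count R (i, c)) *s fund_weight D i)"
proof -
  have "(\<Sum>x\<in>#R. f x) = (\<Sum>x\<in>A. of_nat (count R x) *s f x)"
    if "finite A" "set_mset R \<subseteq> A" for A and f :: "'b \<times> int \<Rightarrow> rat ^ 'a"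
    using that(2)
  proof (induction R)
    case (add y R)
    have "(\<Sum>x\<in>A. of_nat (count (add_mset y R) x) *s f x)
        = (\<Sum>x\<in>A. of_nat (count R x) *s f x + (if x = y then f x else 0))"
      by (intro sum.cong) (auto simp: vec_eq_iff algebra_simps)
    also have "\<dots> = (\<Sum>x\<in>A. of_nat (count R x) *s f x) + f y"
      using add.prems that(1) by (simp add: sum.distrib)
    finally show ?case using add by (simp add: add.commute)
  qed simp
  from this[of "set_mset R"] show ?thesis by (simp add: rat_wt_def case_prod_unfold)
qed

lemma mset_wt_eq: "mset_wt D R = lattice_elt (rat_wt D R)"
  by (simp add: mset_wt_def rat_wt_eq_sum)

lemma admissible_in_weight_lattice:
  assumes "admissible D R"
  shows "in_weight_lattice (rat_wt D R)"
  unfolding rat_wt_eq_sum using assms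
  by (intro in_weight_lattice_sum) (auto simp: admissible_def)

lemma to_rat_mset_wt: "admissible D R \<Longrightarrow> to_rat (mset_wt D R) = rat_wt D R"
  by (simp add: mset_wt_eq to_rat_lattice_elt admissible_in_weight_lattice)

lemma admissible_parity: "admissible D R \<Longrightarrow> set_mset R \<subseteq> parity_pairs D"
  by (simp add: admissible_def)

lemma admissible_empty: "admissible D {#}"
  by (auto simp: admissible_def in_weight_lattice_def intro: image_eqI[of _ _ 0])

lemma admissible_filter: "admissible D R \<Longrightarrow> admissible D (filter_mset P R)"
  using admissible_empty[of D] by (auto simp: admissible_def)

lemma admissible_add:
  assumes "admissible D R" "admissible D Q"
  shows "admissible D (R + Q)"
  unfolding admissible_def
proof (intro conjI ballI, goal_cases)
  case (2 x)
  obtain i c where x: "x = (i, c)" by (cases x)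
  have "of_nat (count (R + Q) (i, c)) *s fund_weight D i =
      of_nat (count R (i, c)) *s fund_weight D i + of_nat (count Q (i, c)) *s fund_weight D i"
    by (simp add: vec_eq_iff algebra_simps)
  moreover have "in_weight_lattice (of_nat (count R (i, c)) *s fund_weight D i)"
    "in_weight_lattice (of_nat (count Q (i, c)) *s fund_weight D i)"
    using 2 assms unfolding admissible_def x by blast+
  ultimately show ?case unfolding x prod.case by (metis in_weight_lattice_add)
qed (use assms in \<open>auto simp: admissible_def\<close>)

lemma mset_wt_add:
  assumes "admissible D R" "admissible D Q"
  shows "mset_wt D (R + Q) = mset_wt D R + mset_wt D Q"
proof -
  have "to_rat (mset_wt D (R + Q)) = to_rat (mset_wt D R + mset_wt D Q)"
    using assms admissible_add[OF assms] by (simp add: to_rat_mset_wt to_rat_add rat_wt_def)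
  then show ?thesis by simp
qed

lemma mset_wt_empty [simp]: "mset_wt D {#} = 0"
proof -
  have "to_rat (mset_wt D {#}) = to_rat 0"
    using to_rat_mset_wt[OF admissible_empty, of D] by (simp add: rat_wt_def)
  then show ?thesis by (simp only: to_rat_inject)
qed

lemma rep_monomial_empty [simp]: "rep_monomial D {#} {#} = 1"
  by (rule monomial_eqI) (simp_all add: rep_monomial_def)

lemma rep_monomial_add:
  assumes "admissible D R" "admissible D Q"
  shows "rep_monomial D (R + Q) (S + T) = rep_monomial D R S * rep_monomial D Q T"
  by (rule monomial_eqI) (simp_all add: rep_monomial_def mset_wt_add[OF assms] z_mset_add)

section \<open>Monomials over a simply laced based root datum\<close>

locale simply_laced_datum =
  fixes D :: "('r::finite, 'i::finite) crystal_datum"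
  assumes based: "based_root_datum D"
    and laced: "simply_laced D"
    and coloured: "two_colouring D"
    and weights: "fundamental_weights D"
begin

sublocale rep_setting D
proof
  show "adj D i j \<Longrightarrow> adj D j i" for i j using laced by (auto simp: adj_def simply_laced_def)
  show "\<not> adj D i i" for i using coloured by (auto simp: two_colouring_def)
qed

lemma adj_parity: "adj D i j \<Longrightarrow> even_vertex D i \<longleftrightarrow> \<not> even_vertex D j"
  using coloured by (auto simp: two_colouring_def)

lemma simple_root_in_roots: "simple_root D i \<in> roots D"
  using based by (auto simp: based_root_datum_def)

lemma root_datum: "root_datum D"
  using based by (simp add: based_root_datum_def reduced_root_datum_def)

lemma cartan_diag [simp]: "cartan D i i = 2"
  using root_datum simple_root_in_roots[of i] unfolding root_datum_def cartan_def simple_coroot_def by blast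

lemma cartan_eq: "cartan D i j = 2 * of_bool (i = j) - of_bool (adj D i j)"
proof (cases "i = j")
  case False
  then have "cartan D i j \<in> {0, -1}" using laced by (simp add: simply_laced_def)
  then show ?thesis using False by (auto simp: adj_def)
qed (simp add: adj_irrefl)

lemma expn_zvar:
  "expn (zvar D (i, k)) j c = of_bool (j = i \<and> c = k) + of_bool (j = i \<and> c = k + 2)
    - of_bool (adj D j i \<and> c = k + 1)"
proof -
  have "(\<Sum>j' | adj D j' i. of_bool (j' = j \<and> k + 1 = c) :: int) =
      (\<Sum>j' | adj D j' i. if j' = j then of_bool (k + 1 = c) else 0)"
    by (intro sum.cong) auto
  also have "\<dots> = of_bool (adj D j i \<and> c = k + 1)" by auto
  finally show ?thesis by (auto simp: zvar_def expn_prod sum_negf)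
qed

lemma expn_z_mset:
  "expn (z_mset D S) i c = int (count S (i, c)) + int (count S (i, c - 2))
    - (\<Sum>j | adj D i j. int (count S (j, c - 1)))"
proof (induction S)
  case (add x S)
  obtain j k where x: "x = (j, k)" by (cases x)
  have "(\<Sum>j' | adj D i j'. int (count (add_mset x S) (j', c - 1))) =
      (\<Sum>j' | adj D i j'. int (count S (j', c - 1)) + (if j' = j then of_bool (c = k + 1) else 0))"
    by (intro sum.cong) (auto simp: x)
  also have "\<dots> = (\<Sum>j' | adj D i j'. int (count S (j', c - 1))) + of_bool (adj D i j \<and> c = k + 1)"
    by (auto simp: sum.distrib)
  finally show ?case using add by (auto simp: x expn_zvar)
qed simp

lemma expn_rep_monomial: "expn (rep_monomial D R S) i c = row_coeff D R S i c"
  by (simp add: rep_monomial_def row_coeff_def expn_z_mset)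

text \<open>At the lowest level \<open>l\<close> where \<open>S\<close> and \<open>T\<close> differ,
  the exponent at \<open>(i, l)\<close> involves, besides \<open>(i, l)\<close>, only levels
  \<open>l - 1\<close> and \<open>l - 2\<close>, where they agree.\<close>

lemma rep_monomial_inject:
  assumes "rep_monomial D R S = rep_monomial D R T"
  shows "S = T"
proof (rule ccontr)
  assume "S \<noteq> T"
  define X where "X = {x \<in> set_mset S \<union> set_mset T. count S x \<noteq> count T x}"
  have "X \<noteq> {}" using \<open>S \<noteq> T\<close> by (force simp: X_def multiset_eq_iff not_in_iff)
  moreover have "finite X" by (simp add: X_def)
  ultimately have "Min (snd ` X) \<in> snd ` X" "\<forall>y\<in>X. Min (snd ` X) \<le> snd y" by auto
  then obtain x where x: "x \<in> X" "\<And>y. y \<in> X \<Longrightarrow> snd x \<le> snd y" by (metis imageE)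
  obtain i l where il: "x = (i, l)" by (cases x)
  have below: "count S (j, k) = count T (j, k)" if "k < l" for j k
  proof -
    have "(j, k) \<notin> X" using x(2)[of "(j, k)"] that il by auto
    then show ?thesis by (auto simp: X_def not_in_iff)
  qed
  have "row_coeff D R S i l = row_coeff D R T i l"
    using assms by (metis expn_rep_monomial)
  then have "count S (i, l) = count T (i, l)" using below by (simp add: row_coeff_def)
  then show False using x(1) il by (simp add: X_def)
qed

text \<open>Parity is not built into \<open>is_rep\<close>; it descends from the frame, as an arrow
  changes both the colour and the parity of the level.\<close>

lemma rep_dim_parity:
  assumes "rep_dim D R S" "set_mset R \<subseteq> parity_pairs D"
  shows "set_mset S \<subseteq> parity_pairs D"
proof
  fix x assume "x \<in> set_mset S"
  then obtain i l where il: "x = (i, l)" "(i, l) \<in># S" by (cases x) auto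
  have "(i, l) \<in> parity_pairs D"
    using assms(1) il(2)
  proof (induction rule: rep_dim_support_induct)
    case (base i l)
    then show ?case using assms(2) by (auto simp: parity_pairs_def)
  next
    case (step i l j)
    then show ?case using adj_parity by (auto simp: parity_pairs_def)
  qed
  then show "x \<in> parity_pairs D" using il by simp
qed

lemma row_sum_zvar: "row_sum (zvar D (j, k)) i = cartan D i j"
proof -
  have "(\<Sum>j' | adj D j' j. of_bool (j' = i) :: int) = (\<Sum>j' | adj D j' j. if j' = i then 1 else 0)"
    by (intro sum.cong) auto
  then have "(\<Sum>j' | adj D j' j. of_bool (j' = i) :: int) = of_bool (adj D i j)"
    by (simp only: sum.delta finite) auto
  then show ?thesis by (auto simp: zvar_def row_sum_prod sum_negf cartan_eq)
qed

lemma pairing_mset_wt: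
  assumes "admissible D R"
  shows "pairing (simple_coroot D i) (mset_wt D R) = int (size {#x \<in># R. fst x = i#})"
proof -
  have "rat_pairing (simple_coroot D i) (rat_wt D R) = of_nat (size {#x \<in># R. fst x = i#})" for R
    unfolding rat_wt_def using weights by (induction R) (auto simp: fundamental_weights_def)
  then have "(of_int (pairing (simple_coroot D i) (mset_wt D R)) :: rat)
      = of_int (int (size {#x \<in># R. fst x = i#}))"
    using rat_pairing_to_rat to_rat_mset_wt[OF assms] by (metis of_int_of_nat_eq)
  then show ?thesis by (simp only: of_int_eq_iff)
qed

lemma monomial_crystal_iff:
  "p \<in> monomial_crystal D \<longleftrightarrow>
    (\<forall>i c. expn p i c \<noteq> 0 \<longrightarrow> (i, c) \<in> parity_pairs D) \<and>
    (\<forall>i. pairing (simple_coroot D i) (wt p) = row_sum p i)"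
  by (auto simp: monomial_crystal_def row_sum_def expn_def in_keys_iff subset_iff)

lemma monomial_crystal_times:
  assumes "p \<in> monomial_crystal D" "q \<in> monomial_crystal D"
  shows "p * q \<in> monomial_crystal D"
proof -
  have "(i, c) \<in> parity_pairs D" if "expn (p * q) i c \<noteq> 0" for i c
  proof -
    have "expn p i c \<noteq> 0 \<or> expn q i c \<noteq> 0" using that by auto
    then show ?thesis using assms by (auto simp: monomial_crystal_iff)
  qed
  moreover have "pairing (simple_coroot D i) (wt (p * q)) = row_sum (p * q) i" for i
    using assms by (simp add: monomial_crystal_iff)
  ultimately show ?thesis unfolding monomial_crystal_iff by blast
qed

lemma monomial_crystal_inverse:
  "p \<in> monomial_crystal D \<Longrightarrow> inverse p \<in> monomial_crystal D"
  by (simp add: monomial_crystal_iff)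

lemma monomial_crystal_zvar:
  assumes "(i, k) \<in> parity_pairs D"
  shows "zvar D (i, k) \<in> monomial_crystal D"
proof -
  have "(j, c) \<in> parity_pairs D" if "expn (zvar D (i, k)) j c \<noteq> 0" for j c
    using that assms adj_parity[of j i]
    by (auto simp: expn_zvar parity_pairs_def of_bool_def split: if_splits)
  then show ?thesis by (auto simp: monomial_crystal_iff row_sum_zvar cartan_def)
qed

lemma rep_monomial_in_crystal:
  assumes "admissible D R" "set_mset S \<subseteq> parity_pairs D"
  shows "rep_monomial D R S \<in> monomial_crystal D"
  using assms(2)
proof (induction S)
  case empty
  have "y_mset D R \<in> monomial_crystal D"
    using assms(1) by (auto simp: monomial_crystal_iff pairing_mset_wt admissible_def)
  then show ?case by (simp add: rep_monomial_def monomial_crystal_times monomial_crystal_inverse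
        monomial_crystal_iff)
next
  case (add x S)
  then show ?case unfolding rep_monomial_lower
    by (cases x) (auto intro!: monomial_crystal_times monomial_crystal_inverse monomial_crystal_zvar)
qed

end


section \<open>Crystal operators\<close>

lemma phi_at_simps [simp]:
  "phi_at (p * q) i k = phi_at p i k + phi_at q i k" "phi_at (inverse p) i k = - phi_at p i k"
  "phi_at 1 i k = 0" "phi_at (wexp \<mu>) i k = 0"
  by (simp_all add: phi_at_def sum_expn_times[where Q = "\<lambda>l. k \<le> l", simplified] sum_negf)

lemma phi_at_yvar [simp]: "phi_at (yvar x) i k = of_bool (fst x = i \<and> k \<le> snd x)"
proof -
  have "{l. k \<le> l \<and> expn (yvar x) i l \<noteq> 0} = (if fst x = i \<and> k \<le> snd x then {snd x} else {})"
    by (cases x) auto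
  then show ?thesis by (cases x) (simp add: phi_at_def)
qed

lemma phi_at_prod: "phi_at (prod f A) i k = (\<Sum>a\<in>A. phi_at (f a) i k)"
  by (induction A rule: infinite_finite_induct) auto

lemma phi_at_eq_sum: "phi_at p i k = (\<Sum>c | expn p i c \<noteq> 0. if k \<le> c then expn p i c else 0)"
  unfolding phi_at_def by (rule sum_expn_superset) auto

lemma phi_at_succ: "phi_at p i k = expn p i k + phi_at p i (k + 1)"
proof -
  have "phi_at p i k = (\<Sum>c | expn p i c \<noteq> 0. (if c = k then expn p i c else 0)
      + (if k + 1 \<le> c then expn p i c else 0))"
    unfolding phi_at_eq_sum by (intro sum.cong) auto
  also have "\<dots> = expn p i k + phi_at p i (k + 1)"
    unfolding phi_at_eq_sum sum.distrib by simp
  finally show ?thesis .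
qed

text \<open>Expresses both families of partial sums through \<open>phi_at\<close>, so that one set
  of maximal positions governs both operators.\<close>

lemma eps_at_eq: "eps_at p i k = phi_at p i (k + 1) - row_sum p i"
proof -
  have eps: "eps_at p i k = - (\<Sum>c | expn p i c \<noteq> 0. if c \<le> k then expn p i c else 0)"
    unfolding eps_at_def by (subst sum_expn_superset) auto
  have "row_sum p i = (\<Sum>c | expn p i c \<noteq> 0. (if k + 1 \<le> c then expn p i c else 0)
      + (if c \<le> k then expn p i c else 0))"
    unfolding row_sum_def by (intro sum.cong) auto
  then show ?thesis unfolding eps phi_at_eq_sum sum.distrib by simp
qed

lemma phi_at_above: "\<exists>b. \<forall>k>b. phi_at p i k = 0"
proof -
  obtain b where b: "\<forall>c\<in>{c. expn p i c \<noteq> 0}. c \<le> b"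
    using bdd_above_finite[OF finite_expn[of p i]] unfolding bdd_above_def by blast
  have "phi_at p i k = 0" if "k > b" for k
    unfolding phi_at_eq_sum
  proof (intro sum.neutral ballI)
    fix c assume "c \<in> {c. expn p i c \<noteq> 0}"
    then show "(if k \<le> c then expn p i c else 0) = 0" using b that by fastforce
  qed
  then show ?thesis by blast
qed

lemma phi_at_below: "\<exists>a. \<forall>k<a. phi_at p i k = row_sum p i"
proof -
  obtain a where a: "\<forall>c\<in>{c. expn p i c \<noteq> 0}. a \<le> c"
    using bdd_below_finite[OF finite_expn[of p i]] unfolding bdd_below_def by blast
  have "phi_at p i k = row_sum p i" if "k < a" for k
    unfolding phi_at_eq_sum row_sum_def
  proof (intro sum.cong refl)
    fix c assume "c \<in> {c. expn p i c \<noteq> 0}"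
    then show "(if k \<le> c then expn p i c else 0) = expn p i c" using a that by fastforce
  qed
  then show ?thesis by blast
qed

text \<open>Justifies the maxima over infinitely many \<open>k\<close>: every value is a sum over a
  subset of the finite support.\<close>

lemma finite_range_phi_at: "finite (phi_at p i ` K)"
proof -
  have "phi_at p i ` K \<subseteq> (\<lambda>A. \<Sum>c\<in>A. expn p i c) ` Pow {c. expn p i c \<noteq> 0}"
    unfolding phi_at_def by (intro image_subsetI rev_image_eqI) auto
  then show ?thesis by (rule finite_subset) simp
qed

text \<open>\<open>f_op\<close> acts at \<open>F - 2\<close> for the last such \<open>F\<close>, and
  \<open>e_op\<close> at \<open>F - 2\<close> for the first.\<close>

definition argmax_phi :: "('r::finite, 'i) crystal_datum \<Rightarrow> ('r, 'i) monomial \<Rightarrow> 'i \<Rightarrow> int \<Rightarrow> bool"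
  where "argmax_phi D p i F \<longleftrightarrow> (i, F) \<in> parity_pairs D \<and>
    (\<forall>k. (i, k) \<in> parity_pairs D \<longrightarrow> phi_at p i k \<le> phi_at p i F)"

context simply_laced_datum
begin

lemma parity_shift [simp]:
  "(i, k + 2) \<in> parity_pairs D \<longleftrightarrow> (i, k) \<in> parity_pairs D"
  "(i, k - 2) \<in> parity_pairs D \<longleftrightarrow> (i, k) \<in> parity_pairs D"
  by (simp_all add: parity_pairs_def)

lemma parity_succ: "(i, k + 1) \<in> parity_pairs D \<longleftrightarrow> (i, k) \<notin> parity_pairs D"
  by (auto simp: parity_pairs_def)

lemma parity_diff: "(i, k) \<in> parity_pairs D \<Longrightarrow> (i, l) \<in> parity_pairs D \<Longrightarrow> even (k - l)"
  by (auto simp: parity_pairs_def)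

lemma parity_less_iff:
  "(i, k) \<in> parity_pairs D \<Longrightarrow> (i, l) \<in> parity_pairs D \<Longrightarrow> k < l \<longleftrightarrow> k \<le> l - 2"
  using parity_diff[of i l k] by presburger

lemma ex_parity_above: "\<exists>k>b. (i, k) \<in> parity_pairs D"
proof (cases "(i, b + 1) \<in> parity_pairs D")
  case False
  then have "(i, b + 1 + 1) \<in> parity_pairs D" by (simp only: parity_succ) simp
  then show ?thesis by (intro exI[of _ "b + 1 + 1"]) simp
qed (intro exI[of _ "b + 1"], simp)

lemma ex_parity_below: "\<exists>k<b. (i, k) \<in> parity_pairs D"
proof (cases "(i, b - 1) \<in> parity_pairs D")
  case False
  then have "(i, b - 2) \<in> parity_pairs D" using parity_succ[of i "b - 2"] by simp
  then show ?thesis by (intro exI[of _ "b - 2"]) simp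
qed (intro exI[of _ "b - 1"], simp)

lemma phi_at_zvar:
  "phi_at (zvar D (i, m)) i k = of_bool (k \<le> m) + of_bool (k \<le> m + 2)"
proof -
  have "(\<Sum>j' | adj D j' i. phi_at (inverse (yvar (j', m + 1)) :: ('r, 'i) monomial) i k) = 0"
    using adj_irrefl by (intro sum.neutral) auto
  then show ?thesis by (simp add: zvar_def phi_at_prod del: phi_at_simps(2))
qed

lemma phi_at_step:
  assumes "p \<in> monomial_crystal D" "(i, k) \<in> parity_pairs D"
  shows "phi_at p i k = expn p i k + phi_at p i (k + 2)"
proof -
  have "expn p i (k + 1) = 0"
    using assms parity_succ[of i k] by (auto simp: monomial_crystal_iff)
  then show ?thesis using phi_at_succ[of p i k] phi_at_succ[of p i "k + 1"] by (simp add: add.commute)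
qed

text \<open>Position \<open>k + 1\<close> has the wrong parity and exponent 0, so
  \<open>k + 2\<close> may replace it. Hence \<open>eps_at\<close> is maximal at \<open>k\<close>
  exactly when \<open>phi_at\<close> is maximal at \<open>k + 2\<close>.\<close>

lemma eps_at_parity:
  assumes "p \<in> monomial_crystal D" "(i, k) \<in> parity_pairs D"
  shows "eps_at p i k = phi_at p i (k + 2) - row_sum p i"
  using phi_at_step[OF assms] phi_at_succ[of p i k] by (simp add: eps_at_eq)

lemma ex_argmax_phi: "\<exists>F. argmax_phi D p i F"
proof -
  let ?A = "phi_at p i ` {k. (i, k) \<in> parity_pairs D}"
  have "?A \<noteq> {}" using ex_parity_above[of 0 i] by auto
  with finite_range_phi_at have "Max ?A \<in> ?A" by (rule Max_in)
  then obtain F where F: "(i, F) \<in> parity_pairs D" "Max ?A = phi_at p i F" by auto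
  have "phi_at p i k \<le> phi_at p i F" if "(i, k) \<in> parity_pairs D" for k
    unfolding F(2)[symmetric] using that finite_range_phi_at by (intro Max_ge) auto
  then show ?thesis using F(1) by (auto simp: argmax_phi_def)
qed

lemma not_argmax_phi:
  assumes "argmax_phi D p i F" "(i, k) \<in> parity_pairs D" "\<not> argmax_phi D p i k"
  shows "phi_at p i k < phi_at p i F"
proof (rule ccontr)
  assume "\<not> phi_at p i k < phi_at p i F"
  then have "argmax_phi D p i k" using assms(1,2) unfolding argmax_phi_def by (meson not_less order_trans)
  with assms(3) show False ..
qed

lemma phi_eq: "argmax_phi D p i F \<Longrightarrow> phi D i p = phi_at p i F"
  unfolding phi_def argmax_phi_def by (intro Max_eqI finite_range_phi_at) auto

lemma eps_eq:
  assumes p: "p \<in> monomial_crystal D" and F: "argmax_phi D p i F"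
  shows "eps D i p = phi_at p i F - row_sum p i"
proof -
  have "eps_at p i ` {k. (i, k) \<in> parity_pairs D}
      = (\<lambda>k. phi_at p i (k + 2) - row_sum p i) ` {k. (i, k) \<in> parity_pairs D}"
    using eps_at_parity[OF p] by (intro image_cong) auto
  moreover have "Max ((\<lambda>k. phi_at p i (k + 2) - row_sum p i) ` {k. (i, k) \<in> parity_pairs D})
      = phi_at p i F - row_sum p i"
  proof (rule Max_eqI)
    show "finite ((\<lambda>k. phi_at p i (k + 2) - row_sum p i) ` {k. (i, k) \<in> parity_pairs D})"
      using finite_imageI[OF finite_range_phi_at[of p i "(\<lambda>k. k + 2) ` {k. (i, k) \<in> parity_pairs D}"],
          of "\<lambda>x. x - row_sum p i"] by (simp add: image_image)
    show "y \<le> phi_at p i F - row_sum p i"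
      if "y \<in> (\<lambda>k. phi_at p i (k + 2) - row_sum p i) ` {k. (i, k) \<in> parity_pairs D}" for y
      using that F by (auto simp: argmax_phi_def)
    show "phi_at p i F - row_sum p i
        \<in> (\<lambda>k. phi_at p i (k + 2) - row_sum p i) ` {k. (i, k) \<in> parity_pairs D}"
      using F by (intro image_eqI[of _ _ "F - 2"]) (auto simp: argmax_phi_def)
  qed
  ultimately show ?thesis by (simp add: eps_def)
qed

lemma phi_nonneg: "phi D i p \<ge> 0"
proof -
  obtain F where F: "argmax_phi D p i F" using ex_argmax_phi by blast
  from phi_at_above[of p i] obtain b where b: "\<forall>k>b. phi_at p i k = 0" ..
  obtain k where "k > b" "(i, k) \<in> parity_pairs D" using ex_parity_above by blast
  then have "0 \<le> phi_at p i F" using F b unfolding argmax_phi_def by metis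
  then show ?thesis using phi_eq[OF F] by simp
qed

lemma eps_nonneg:
  assumes "p \<in> monomial_crystal D"
  shows "eps D i p \<ge> 0"
proof -
  obtain F where F: "argmax_phi D p i F" using ex_argmax_phi by blast
  from phi_at_below[of p i] obtain b where b: "\<forall>k<b. phi_at p i k = row_sum p i" ..
  obtain k where "k < b" "(i, k) \<in> parity_pairs D" using ex_parity_below by blast
  then have "row_sum p i \<le> phi_at p i F" using F b unfolding argmax_phi_def by metis
  then show ?thesis using eps_eq[OF assms F] by simp
qed

lemma phi_diff_eps:
  assumes "p \<in> monomial_crystal D"
  shows "phi D i p - eps D i p = pairing (simple_coroot D i) (wt p)"
proof -
  obtain F where "argmax_phi D p i F" using ex_argmax_phi by blast
  then show ?thesis using phi_eq eps_eq assms by (simp add: monomial_crystal_iff)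
qed

lemma f_op_eq_None_iff: "f_op D i p = None \<longleftrightarrow> phi D i p = 0"
  by (simp add: f_op_def Let_def)

lemma e_op_eq_None_iff: "e_op D i p = None \<longleftrightarrow> eps D i p = 0"
  by (simp add: e_op_def Let_def)

lemma f_op_eq_Some:
  assumes F: "argmax_phi D p i F" and last: "\<And>k. argmax_phi D p i k \<Longrightarrow> k \<le> F"
    and "phi_at p i F \<noteq> 0"
  shows "f_op D i p = Some (p * inverse (zvar D (i, F - 2)))"
proof -
  have "(GREATEST k. (i, k) \<in> parity_pairs D \<and> phi_at p i k = phi D i p) = F"
  proof (rule Greatest_equality)
    show "(i, F) \<in> parity_pairs D \<and> phi_at p i F = phi D i p"
      using F phi_eq[OF F] by (simp add: argmax_phi_def)
    show "k \<le> F" if "(i, k) \<in> parity_pairs D \<and> phi_at p i k = phi D i p" for k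
      using that F phi_eq[OF F] by (intro last) (auto simp: argmax_phi_def)
  qed
  then show ?thesis using assms(3) phi_eq[OF F] by (simp add: f_op_def)
qed

lemma e_op_eq_Some:
  assumes p: "p \<in> monomial_crystal D"
    and F: "argmax_phi D p i F" and first: "\<And>k. argmax_phi D p i k \<Longrightarrow> F \<le> k"
    and "phi_at p i F \<noteq> row_sum p i"
  shows "e_op D i p = Some (p * zvar D (i, F - 2))"
proof -
  have "(LEAST k. (i, k) \<in> parity_pairs D \<and> eps_at p i k = eps D i p) = F - 2"
  proof (rule Least_equality)
    show "(i, F - 2) \<in> parity_pairs D \<and> eps_at p i (F - 2) = eps D i p"
      using F eps_eq[OF p F] eps_at_parity[OF p, of i "F - 2"] by (simp add: argmax_phi_def)
    show "F - 2 \<le> k" if k: "(i, k) \<in> parity_pairs D \<and> eps_at p i k = eps D i p" for k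
    proof -
      have "argmax_phi D p i (k + 2)"
        using k F eps_eq[OF p F] eps_at_parity[OF p, of i k] by (simp add: argmax_phi_def)
      then show ?thesis using first[of "k + 2"] by simp
    qed
  qed
  then show ?thesis using assms(4) eps_eq[OF p F] by (simp add: e_op_def)
qed

text \<open>Beyond the last maximum the partial sums drop strictly, which forces a positive exponent
  at \<open>F\<close>: the input that \<open>rep_dim_lower\<close> needs.\<close>

lemma f_op_SomeE:
  assumes p: "p \<in> monomial_crystal D" and q: "f_op D i p = Some q"
  obtains F where "argmax_phi D p i F" "\<And>k. argmax_phi D p i k \<Longrightarrow> k \<le> F"
    "phi_at p i F > 0" "expn p i F > 0" "q = p * inverse (zvar D (i, F - 2))"
proof -
  have pos: "phi D i p > 0" using q phi_nonneg[of i p] f_op_eq_None_iff[of i p] by auto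
  from phi_at_above[of p i] obtain b where b: "\<forall>k>b. phi_at p i k = 0" ..
  obtain F0 where F0: "argmax_phi D p i F0" using ex_argmax_phi by blast
  \<comment> \<open>A last maximum exists: \<open>phi_at\<close> vanishes above \<open>b\<close>
    whereas the maximum is positive, so the candidates lie in \<open>{F0..b}\<close>.\<close>
  let ?K = "{k. argmax_phi D p i k \<and> F0 \<le> k}"
  have "k \<le> b" if "argmax_phi D p i k" for k
  proof (rule ccontr)
    assume "\<not> k \<le> b"
    then show False using phi_eq[OF that] b pos by simp
  qed
  then have "?K \<subseteq> {F0..b}" by auto
  then have fin: "finite ?K" using finite_subset by blast
  define F where "F = Max ?K"
  have "F \<in> ?K" unfolding F_def using fin F0 by (intro Max_in) auto
  then have F: "argmax_phi D p i F" "F0 \<le> F" by auto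
  have last: "k \<le> F" if "argmax_phi D p i k" for k
  proof (cases "F0 \<le> k")
    case True
    then show ?thesis unfolding F_def using fin that by (intro Max_ge) auto
  qed (use F(2) in auto)
  have par: "(i, F) \<in> parity_pairs D" using F by (simp add: argmax_phi_def)
  have "\<not> argmax_phi D p i (F + 2)" using last[of "F + 2"] by auto
  then have "phi_at p i (F + 2) < phi_at p i F" using not_argmax_phi[OF F(1)] par by simp
  then have "expn p i F > 0" using phi_at_step[OF p par] by simp
  moreover have "phi_at p i F > 0" using pos phi_eq[OF F(1)] by simp
  ultimately show thesis using that[OF F(1) last] f_op_eq_Some[OF F(1) last] q by simp
qed

lemma e_op_SomeE:
  assumes p: "p \<in> monomial_crystal D" and q: "e_op D i p = Some q"
  obtains F where "argmax_phi D p i F" "\<And>k. argmax_phi D p i k \<Longrightarrow> F \<le> k"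
    "phi_at p i F > row_sum p i" "expn p i (F - 2) < 0" "q = p * zvar D (i, F - 2)"
proof -
  have pos: "eps D i p > 0" using q eps_nonneg[OF p, of i] e_op_eq_None_iff[of i p] by auto
  from phi_at_below[of p i] obtain b where b: "\<forall>k<b. phi_at p i k = row_sum p i" ..
  obtain F0 where F0: "argmax_phi D p i F0" using ex_argmax_phi by blast
  let ?K = "{k. argmax_phi D p i k \<and> k \<le> F0}"
  have "b \<le> k" if "argmax_phi D p i k" for k
  proof (rule ccontr)
    assume "\<not> b \<le> k"
    then show False using eps_eq[OF p that] b pos by simp
  qed
  then have "?K \<subseteq> {b..F0}" by auto
  then have fin: "finite ?K" using finite_subset by blast
  define F where "F = Min ?K"
  have "F \<in> ?K" unfolding F_def using fin F0 by (intro Min_in) auto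
  then have F: "argmax_phi D p i F" "F \<le> F0" by auto
  have first: "F \<le> k" if "argmax_phi D p i k" for k
  proof (cases "k \<le> F0")
    case True
    then show ?thesis unfolding F_def using fin that by (intro Min_le) auto
  qed (use F(2) in auto)
  have par: "(i, F) \<in> parity_pairs D" using F by (simp add: argmax_phi_def)
  have "\<not> argmax_phi D p i (F - 2)" using first[of "F - 2"] by auto
  then have "phi_at p i (F - 2) < phi_at p i F" using not_argmax_phi[OF F(1)] par by simp
  then have "expn p i (F - 2) < 0" using phi_at_step[OF p, of i "F - 2"] par by simp
  moreover have gt: "phi_at p i F > row_sum p i" using pos eps_eq[OF p F(1)] by simp
  ultimately show thesis using that[OF F(1) first] e_op_eq_Some[OF p F(1) first] q by simp
qed

text \<open>The step lowers \<open>phi_at\<close> by 2 up to \<open>F - 2\<close>, by 1 at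
  \<open>F\<close> and by 0 above. As \<open>F\<close> was the last maximum, it stays one and
  becomes the first, which is where \<open>e_op\<close> acts.\<close>

lemma e_op_f_op:
  assumes p: "p \<in> monomial_crystal D" and q: "f_op D i p = Some q"
  shows "q \<in> monomial_crystal D" "e_op D i q = Some p" "phi D i q = phi D i p - 1"
proof -
  obtain F where F: "argmax_phi D p i F" "\<And>k. argmax_phi D p i k \<Longrightarrow> k \<le> F"
    "phi_at p i F > 0" "q = p * inverse (zvar D (i, F - 2))"
    using f_op_SomeE[OF p q] by blast
  have par: "(i, F) \<in> parity_pairs D" using F by (simp add: argmax_phi_def)
  show qM: "q \<in> monomial_crystal D"
    unfolding F(4) using par
    by (intro monomial_crystal_times p monomial_crystal_inverse monomial_crystal_zvar) simp
  have phi_q: "phi_at q i k = phi_at p i k - of_bool (k \<le> F - 2) - of_bool (k \<le> F)" for k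
    by (simp add: F(4) phi_at_zvar)
  have above: "phi_at p i k < phi_at p i F" if "(i, k) \<in> parity_pairs D" "k > F" for k
  proof -
    have "\<not> argmax_phi D p i k" using F(2)[of k] that by auto
    then show ?thesis using not_argmax_phi[OF F(1) that(1)] by simp
  qed
  have le: "phi_at p i k \<le> phi_at p i F" if "(i, k) \<in> parity_pairs D" for k
    using F(1) that by (simp add: argmax_phi_def)
  have strict: "phi_at q i k < phi_at q i F" if k: "(i, k) \<in> parity_pairs D" "k < F" for k
  proof -
    have "k \<le> F - 2" using parity_less_iff[OF k(1) par] k(2) by simp
    then show ?thesis using le[OF k(1)] by (simp add: phi_q)
  qed
  have "phi_at q i k \<le> phi_at q i F" if k: "(i, k) \<in> parity_pairs D" for k
    using strict[OF k] above[OF k] by (cases k F rule: linorder_cases) (auto simp: phi_q)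
  then have max: "argmax_phi D q i F" using par by (simp add: argmax_phi_def)
  then show "phi D i q = phi D i p - 1" using phi_eq F(1) by (simp add: phi_q)
  have first: "F \<le> k" if k: "argmax_phi D q i k" for k
  proof (rule ccontr)
    assume "\<not> F \<le> k"
    then have "phi_at q i k < phi_at q i F" using strict k by (auto simp: argmax_phi_def)
    then show False using k par by (auto simp: argmax_phi_def)
  qed
  \<comment> \<open>The row sum falls by 2 but the maximum only by 1, so \<open>eps\<close> has
    become positive.\<close>
  have "row_sum q i = row_sum p i - 2" by (simp add: F(4) row_sum_zvar)
  moreover have "row_sum p i \<le> phi_at p i F"
    using eps_eq[OF p F(1)] eps_nonneg[OF p, of i] by simp
  ultimately have "phi_at q i F \<noteq> row_sum q i" by (simp add: phi_q)
  then show "e_op D i q = Some p"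
    using e_op_eq_Some[OF qM max first] by (simp add: F(4))
qed

text \<open>Mirror image of the previous lemma: values up to \<open>F - 2\<close> were strictly
  smaller and gain 2, the one at \<open>F\<close> gains 1, so \<open>F\<close> stays maximal and
  becomes the last maximum.\<close>

lemma f_op_e_op:
  assumes p: "p \<in> monomial_crystal D" and q: "e_op D i p = Some q"
  shows "q \<in> monomial_crystal D" "f_op D i q = Some p" "phi D i q = phi D i p + 1"
proof -
  obtain F where F: "argmax_phi D p i F" "\<And>k. argmax_phi D p i k \<Longrightarrow> F \<le> k"
    "phi_at p i F > row_sum p i" "q = p * zvar D (i, F - 2)"
    using e_op_SomeE[OF p q] by blast
  have par: "(i, F) \<in> parity_pairs D" using F by (simp add: argmax_phi_def)
  show qM: "q \<in> monomial_crystal D"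
    unfolding F(4) using par by (intro monomial_crystal_times p monomial_crystal_zvar) simp
  have phi_q: "phi_at q i k = phi_at p i k + of_bool (k \<le> F - 2) + of_bool (k \<le> F)" for k
    by (simp add: F(4) phi_at_zvar)
  have below: "phi_at p i k < phi_at p i F" if "(i, k) \<in> parity_pairs D" "k < F" for k
  proof -
    have "\<not> argmax_phi D p i k" using F(2)[of k] that by auto
    then show ?thesis using not_argmax_phi[OF F(1) that(1)] by simp
  qed
  have le: "phi_at p i k \<le> phi_at p i F" if "(i, k) \<in> parity_pairs D" for k
    using F(1) that by (simp add: argmax_phi_def)
  have "phi_at q i k \<le> phi_at q i F" if k: "(i, k) \<in> parity_pairs D" for k
    using below[OF k] le[OF k] by (cases k F rule: linorder_cases) (auto simp: phi_q)
  then have max: "argmax_phi D q i F" using par by (simp add: argmax_phi_def)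
  then show "phi D i q = phi D i p + 1" using phi_eq F(1) by (simp add: phi_q)
  have last: "k \<le> F" if k: "argmax_phi D q i k" for k
  proof (rule ccontr)
    assume "\<not> k \<le> F"
    then have "phi_at q i k < phi_at q i F"
      using le[of k] k by (simp add: phi_q argmax_phi_def)
    then show False using k par by (auto simp: argmax_phi_def)
  qed
  have "0 \<le> phi_at p i F" using phi_eq[OF F(1)] phi_nonneg[of i p] by simp
  then have "phi_at q i F \<noteq> 0" by (simp add: phi_q)
  then show "f_op D i q = Some p"
    using f_op_eq_Some[OF max last] by (simp add: F(4))
qed

end


section \<open>The product monomial crystal\<close>

definition rep_crystal ::
  "('r::finite, 'i::finite) crystal_datum \<Rightarrow> ('i \<times> int) multiset \<Rightarrow> ('r, 'i) monomial set"
  where "rep_crystal D R = rep_monomial D R ` {S. rep_dim D R S}"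

lemma rep_crystal_empty: "rep_crystal D {#} = 1"
  by (auto simp: rep_crystal_def)

lemma rep_crystal_add:
  assumes "admissible D R" "admissible D Q"
  shows "rep_crystal D (R + Q) = rep_crystal D R * rep_crystal D Q"
proof (intro set_eqI iffI)
  fix p assume "p \<in> rep_crystal D (R + Q)"
  then obtain S T where "p = rep_monomial D (R + Q) (S + T)" "rep_dim D R S" "rep_dim D Q T"
    by (auto simp: rep_crystal_def rep_dim_add_iff)
  then show "p \<in> rep_crystal D R * rep_crystal D Q"
    using rep_monomial_add[OF assms] by (auto simp: rep_crystal_def)
next
  fix p assume "p \<in> rep_crystal D R * rep_crystal D Q"
  then obtain S T where p: "p = rep_monomial D R S * rep_monomial D Q T" "rep_dim D R S" "rep_dim D Q T"
    by (auto simp: rep_crystal_def elim!: set_times_elim)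
  then have "rep_dim D (R + Q) (S + T)" by (auto simp: rep_dim_add_iff)
  then show "p \<in> rep_crystal D (R + Q)"
    unfolding p(1) rep_monomial_add[OF assms, symmetric] rep_crystal_def by blast
qed

lemma y_mset_replicate:
  assumes "n > 0"
  shows "y_mset D (replicate_mset n (i, c)) = wexp (lattice_elt (of_nat n *s fund_weight D i)) * yvar (i, c) ^ n"
  using assms by (simp add: y_mset_def mset_wt_def)

lemma filter_mset_insert:
  assumes "x \<notin> A"
  shows "filter_mset (\<lambda>y. y \<in> insert x A) R = replicate_mset (count R x) x + filter_mset (\<lambda>y. y \<in> A) R"
  using assms by (auto simp: multiset_eq_iff)

lemma gexp_add: "gexp (\<mu> + \<nu>) = gexp \<mu> * gexp \<nu>"
  by (simp add: gexp_def mult_single)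

lemma replicate_count_eq_filter: "replicate_mset (count R x) x = filter_mset (\<lambda>y. y = x) R"
  by (auto simp: multiset_eq_iff)

context simply_laced_datum
begin

lemma rep_crystal_subset:
  assumes "admissible D R"
  shows "rep_crystal D R \<subseteq> monomial_crystal D"
  unfolding rep_crystal_def
  using rep_monomial_in_crystal[OF assms rep_dim_parity[OF _ admissible_parity[OF assms]]] by blast

lemma rep_monomial_rep_dim_in_crystal:
  "admissible D R \<Longrightarrow> rep_dim D R S \<Longrightarrow> rep_monomial D R S \<in> monomial_crystal D"
  using rep_crystal_subset by (auto simp: rep_crystal_def)

lemma e_op_rep_monomial:
  assumes "admissible D R" "rep_dim D R S" "e_op D i (rep_monomial D R S) = Some q"
  obtains k where "(i, k) \<in># S" "q = rep_monomial D R (S - {#(i, k)#})" "rep_dim D R (S - {#(i, k)#})"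
proof -
  obtain F where F: "expn (rep_monomial D R S) i (F - 2) < 0" "q = rep_monomial D R S * zvar D (i, F - 2)"
    using e_op_SomeE[OF rep_monomial_rep_dim_in_crystal[OF assms(1,2)] assms(3)] by blast
  from rep_dim_raise[OF assms(2), of i "F - 2"] F(1)
  have "(i, F - 2) \<in># S" "rep_dim D R (S - {#(i, F - 2)#})" by (auto simp: expn_rep_monomial)
  then show thesis using that F(2) rep_monomial_raise by metis
qed

lemma f_op_rep_monomial:
  assumes "admissible D R" "rep_dim D R S" "f_op D i (rep_monomial D R S) = Some q"
  obtains F where "argmax_phi D (rep_monomial D R S) i F"
    "\<And>k. argmax_phi D (rep_monomial D R S) i k \<Longrightarrow> k \<le> F" "row_coeff D R S i F > 0"
    "q = rep_monomial D R (add_mset (i, F - 2) S)" "rep_dim D R (add_mset (i, F - 2) S)"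
proof -
  obtain F where F: "argmax_phi D (rep_monomial D R S) i F"
    "\<And>k. argmax_phi D (rep_monomial D R S) i k \<Longrightarrow> k \<le> F"
    "expn (rep_monomial D R S) i F > 0" "q = rep_monomial D R S * inverse (zvar D (i, F - 2))"
    using f_op_SomeE[OF rep_monomial_rep_dim_in_crystal[OF assms(1,2)] assms(3)] by blast
  then have pos: "row_coeff D R S i F > 0" by (simp add: expn_rep_monomial)
  show thesis
    using that[OF F(1,2) pos _ rep_dim_lower[OF assms(2) pos]] F(4) by (simp add: rep_monomial_lower)
qed

lemma subcrystal_rep_crystal:
  assumes "admissible D R"
  shows "subcrystal D (rep_crystal D R)"
  unfolding subcrystal_def
proof (intro conjI ballI allI impI rep_crystal_subset[OF assms])
  fix p i q assume "p \<in> rep_crystal D R" and q: "e_op D i p = Some q \<or> f_op D i p = Some q"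
  then obtain S where S: "p = rep_monomial D R S" "rep_dim D R S" by (auto simp: rep_crystal_def)
  from q show "q \<in> rep_crystal D R"
  proof
    assume "e_op D i p = Some q"
    with e_op_rep_monomial[OF assms S(2)] S(1) show ?thesis unfolding rep_crystal_def by blast
  next
    assume "f_op D i p = Some q"
    with f_op_rep_monomial[OF assms S(2)] S(1) show ?thesis unfolding rep_crystal_def by blast
  qed
qed

lemma phi_at_eq_row_sum:
  assumes "\<And>c. expn p i c \<noteq> 0 \<Longrightarrow> l \<le> c"
  shows "phi_at p i l = row_sum p i"
  unfolding phi_at_eq_sum row_sum_def using assms by (intro sum.cong) auto

text \<open>Leaving out a negative first exponent makes the partial sum exceed the full row sum.
  This serves both for uniqueness of the highest weight element and for rule (3).\<close>

lemma eps_nonzero_if_first_neg: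
  assumes pM: "p \<in> monomial_crystal D" and par: "(i, l) \<in> parity_pairs D"
    and low: "\<And>c. expn p i c \<noteq> 0 \<Longrightarrow> l \<le> c" and neg: "expn p i l < 0"
  shows "eps D i p \<noteq> 0"
proof -
  have gt: "row_sum p i < phi_at p i (l + 2)"
    using phi_at_step[OF pM par] phi_at_eq_row_sum[of p i l, OF low] neg by simp
  obtain F where F: "argmax_phi D p i F" using ex_argmax_phi by blast
  then have "phi_at p i (l + 2) \<le> phi_at p i F" using par by (simp add: argmax_phi_def)
  then show ?thesis using gt eps_eq[OF pM F] by simp
qed

text \<open>A monomial other than the generator is not a highest weight element: the row of a factor
  \<open>z\<inverse>\<close> of lowest level starts with a negative exponent.\<close>

lemma ex_e_op_replicate:
  assumes adm: "admissible D (replicate_mset n x)" and S: "rep_dim D (replicate_mset n x) S" "S \<noteq> {#}"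
  shows "\<exists>i q. e_op D i (rep_monomial D (replicate_mset n x) S) = Some q"
proof -
  let ?R = "replicate_mset n x"
  let ?p = "rep_monomial D ?R S"
  have "Min (snd ` set_mset S) \<in> snd ` set_mset S" using S(2) by (intro Min_in) auto
  moreover have le: "Min (snd ` set_mset S) \<le> snd y" if "y \<in># S" for y
    using that by (intro Min_le) auto
  ultimately obtain i l where il: "(i, l) \<in># S" "l = Min (snd ` set_mset S)" by auto
  have level: "l + 2 \<le> snd x"
    using rep_dim_level_le[OF S(1) il(1)] by (auto split: if_splits)
  have S0: "count S (j, k) = 0" if "k < l" for j k
    using le[of "(j, k)"] il(2) that by (auto simp: not_in_iff[symmetric])
  have R0: "count ?R (j, k) = 0" if "k \<le> l" for j k
    using level that by auto
  have low: "l \<le> c" if "expn ?p i c \<noteq> 0" for c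
  proof (rule ccontr)
    assume "\<not> l \<le> c"
    then have "row_coeff D ?R S i c = 0" using S0 R0[of c] by (simp add: row_coeff_def)
    with that show False by (simp add: expn_rep_monomial)
  qed
  have pM: "?p \<in> monomial_crystal D" using rep_monomial_rep_dim_in_crystal[OF adm S(1)] .
  have par: "(i, l) \<in> parity_pairs D"
    using rep_dim_parity[OF S(1) admissible_parity[OF adm]] il(1) by auto
  have "expn ?p i l < 0"
  proof -
    have "row_coeff D ?R S i l = - int (count S (i, l))"
      using S0 R0[of l] by (simp add: row_coeff_def)
    moreover have "count S (i, l) > 0" using il(1) by simp
    ultimately show ?thesis by (simp add: expn_rep_monomial)
  qed
  then have "eps D i ?p \<noteq> 0" using eps_nonzero_if_first_neg[OF pM par low] by simp
  then have "e_op D i ?p \<noteq> None" by (simp add: e_op_eq_None_iff)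
  then show ?thesis by blast
qed

text \<open>Each raising step shortens \<open>S\<close> until the generator is reached, and
  \<open>f_op\<close> undoes it; hence any subcrystal with the generator contains every monomial of
  \<open>rep_crystal\<close>.\<close>

lemma generated_subcrystal_replicate:
  assumes adm: "admissible D (replicate_mset n x)"
  shows "generated_subcrystal D (y_mset D (replicate_mset n x)) = rep_crystal D (replicate_mset n x)"
proof (rule equalityI)
  let ?R = "replicate_mset n x"
  have y: "y_mset D ?R = rep_monomial D ?R {#}"
    by (rule monomial_eqI) (simp_all add: rep_monomial_def)
  then have "y_mset D ?R \<in> rep_crystal D ?R" using rep_dim_zero by (auto simp: rep_crystal_def)
  then show "generated_subcrystal D (y_mset D ?R) \<subseteq> rep_crystal D ?R"
    using subcrystal_rep_crystal[OF adm] by (auto simp: generated_subcrystal_def)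
  have "rep_monomial D ?R S \<in> X" if X: "subcrystal D X" "y_mset D ?R \<in> X" and "rep_dim D ?R S" for X S
    using that(3)
  proof (induction "size S" arbitrary: S rule: less_induct)
    case less
    show ?case
    proof (cases "S = {#}")
      case True
      then show ?thesis using X(2) y by simp
    next
      case False
      then obtain i q where q: "e_op D i (rep_monomial D ?R S) = Some q"
        using ex_e_op_replicate[OF adm less.prems] by blast
      from e_op_rep_monomial[OF adm less.prems q]
      obtain k where k: "(i, k) \<in># S" "q = rep_monomial D ?R (S - {#(i, k)#})"
        "rep_dim D ?R (S - {#(i, k)#})" .
      have "q \<in> X" using less.hyps[OF _ k(3)] k(1,2) by (simp add: size_Diff1_less)
      moreover have "f_op D i q = Some (rep_monomial D ?R S)"
        using f_op_e_op(2)[OF rep_monomial_rep_dim_in_crystal[OF adm less.prems] q] .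
      ultimately show ?thesis using X(1) unfolding subcrystal_def by blast
    qed
  qed
  then show "rep_crystal D ?R \<subseteq> generated_subcrystal D (y_mset D ?R)"
    by (auto simp: generated_subcrystal_def rep_crystal_def)
qed

lemma fund_crystal_eq:
  assumes "admissible D (replicate_mset n x)" "n > 0"
  shows "fund_crystal D x n = rep_crystal D (replicate_mset n x)"
  using generated_subcrystal_replicate[OF assms(1)] y_mset_replicate[OF assms(2), of D "fst x" "snd x"]
  by (simp add: fund_crystal_def case_prod_unfold)

lemma product_crystal_eq:
  assumes adm: "admissible D R"
  shows "product_crystal D R = rep_crystal D R"
proof -
  have "(\<Prod>x\<in>A. fund_crystal D x (count R x)) = rep_crystal D (filter_mset (\<lambda>y. y \<in> A) R)"
    if "finite A" "A \<subseteq> set_mset R" for A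
    using that
  proof (induction A rule: finite_induct)
    case empty
    then show ?case by (simp add: rep_crystal_empty)
  next
    case (insert x A)
    have adm_x: "admissible D (replicate_mset (count R x) x)"
      unfolding replicate_count_eq_filter by (rule admissible_filter[OF adm])
    have "fund_crystal D x (count R x) = rep_crystal D (replicate_mset (count R x) x)"
      using insert.prems by (intro fund_crystal_eq adm_x) auto
    then show ?case
      using insert.IH insert.prems
      unfolding filter_mset_insert[OF insert.hyps(2)] rep_crystal_add[OF adm_x admissible_filter[OF adm]]
      by (simp add: insert.hyps)
  qed
  from this[of "set_mset R"] show ?thesis
    by (simp add: product_crystal_def filter_mset_cong[of R R _ "\<lambda>_. True"])
qed

section \<open>Truncations through dimension vectors; rules (1) and (2)\<close>

lemma z_part_rep_monomial:
  assumes "admissible D R" "rep_dim D R S"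
  shows "z_part D R (rep_monomial D R S) = S"
  unfolding z_part_def
proof (rule the_equality)
  show "set_mset S \<subseteq> parity_pairs D \<and> rep_monomial D R S = y_mset D R * inverse (z_mset D S)"
    using rep_dim_parity[OF assms(2) admissible_parity[OF assms(1)]] by (simp add: rep_monomial_def)
  show "T = S" if "set_mset T \<subseteq> parity_pairs D \<and> rep_monomial D R S = y_mset D R * inverse (z_mset D T)" for T
    using that rep_monomial_inject[of R S T] by (simp add: rep_monomial_def)
qed

lemma truncation_eq:
  assumes "admissible D R" "set_mset R \<subseteq> J"
  shows "truncation D R J = rep_monomial D R ` {S. rep_dim D R S \<and> set_mset S \<subseteq> J}"
  unfolding truncation_def product_crystal_eq[OF assms(1)] rep_crystal_def Supp_def
  using assms z_part_rep_monomial by auto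

lemma inj_rep_monomial: "inj (rep_monomial D R)"
  using rep_monomial_inject by (blast intro: injI)

lemma ch_truncation:
  assumes "admissible D R" "set_mset R \<subseteq> J"
  shows "ch (truncation D R J) = (\<Sum>S | rep_dim D R S \<and> set_mset S \<subseteq> J. gexp (wt (rep_monomial D R S)))"
  unfolding ch_def truncation_eq[OF assms]
  by (subst sum.reindex) (auto intro: inj_on_subset[OF inj_rep_monomial])

lemma ch_truncation_empty: "ch (truncation D {#} J) = 1"
proof -
  have "{S :: ('i \<times> int) multiset. S = {#} \<and> set_mset S \<subseteq> J} = {{#}}" by auto
  then show ?thesis
    using ch_truncation[OF admissible_empty, of J] by (simp add: gexp_def)
qed

text \<open>A summand of the part over \<open>Q\<close> would contain the socle element \<open>(i, k - 2)\<close> for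
  some \<open>(i, k)\<close> in \<open>Q\<close>, which the boundary condition excludes.\<close>

lemma rep_dim_add_bdry:
  assumes "set_mset Q \<subseteq> bdry J" "set_mset S \<subseteq> J"
  shows "rep_dim D (R + Q) S \<longleftrightarrow> rep_dim D R S"
proof
  assume "rep_dim D (R + Q) S"
  then obtain S1 S2 where S: "S = S1 + S2" "rep_dim D R S1" "rep_dim D Q S2"
    by (auto simp: rep_dim_add_iff)
  have "S2 = {#}"
  proof (rule ccontr)
    assume "S2 \<noteq> {#}"
    then obtain i l where "(i, l) \<in># S2" "(i, l + 2) \<in># Q" using rep_dim_socle[OF S(3)] by blast
    then have "(i, l) \<in> J" "(i, l + 2) \<in> bdry J" using assms S(1) by auto
    then show False by (auto simp: bdry_def)
  qed
  then show "rep_dim D R S" using S by simp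
next
  assume "rep_dim D R S"
  then show "rep_dim D (R + Q) S" unfolding rep_dim_add_iff
    using rep_dim_zero by (intro exI[of _ S] exI[of _ "{#}"]) auto
qed

lemma ch_truncation_bdry:
  assumes "admissible D R" "admissible D Q" "set_mset R \<subseteq> J" "set_mset Q \<subseteq> bdry J"
  shows "ch (truncation D (R + Q) J) = gexp (mset_wt D Q) * ch (truncation D R J)"
proof -
  have "bdry J \<subseteq> J" by (auto simp: bdry_def)
  then have sub: "set_mset (R + Q) \<subseteq> J" using assms by auto
  have wt: "gexp (wt (rep_monomial D (R + Q) S)) = gexp (mset_wt D Q) * gexp (wt (rep_monomial D R S))" for S
    using mset_wt_add[OF assms(1,2)]
    by (simp add: rep_monomial_def flip: gexp_add) (simp add: algebra_simps)
  have sets: "{S. rep_dim D (R + Q) S \<and> set_mset S \<subseteq> J} = {S. rep_dim D R S \<and> set_mset S \<subseteq> J}"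
    using rep_dim_add_bdry[OF assms(4)] by blast
  show ?thesis
    unfolding ch_truncation[OF admissible_add[OF assms(1,2)] sub] ch_truncation[OF assms(1,3)] sets wt
    by (simp add: sum_distrib_left)
qed

end


section \<open>Finiteness\<close>

text \<open>Positive semidefinite by construction; its radical consists of the weights orthogonal to
  all coroots.\<close>

definition root_form :: "('r::finite, 'i) crystal_datum \<Rightarrow> int ^ 'r \<Rightarrow> int ^ 'r \<Rightarrow> int"
  where "root_form D x y = (\<Sum>\<gamma>\<in>roots D. pairing (coroot D \<gamma>) x * pairing (coroot D \<gamma>) y)"

lemma root_form_add:
  "root_form D (x + y) z = root_form D x z + root_form D y z"
  "root_form D x (y + z) = root_form D x y + root_form D x z"
  by (simp_all add: root_form_def algebra_simps sum.distrib)

lemma root_form_diff: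
  "root_form D (x - y) z = root_form D x z - root_form D y z"
  "root_form D x (y - z) = root_form D x y - root_form D x z"
  by (simp_all add: root_form_def algebra_simps sum_subtractf)

lemma root_form_uminus: "root_form D (- x) z = - root_form D x z"
  by (simp add: root_form_def sum_negf)

lemma root_form_scale:
  "root_form D (a *s x) z = a * root_form D x z" "root_form D x (a *s z) = a * root_form D x z"
  by (simp_all add: root_form_def sum_distrib_left algebra_simps)

lemma root_form_zero [simp]: "root_form D 0 z = 0"
  by (simp add: root_form_def)

lemma root_form_sum: "root_form D (sum f A) z = (\<Sum>a\<in>A. root_form D (f a) z)"
  by (induction A rule: infinite_finite_induct) (simp_all add: root_form_add)

lemma root_form_commute: "root_form D x y = root_form D y x"
  by (simp add: root_form_def mult.commute)

definition root_sum :: "('r::finite, 'i) crystal_datum \<Rightarrow> ('i \<times> int) multiset \<Rightarrow> int ^ 'r"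
  where "root_sum D S = (\<Sum>x\<in>#S. simple_root D (fst x))"

definition row_size :: "('i \<times> int) multiset \<Rightarrow> 'i \<Rightarrow> nat"
  where "row_size S i = size {#x \<in># S. fst x = i#}"

lemma wt_rep_monomial: "wt (rep_monomial D R S) = mset_wt D R - root_sum D S"
  by (simp add: rep_monomial_def wt_z_mset root_sum_def)

lemma size_eq_sum_row_size: "size S = (\<Sum>i\<in>UNIV. row_size S i)"
  for S :: "('i::finite \<times> int) multiset"
proof (induction S)
  case (add x S)
  have "(\<Sum>i\<in>UNIV. row_size (add_mset x S) i) = (\<Sum>i\<in>UNIV. row_size S i + (if fst x = i then 1 else 0))"
    by (intro sum.cong) (auto simp: row_size_def)
  then show ?case using add by (simp add: sum.distrib)
qed (simp add: row_size_def)

lemma root_sum_eq: "root_sum D S = (\<Sum>i\<in>UNIV. int (row_size S i) *s simple_root D i)"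
  for S :: "('i::finite \<times> int) multiset"
proof (induction S)
  case (add x S)
  have "(\<Sum>i\<in>UNIV. int (row_size (add_mset x S) i) *s simple_root D i) =
    (\<Sum>i\<in>UNIV. int (row_size S i) *s simple_root D i + (if fst x = i then simple_root D i else 0))"
    by (intro sum.cong) (auto simp: row_size_def vec_eq_iff algebra_simps)
  then show ?case using add by (simp add: root_sum_def sum.distrib add.commute)
qed (simp add: row_size_def root_sum_def)

context simply_laced_datum
begin

lemma finite_roots: "finite (roots D)"
  using root_datum by (simp add: root_datum_def)

lemma pairing_simple [simp]: "pairing (simple_coroot D i) (simple_root D i) = 2"
  using cartan_diag[of i] by (simp add: cartan_def)

text \<open>A reflection of the argument can be moved to the coroots, which the dual reflection
  permutes.\<close>

lemma root_form_refl: "root_form D (simple_refl D i x) (simple_refl D i y) = root_form D x y"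
proof -
  let ?C = "coroot D ` roots D"
  let ?s = "\<lambda>h. h - pairing h (simple_root D i) *s simple_coroot D i"
  have form: "root_form D u v = (\<Sum>h\<in>?C. pairing h u * pairing h v)" for u v
    using root_datum by (simp add: root_form_def sum.reindex root_datum_def)
  have invol: "?s (?s h) = h" for h
    by (simp add: vec_eq_iff algebra_simps)
  have closed: "?s h \<in> ?C" if "h \<in> ?C" for h
    using that root_datum simple_root_in_roots[of i]
    by (auto simp: root_datum_def simple_coroot_def)
  have bij: "bij_betw ?s ?C ?C"
  proof (rule bij_betw_byWitness[where f' = ?s])
    show "\<forall>h\<in>?C. ?s (?s h) = h" "\<forall>h\<in>?C. ?s (?s h) = h" using invol by blast+
    show "?s ` ?C \<subseteq> ?C" "?s ` ?C \<subseteq> ?C" using closed by blast+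
  qed
  have "pairing h (simple_refl D i u) = pairing (?s h) u" for h u
    by (simp add: simple_refl_def)
  then have "root_form D (simple_refl D i x) (simple_refl D i y)
      = (\<Sum>h\<in>?C. pairing (?s h) x * pairing (?s h) y)"
    by (simp add: form)
  also have "\<dots> = (\<Sum>h\<in>?C. pairing h x * pairing h y)"
    by (rule sum.reindex_bij_betw[OF bij])
  finally show ?thesis by (simp add: form)
qed

text \<open>Apply invariance under the reflection, which negates the simple root, and solve for the
  form. The form against a simple root is thus a positive multiple of the coroot pairing.\<close>

lemma root_form_simple:
  "2 * root_form D (simple_root D i) x
    = root_form D (simple_root D i) (simple_root D i) * pairing (simple_coroot D i) x"
proof -
  have neg: "simple_refl D i (simple_root D i) = - simple_root D i"
    by (simp add: simple_refl_def vec_eq_iff)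
  have "root_form D (simple_root D i) x
      = root_form D (- simple_root D i) (x - pairing (simple_coroot D i) x *s simple_root D i)"
    using root_form_refl[of i "simple_root D i" x] unfolding neg by (simp add: simple_refl_def)
  then show ?thesis by (simp add: root_form_uminus root_form_diff root_form_scale mult.commute)
qed

lemma pairing_square_le_root_form:
  assumes "\<gamma> \<in> roots D"
  shows "(pairing (coroot D \<gamma>) x)\<^sup>2 \<le> root_form D x x"
  unfolding root_form_def power2_eq_square
  using assms by (intro member_le_sum[where f = "\<lambda>\<gamma>. pairing (coroot D \<gamma>) x * pairing (coroot D \<gamma>) x"]
      finite_roots) auto

lemma root_form_simple_pos: "root_form D (simple_root D i) (simple_root D i) > 0"
  using pairing_square_le_root_form[OF simple_root_in_roots, of i "simple_root D i"] pairing_simple[of i]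
  by (simp add: simple_coroot_def)

lemma root_form_root_sum_nonneg:
  assumes "\<And>i. pairing (simple_coroot D i) v \<ge> 0"
  shows "root_form D (root_sum D S) v \<ge> 0"
proof (induction S)
  case (add x S)
  have "0 \<le> 2 * root_form D (simple_root D (fst x)) v"
    unfolding root_form_simple using root_form_simple_pos[of "fst x"] assms by simp
  then show ?case using add by (simp add: root_sum_def root_form_add)
qed (simp add: root_sum_def)

lemma e_op_iterate:
  assumes adm: "admissible D R" and "rep_dim D R S" "int k \<le> eps D i (rep_monomial D R S)"
  shows "\<exists>S'. rep_dim D R S' \<and> size S' + k = size S \<and>
    wt (rep_monomial D R S') = wt (rep_monomial D R S) + int k *s simple_root D i"
  using assms(2,3)
proof (induction k arbitrary: S)
  case 0
  then show ?case by (intro exI[of _ S]) simp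
next
  case (Suc k)
  let ?p = "rep_monomial D R S"
  have pM: "?p \<in> monomial_crystal D" using rep_monomial_rep_dim_in_crystal[OF adm Suc.prems(1)] .
  have "eps D i ?p \<noteq> 0" using Suc.prems(2) by simp
  then obtain q where q: "e_op D i ?p = Some q" using e_op_eq_None_iff[of i ?p] by auto
  from e_op_rep_monomial[OF adm Suc.prems(1) q]
  obtain l where l: "(i, l) \<in># S" "q = rep_monomial D R (S - {#(i, l)#})" "rep_dim D R (S - {#(i, l)#})" .
  have wt_q: "wt q = wt ?p + simple_root D i"
    using rep_monomial_raise[OF l(1), of D R] l(2) by simp
  then have "eps D i q = eps D i ?p - 1"
    using f_op_e_op[OF pM q] phi_diff_eps[OF pM, of i] phi_diff_eps[of q i] by simp
  then have "int k \<le> eps D i (rep_monomial D R (S - {#(i, l)#}))" using Suc.prems(2) l(2) by simp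
  from Suc.IH[OF l(3) this] obtain S' where S': "rep_dim D R S'" "size S' + k = size (S - {#(i, l)#})"
    "wt (rep_monomial D R S') = wt q + int k *s simple_root D i" using l(2) by blast
  have "size S = Suc (size (S - {#(i, l)#}))" using l(1) by (simp add: size_Suc_Diff1)
  then show ?case
    using S' wt_q by (intro exI[of _ S']) (simp add: vec_eq_iff algebra_simps)
qed

text \<open>Raising along a row in which the weight is negative applies the simple reflection, which
  preserves the form, so it is enough to treat dominant weights.\<close>

lemma root_form_wt_le:
  assumes adm: "admissible D R" and "rep_dim D R S"
  shows "root_form D (wt (rep_monomial D R S)) (wt (rep_monomial D R S))
    \<le> root_form D (mset_wt D R) (mset_wt D R)"
  using assms(2)
proof (induction "size S" arbitrary: S rule: less_induct)
  case less
  let ?p = "rep_monomial D R S" and ?L = "mset_wt D R"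
  show ?case
  proof (cases "\<forall>i. pairing (simple_coroot D i) (wt ?p) \<ge> 0")
    case True
    \<comment> \<open>With \<open>?L\<close> and \<open>wt ?p\<close> both dominant, the difference
      of the two norms is the form of \<open>?L - wt ?p\<close>, a sum of simple roots, with the
      dominant \<open>?L + wt ?p\<close>.\<close>
    have "root_form D (root_sum D S) (?L + wt ?p) \<ge> 0"
      using True pairing_mset_wt[OF adm] by (intro root_form_root_sum_nonneg) simp
    moreover have "root_sum D S = ?L - wt ?p" by (simp add: wt_rep_monomial)
    ultimately show ?thesis
      by (simp add: root_form_diff root_form_add root_form_commute[of D "wt ?p" ?L])
  next
    case False
    then obtain i where i: "pairing (simple_coroot D i) (wt ?p) < 0" by (auto simp: not_le)
    define k where "k = nat (- pairing (simple_coroot D i) (wt ?p))"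
    have k: "int k = - pairing (simple_coroot D i) (wt ?p)" "k > 0" using i by (auto simp: k_def)
    \<comment> \<open>\<open>phi\<close> is nonnegative and differs from \<open>eps\<close> by the
      pairing \<open>- int k\<close>.\<close>
    have "int k \<le> eps D i ?p"
      using phi_diff_eps[OF rep_monomial_rep_dim_in_crystal[OF adm less.prems], of i] phi_nonneg[of i ?p] k by simp
    from e_op_iterate[OF adm less.prems this] obtain S' where S': "rep_dim D R S'" "size S' + k = size S"
      "wt (rep_monomial D R S') = wt ?p + int k *s simple_root D i" by blast
    have "wt (rep_monomial D R S') = simple_refl D i (wt ?p)"
      using S'(3) k(1) by (simp add: simple_refl_def vec_eq_iff)
    then show ?thesis using less.hyps[OF _ S'(1)] S'(2) k(2) by (simp add: root_form_refl)
  qed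
qed

section \<open>Recovering the size of \<open>S\<close> from coroot pairings\<close>

lemma rat_pairing_left_sum:
  "rat_pairing (\<Sum>i\<in>A. a i *s h i) v = (\<Sum>i\<in>A. of_int (a i) * rat_pairing (h i) v)"
proof (induction A rule: infinite_finite_induct)
  case (insert i A)
  have "rat_pairing (a i *s h i + (\<Sum>i\<in>A. a i *s h i)) v
      = of_int (a i) * rat_pairing (h i) v + rat_pairing (\<Sum>i\<in>A. a i *s h i) v"
    by (simp add: rat_pairing_def sum_distrib_left sum.distrib[symmetric] algebra_simps)
  then show ?case using insert by simp
qed (simp_all add: rat_pairing_def)

text \<open>Coordinate vectors turn the hypothesis into a relation between coroots, which may then
  be paired with the rational weight \<open>fund_weight D j\<close> to isolate
  \<open>a j\<close>.\<close>

lemma simple_coroots_independent: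
  assumes "\<And>x. (\<Sum>i\<in>UNIV. a i * pairing (simple_coroot D i) x) = 0"
  shows "a j = 0"
proof -
  have "(\<Sum>i\<in>UNIV. a i *s simple_coroot D i) $ k = 0" for k
  proof -
    have "pairing h (axis k 1) = h $ k" for h :: "int ^ 'r"
      by (simp add: pairing_def axis_def if_distrib cong: if_cong)
    then show ?thesis using assms[of "axis k 1"] by simp
  qed
  then have "(\<Sum>i\<in>UNIV. a i *s simple_coroot D i) = 0" by (simp add: vec_eq_iff)
  then have "(\<Sum>i\<in>UNIV. of_int (a i) * rat_pairing (simple_coroot D i) (fund_weight D j)) = 0"
    unfolding rat_pairing_left_sum[symmetric] by (simp add: rat_pairing_def)
  moreover have "of_int (a i) * rat_pairing (simple_coroot D i) (fund_weight D j)
      = (if i = j then of_int (a j) else 0)" for i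
    using weights by (simp add: fundamental_weights_def)
  ultimately show ?thesis by simp
qed

lemma root_form_simple_sum:
  "2 * root_form D (\<Sum>i\<in>UNIV. a i *s simple_root D i) x =
    (\<Sum>i\<in>UNIV. (a i * root_form D (simple_root D i) (simple_root D i)) * pairing (simple_coroot D i) x)"
  unfolding root_form_sum root_form_scale sum_distrib_left
proof (intro sum.cong refl)
  fix i
  have "2 * (a i * root_form D (simple_root D i) x) = a i * (2 * root_form D (simple_root D i) x)"
    by simp
  then show "2 * (a i * root_form D (simple_root D i) x)
      = a i * root_form D (simple_root D i) (simple_root D i) * pairing (simple_coroot D i) x"
    unfolding root_form_simple by (simp only: mult.assoc)
qed

text \<open>Nondegeneracy of the Cartan matrix: such a combination has norm 0, hence pairs to 0 with
  every coroot and has form 0 with every weight; independence of the simple coroots then kills the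
  coefficients.\<close>

lemma simple_root_combination_zero:
  assumes zero: "\<And>i. pairing (simple_coroot D i) (\<Sum>j\<in>UNIV. a j *s simple_root D j) = 0"
  shows "a j = 0"
proof -
  let ?\<beta> = "\<Sum>j\<in>UNIV. a j *s simple_root D j"
  have "root_form D ?\<beta> ?\<beta> = 0" using root_form_simple_sum[of a ?\<beta>] zero by simp
  then have "(pairing (coroot D \<gamma>) ?\<beta>)\<^sup>2 \<le> 0" if "\<gamma> \<in> roots D" for \<gamma>
    using pairing_square_le_root_form[OF that, of ?\<beta>] by simp
  then have "root_form D ?\<beta> x = 0" for x unfolding root_form_def by (intro sum.neutral) auto
  then have "(\<Sum>i\<in>UNIV. (a i * root_form D (simple_root D i) (simple_root D i))
      * pairing (simple_coroot D i) x) = 0" for x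
    using root_form_simple_sum[of a x] by simp
  then have "a j * root_form D (simple_root D j) (simple_root D j) = 0"
    by (rule simple_coroots_independent)
  then show ?thesis using root_form_simple_pos[of j] by simp
qed

lemma size_eq_if_root_pairings_eq:
  assumes "\<And>i. pairing (simple_coroot D i) (root_sum D S) = pairing (simple_coroot D i) (root_sum D T)"
  shows "size S = size T"
proof -
  have diff: "root_sum D S - root_sum D T = (\<Sum>i\<in>UNIV. (int (row_size S i) - int (row_size T i)) *s simple_root D i)"
    by (simp add: root_sum_eq vec_eq_iff sum_subtractf algebra_simps)
  have "pairing (simple_coroot D i)
      (\<Sum>i\<in>UNIV. (int (row_size S i) - int (row_size T i)) *s simple_root D i) = 0" for i
    unfolding diff[symmetric] using assms[of i] by simp
  then have "int (row_size S i) - int (row_size T i) = 0" for i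
    by (rule simple_root_combination_zero)
  then show ?thesis by (simp add: size_eq_sum_row_size)
qed

text \<open>The pairings with simple coroots are bounded by the norm \<open>K\<close> of the highest
  weight, so they take finitely many values, and they determine the size of
  \<open>S\<close>.\<close>

lemma finite_rep_dims:
  assumes adm: "admissible D R"
  shows "finite {S. rep_dim D R S}"
proof -
  let ?A = "{S. rep_dim D R S}"
  define K where "K = root_form D (mset_wt D R) (mset_wt D R)"
  define t where "t S = (\<lambda>i. pairing (simple_coroot D i) (wt (rep_monomial D R S)))" for S
  have "t S i \<in> {- K..K}" if "rep_dim D R S" for S i
  proof -
    have "\<bar>t S i\<bar> \<le> (t S i)\<^sup>2"
    proof (cases "t S i = 0")
      case False
      then show ?thesis using mult_left_mono[of 1 "\<bar>t S i\<bar>" "\<bar>t S i\<bar>"] by (simp add: power2_eq_square)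
    qed simp
    also have "\<dots> \<le> K"
      unfolding t_def K_def simple_coroot_def
      using pairing_square_le_root_form[OF simple_root_in_roots] root_form_wt_le[OF adm that]
      by (rule order.trans)
    finally show ?thesis by (auto simp: abs_le_iff)
  qed
  then have "t ` ?A \<subseteq> (UNIV \<rightarrow>\<^sub>E {- K..K})" by blast
  moreover have "finite ((UNIV :: 'i set) \<rightarrow>\<^sub>E {- K..K})" by (intro finite_PiE) auto
  ultimately have "finite (t ` ?A)" by (rule finite_subset)
  \<comment> \<open>Finitely many sizes: one representative \<open>S\<close> is chosen for each
    value of \<open>t\<close>, and all others with that value share its size.\<close>
  then have fin: "finite ((\<lambda>v. size (inv_into ?A t v)) ` t ` ?A)" by (rule finite_imageI)
  have size: "size S = size T" if "t S = t T" for S T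
  proof (rule size_eq_if_root_pairings_eq)
    fix i show "pairing (simple_coroot D i) (root_sum D S) = pairing (simple_coroot D i) (root_sum D T)"
      using fun_cong[OF that, of i] by (simp add: t_def wt_rep_monomial)
  qed
  have "size (inv_into ?A t (t S)) = size S" if "S \<in> ?A" for S
    using that by (intro size f_inv_into_f imageI)
  then have "(\<lambda>v. size (inv_into ?A t v)) ` t ` ?A = size ` ?A"
    unfolding image_image by (rule image_cong[OF refl])
  with fin have "finite (size ` ?A)" by (simp only:)
  then obtain n where "\<forall>m\<in>size ` ?A. m \<le> n" using finite_nat_set_iff_bounded_le by blast
  then show ?thesis by (intro finite_rep_dim_if_bounded[of R n]) auto
qed

lemma finite_truncation:
  assumes "admissible D R" "set_mset R \<subseteq> J"
  shows "finite (truncation D R J)"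
  unfolding truncation_eq[OF assms]
  by (rule finite_imageI, rule finite_subset[OF _ finite_rep_dims[OF assms(1)]]) auto

end


section \<open>Demazure operators\<close>

text \<open>A product of zero makes the support of \<open>g\<close> stable under adding
  \<open>\<alpha>\<close>, which no nonempty finite set is when \<open>\<alpha>\<close> is
  nonzero.\<close>

lemma mult_one_minus_gexp_cancel:
  fixes g :: "(int ^ 'r::finite) \<Rightarrow>\<^sub>0 int"
  assumes g: "g * (1 - gexp (- \<alpha>)) = 0" and \<alpha>: "\<alpha> \<noteq> 0"
  shows "g = 0"
proof (rule ccontr)
  assume "g \<noteq> 0"
  then obtain \<mu> where \<mu>: "\<mu> \<in> Poly_Mapping.keys g" by fastforce
  have eq: "g = g * gexp (- \<alpha>)" using g by (simp add: right_diff_distrib)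
  have shift: "\<nu> + \<alpha> \<in> Poly_Mapping.keys g" if "\<nu> \<in> Poly_Mapping.keys g" for \<nu>
  proof -
    have "\<nu> \<in> Poly_Mapping.keys (g * gexp (- \<alpha>))" using that eq by simp
    then obtain a b where "\<nu> = a + b" "a \<in> Poly_Mapping.keys g" "b \<in> Poly_Mapping.keys (gexp (- \<alpha>))"
      using keys_mult[of g "gexp (- \<alpha>)"] by blast
    then show ?thesis by (simp add: gexp_def)
  qed
  have "\<mu> + int n *s \<alpha> \<in> Poly_Mapping.keys g" for n
  proof (induction n)
    case (Suc n)
    have eq: "\<mu> + int (Suc n) *s \<alpha> = \<mu> + int n *s \<alpha> + \<alpha>" by (simp add: vec_eq_iff algebra_simps)
    show ?case unfolding eq by (rule shift[OF Suc])
  qed (simp add: \<mu>)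
  then have "range (\<lambda>n. \<mu> + int n *s \<alpha>) \<subseteq> Poly_Mapping.keys g" by blast
  moreover have "inj (\<lambda>n. \<mu> + int n *s \<alpha>)"
    using \<alpha> by (intro injI) (auto simp: vec_eq_iff)
  ultimately show False using finite_subset finite_keys finite_imageD infinite_UNIV_nat by metis
qed

lemma gexp_power: "gexp \<mu> ^ k = gexp (int k *s \<mu>)"
proof (induction k)
  case 0
  then show ?case by (simp add: gexp_def)
next
  case (Suc k)
  have "int (Suc k) *s \<mu> = \<mu> + int k *s \<mu>" by (simp add: vec_eq_iff algebra_simps)
  then show ?case using Suc by (simp add: gexp_add)
qed

lemma gexp_string:
  "(\<Sum>m<k. gexp (\<mu> - int m *s \<alpha>)) * (1 - gexp (- \<alpha>)) = gexp \<mu> - gexp (\<mu> - int k *s \<alpha>)"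
proof -
  have pow: "gexp (\<mu> - int m *s \<alpha>) = gexp \<mu> * gexp (- \<alpha>) ^ m" for m
    unfolding gexp_power gexp_add[symmetric] by (rule arg_cong[of _ _ gexp]) (simp add: vec_eq_iff)
  have "(\<Sum>m<k. gexp (\<mu> - int m *s \<alpha>)) * (1 - gexp (- \<alpha>))
      = gexp \<mu> * ((1 - gexp (- \<alpha>)) * (\<Sum>m<k. gexp (- \<alpha>) ^ m))"
    by (simp add: pow sum_distrib_left mult_ac)
  also have "\<dots> = gexp \<mu> * (1 - gexp (- \<alpha>) ^ k)" by (simp only: one_diff_power_eq)
  finally show ?thesis by (simp add: pow right_diff_distrib)
qed

lemma demazure_superset:
  assumes "finite K" "Poly_Mapping.keys f \<subseteq> K"
  shows "demazure D i f = (\<Sum>\<mu>\<in>K. of_int (Poly_Mapping.lookup f \<mu>) * demazure_exp D i \<mu>)"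
  unfolding demazure_def using assms by (intro sum.mono_neutral_left) (auto simp: in_keys_iff)

lemma demazure_add: "demazure D i (f + g) = demazure D i f + demazure D i g"
proof -
  let ?K = "Poly_Mapping.keys f \<union> Poly_Mapping.keys g"
  have "demazure D i h = (\<Sum>\<mu>\<in>?K. of_int (Poly_Mapping.lookup h \<mu>) * demazure_exp D i \<mu>)"
    if "h \<in> {f, g, f + g}" for h
    using that keys_add[of f g] by (intro demazure_superset) auto
  then show ?thesis by (simp add: lookup_add distrib_right sum.distrib)
qed

lemma demazure_gexp: "demazure D i (gexp \<mu>) = demazure_exp D i \<mu>"
  by (simp add: demazure_def gexp_def)

lemma demazure_sum_gexp: "demazure D i (\<Sum>a\<in>A. gexp (w a)) = (\<Sum>a\<in>A. demazure_exp D i (w a))"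
proof (induction A rule: infinite_finite_induct)
  case (insert a A)
  then show ?case by (simp add: demazure_add demazure_gexp)
qed (simp_all add: demazure_def)

context simply_laced_datum
begin

lemma simple_root_nonzero: "simple_root D i \<noteq> 0"
  by (metis pairing_simple pairing_zero zero_neq_numeral)

lemma gexp_cancel:
  assumes "g * (1 - gexp (- simple_root D i)) = h * (1 - gexp (- simple_root D i))"
  shows "g = h"
  using mult_one_minus_gexp_cancel[OF _ simple_root_nonzero, of "g - h" i] assms
  by (simp add: left_diff_distrib)

text \<open>Turns the description in \<open>demazure_exp\<close> into an equation. Existence of the
  quotient is a geometric sum, or minus one started at the other end; uniqueness is
  \<open>gexp_cancel\<close>.\<close>

lemma demazure_exp_mult:
  "demazure_exp D i \<mu> * (1 - gexp (- simple_root D i)) =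
    gexp \<mu> - gexp (simple_refl D i \<mu> - simple_root D i)"
proof -
  let ?\<alpha> = "simple_root D i" and ?m = "pairing (simple_coroot D i) \<mu> + 1"
  let ?\<nu> = "simple_refl D i \<mu> - ?\<alpha>"
  have \<nu>: "?\<nu> = \<mu> - ?m *s ?\<alpha>" by (simp add: simple_refl_def vec_eq_iff algebra_simps)
  have "\<exists>g. g * (1 - gexp (- ?\<alpha>)) = gexp \<mu> - gexp ?\<nu>"
  proof (cases "?m \<ge> 0")
    case True
    then show ?thesis using gexp_string[where k = "nat ?m" and \<mu> = \<mu> and \<alpha> = ?\<alpha>] unfolding \<nu> by auto
  next
    case False
    then have k: "int (nat (- ?m)) = - ?m" by simp
    have "\<mu> = ?\<nu> - int (nat (- ?m)) *s ?\<alpha>"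
      unfolding k \<nu> by (simp add: vec_eq_iff algebra_simps)
    then have "(- (\<Sum>m<nat (- ?m). gexp (?\<nu> - int m *s ?\<alpha>))) * (1 - gexp (- ?\<alpha>)) = gexp \<mu> - gexp ?\<nu>"
      using gexp_string[where k = "nat (- ?m)" and \<mu> = ?\<nu> and \<alpha> = ?\<alpha>] by simp
    then show ?thesis by blast
  qed
  then obtain g where g: "g * (1 - gexp (- ?\<alpha>)) = gexp \<mu> - gexp ?\<nu>" by blast
  then have "\<exists>!g. g * (1 - gexp (- ?\<alpha>)) = gexp \<mu> - gexp ?\<nu>" using gexp_cancel by metis
  then show ?thesis unfolding demazure_exp_def by (rule theI')
qed

text \<open>The case of a string of which the truncation keeps only the top element.\<close>

lemma demazure_exp_string:
  assumes "pairing (simple_coroot D i) \<mu> = int n"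
  shows "demazure_exp D i \<mu> = (\<Sum>m\<le>n. gexp (\<mu> - int m *s simple_root D i))"
proof (rule gexp_cancel)
  have "simple_refl D i \<mu> - simple_root D i = \<mu> - int (Suc n) *s simple_root D i"
    using assms by (simp add: simple_refl_def vec_eq_iff algebra_simps)
  then show "demazure_exp D i \<mu> * (1 - gexp (- simple_root D i)) =
      (\<Sum>m\<le>n. gexp (\<mu> - int m *s simple_root D i)) * (1 - gexp (- simple_root D i))"
    unfolding demazure_exp_mult lessThan_Suc_atMost[symmetric] gexp_string by simp
qed

text \<open>A full string is fixed because its weights are symmetric under the reflection.\<close>

lemma sum_demazure_exp_string:
  assumes "pairing (simple_coroot D i) \<mu> = int n"
  shows "(\<Sum>m\<le>n. demazure_exp D i (\<mu> - int m *s simple_root D i)) =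
    (\<Sum>m\<le>n. gexp (\<mu> - int m *s simple_root D i))"
proof (rule gexp_cancel)
  let ?\<alpha> = "simple_root D i"
  have refl: "simple_refl D i (\<mu> - int m *s ?\<alpha>) - ?\<alpha> = \<mu> - int (Suc (n - m)) *s ?\<alpha>" if "m \<le> n" for m
    using assms that by (simp add: simple_refl_def vec_eq_iff algebra_simps)
  have "(\<Sum>m\<le>n. demazure_exp D i (\<mu> - int m *s ?\<alpha>)) * (1 - gexp (- ?\<alpha>))
      = (\<Sum>m\<le>n. gexp (\<mu> - int m *s ?\<alpha>)) - (\<Sum>m\<le>n. gexp (\<mu> - int (Suc (n - m)) *s ?\<alpha>))"
    unfolding sum_distrib_right demazure_exp_mult sum_subtractf
    using refl by (intro arg_cong2[of _ _ _ _ minus] sum.cong) auto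
  also have "(\<Sum>m\<le>n. gexp (\<mu> - int (Suc (n - m)) *s ?\<alpha>)) = (\<Sum>m\<le>n. gexp (\<mu> - int (Suc m) *s ?\<alpha>))"
    using sum.nat_diff_reindex[of "\<lambda>m. gexp (\<mu> - int (Suc m) *s ?\<alpha>)" "Suc n"]
    by (simp add: lessThan_Suc_atMost del: of_nat_Suc)
  also have "(\<Sum>m\<le>n. gexp (\<mu> - int m *s ?\<alpha>)) - (\<Sum>m\<le>n. gexp (\<mu> - int (Suc m) *s ?\<alpha>))
      = gexp \<mu> - gexp (\<mu> - int (Suc n) *s ?\<alpha>)"
    using sum_telescope[of "\<lambda>m. gexp (\<mu> - int m *s ?\<alpha>)" n]
    by (simp add: sum_subtractf del: of_nat_Suc)
  finally show "(\<Sum>m\<le>n. demazure_exp D i (\<mu> - int m *s ?\<alpha>)) * (1 - gexp (- ?\<alpha>))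
      = (\<Sum>m\<le>n. gexp (\<mu> - int m *s ?\<alpha>)) * (1 - gexp (- ?\<alpha>))"
    unfolding lessThan_Suc_atMost[symmetric] gexp_string .
qed


section \<open>Strings\<close>

text \<open>A total version of \<open>f_op\<close>, so that it can be iterated with
  \<open>^^\<close>; it is meaningful only where \<open>f_op\<close> is not
  \<open>None\<close>.\<close>

definition f_step :: "'i \<Rightarrow> ('r, 'i) monomial \<Rightarrow> ('r, 'i) monomial"
  where "f_step i p = the (f_op D i p)"

definition e_step :: "'i \<Rightarrow> ('r, 'i) monomial \<Rightarrow> ('r, 'i) monomial"
  where "e_step i p = the (e_op D i p)"

lemma wt_f_op:
  assumes "p \<in> monomial_crystal D" "f_op D i p = Some q"
  shows "wt q = wt p - simple_root D i"
  using f_op_SomeE[OF assms] by force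

lemma eps_f_op:
  assumes "p \<in> monomial_crystal D" "f_op D i p = Some q"
  shows "eps D i q = eps D i p + 1"
  using e_op_f_op[OF assms] wt_f_op[OF assms] phi_diff_eps[OF assms(1), of i] phi_diff_eps[of q i]
  by simp

text \<open>Closure is required for one vertex \<open>i\<close> only, since a truncation need not be
  stable under the lowering operators of other vertices.\<close>

context
  fixes X :: "('r, 'i) monomial set" and i :: 'i
  assumes X: "X \<subseteq> monomial_crystal D"
    and e_closed: "\<And>p q. p \<in> X \<Longrightarrow> e_op D i p = Some q \<Longrightarrow> q \<in> X"
    and f_closed: "\<And>p q. p \<in> X \<Longrightarrow> f_op D i p = Some q \<Longrightarrow> q \<in> X"
begin

lemma f_step_props:
  assumes p: "p \<in> X" and "phi D i p > 0"
  shows "f_op D i p = Some (f_step i p)" "f_step i p \<in> X" "e_step i (f_step i p) = p"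
    "phi D i (f_step i p) = phi D i p - 1" "eps D i (f_step i p) = eps D i p + 1"
    "wt (f_step i p) = wt p - simple_root D i"
proof -
  have "f_op D i p \<noteq> None" using assms(2) by (simp add: f_op_eq_None_iff)
  then show *: "f_op D i p = Some (f_step i p)" by (auto simp: f_step_def)
  have pM: "p \<in> monomial_crystal D" using X p by blast
  show "f_step i p \<in> X" using f_closed[OF p *] .
  show "e_step i (f_step i p) = p" "phi D i (f_step i p) = phi D i p - 1"
    using e_op_f_op[OF pM *] by (auto simp: e_step_def)
  show "eps D i (f_step i p) = eps D i p + 1" using eps_f_op[OF pM *] .
  show "wt (f_step i p) = wt p - simple_root D i" using wt_f_op[OF pM *] .
qed

lemma e_step_props:
  assumes p: "p \<in> X" and "eps D i p > 0"
  shows "e_step i p \<in> X" "f_step i (e_step i p) = p" "phi D i (e_step i p) = phi D i p + 1"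
    "eps D i (e_step i p) = eps D i p - 1"
proof -
  have "e_op D i p \<noteq> None" using assms(2) by (simp add: e_op_eq_None_iff)
  then have *: "e_op D i p = Some (e_step i p)" by (auto simp: e_step_def)
  have pM: "p \<in> monomial_crystal D" using X p by blast
  note q = f_op_e_op[OF pM *]
  show "e_step i p \<in> X" using e_closed[OF p *] .
  show "f_step i (e_step i p) = p" "phi D i (e_step i p) = phi D i p + 1"
    using q by (auto simp: f_step_def)
  show "eps D i (e_step i p) = eps D i p - 1" using eps_f_op[OF q(1,2)] by simp
qed

lemma f_step_iterate:
  assumes p: "p \<in> X" and "int m \<le> phi D i p"
  shows "(f_step i ^^ m) p \<in> X \<and> (e_step i ^^ m) ((f_step i ^^ m) p) = p \<and>
    phi D i ((f_step i ^^ m) p) = phi D i p - int m \<and>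
    eps D i ((f_step i ^^ m) p) = eps D i p + int m \<and>
    wt ((f_step i ^^ m) p) = wt p - int m *s simple_root D i"
  using assms(2)
proof (induction m)
  case (Suc m)
  let ?q = "(f_step i ^^ m) p"
  have IH: "?q \<in> X" "(e_step i ^^ m) ?q = p" "phi D i ?q = phi D i p - int m"
    "eps D i ?q = eps D i p + int m" "wt ?q = wt p - int m *s simple_root D i"
    using Suc by auto
  then have "phi D i ?q > 0" using Suc.prems by simp
  note step = f_step_props[OF IH(1) this]
  have "(e_step i ^^ Suc m) ((f_step i ^^ Suc m) p) = (e_step i ^^ m) ?q"
    using step(3) by (simp add: funpow_swap1)
  moreover have "wt p - int m *s simple_root D i - simple_root D i = wt p - int (Suc m) *s simple_root D i"
    by (simp add: vec_eq_iff algebra_simps)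
  ultimately show ?case using IH step by simp
qed (simp add: p vec_eq_iff)

lemma e_step_iterate:
  assumes p: "p \<in> X" and "int m \<le> eps D i p"
  shows "(e_step i ^^ m) p \<in> X \<and> (f_step i ^^ m) ((e_step i ^^ m) p) = p \<and>
    phi D i ((e_step i ^^ m) p) = phi D i p + int m \<and>
    eps D i ((e_step i ^^ m) p) = eps D i p - int m"
  using assms(2)
proof (induction m)
  case (Suc m)
  let ?q = "(e_step i ^^ m) p"
  have IH: "?q \<in> X" "(f_step i ^^ m) ?q = p" "phi D i ?q = phi D i p + int m"
    "eps D i ?q = eps D i p - int m" using Suc by auto
  then have "eps D i ?q > 0" using Suc.prems by simp
  note step = e_step_props[OF IH(1) this]
  have "(f_step i ^^ Suc m) ((e_step i ^^ Suc m) p) = (f_step i ^^ m) ?q"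
    using step(2) by (simp add: funpow_swap1)
  then show ?case using IH step by simp
qed (simp add: p)

text \<open>The inverse climbs as far as possible: \<open>eps\<close> counts the steps from the top
  of the string, and \<open>phi\<close> of the top is the length of the string.\<close>

lemma string_bij:
  "bij_betw (\<lambda>(p, m). (f_step i ^^ m) p) (SIGMA p : {p \<in> X. eps D i p = 0}. {..nat (phi D i p)}) X"
proof (rule bij_betw_byWitness[where f' = "\<lambda>q. ((e_step i ^^ nat (eps D i q)) q, nat (eps D i q))"])
  have "eps D i ((f_step i ^^ m) p) = int m \<and> (e_step i ^^ m) ((f_step i ^^ m) p) = p \<and>
      (f_step i ^^ m) p \<in> X"
    if "p \<in> X" "eps D i p = 0" "m \<le> nat (phi D i p)" for p m
    using f_step_iterate[OF that(1), of m] that phi_nonneg[of i p] by simp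
  then show "\<forall>y\<in>(SIGMA p : {p \<in> X. eps D i p = 0}. {..nat (phi D i p)}).
      ((e_step i ^^ nat (eps D i (case y of (p, m) \<Rightarrow> (f_step i ^^ m) p)))
        (case y of (p, m) \<Rightarrow> (f_step i ^^ m) p),
       nat (eps D i (case y of (p, m) \<Rightarrow> (f_step i ^^ m) p))) = y"
    "(\<lambda>(p, m). (f_step i ^^ m) p) ` (SIGMA p : {p \<in> X. eps D i p = 0}. {..nat (phi D i p)}) \<subseteq> X"
    by auto
  have "(e_step i ^^ nat (eps D i q)) q \<in> X \<and> eps D i ((e_step i ^^ nat (eps D i q)) q) = 0 \<and>
      nat (eps D i q) \<le> nat (phi D i ((e_step i ^^ nat (eps D i q)) q)) \<and>
      (f_step i ^^ nat (eps D i q)) ((e_step i ^^ nat (eps D i q)) q) = q" if "q \<in> X" for q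
  proof -
    have "eps D i q \<ge> 0" using eps_nonneg X that by blast
    then show ?thesis using e_step_iterate[OF that, of "nat (eps D i q)"] phi_nonneg[of i q] by simp
  qed
  then show "\<forall>q\<in>X. (case ((e_step i ^^ nat (eps D i q)) q, nat (eps D i q)) of
      (p, m) \<Rightarrow> (f_step i ^^ m) p) = q"
    "(\<lambda>q. ((e_step i ^^ nat (eps D i q)) q, nat (eps D i q))) ` X
      \<subseteq> (SIGMA p : {p \<in> X. eps D i p = 0}. {..nat (phi D i p)})"
    by auto
qed

text \<open>The conditions on \<open>Y\<close> say that it contains every string top and, once it
  leaves the top, cannot stop before the end; so it meets each string in its top or in all of
  it.\<close>

lemma ch_string_extension:
  assumes fin: "finite X" and Y: "Y \<subseteq> X"
    and e_Y: "\<And>p q. p \<in> Y \<Longrightarrow> e_op D i p = Some q \<Longrightarrow> q \<in> Y"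
    and f_Y: "\<And>p q. p \<in> Y \<Longrightarrow> eps D i p \<noteq> 0 \<Longrightarrow> f_op D i p = Some q \<Longrightarrow> q \<in> Y"
    and hw_Y: "\<And>p. p \<in> X \<Longrightarrow> eps D i p = 0 \<Longrightarrow> p \<in> Y"
  shows "ch X = demazure D i (ch Y)"
proof -
  let ?H = "{p \<in> X. eps D i p = 0}" and ?\<alpha> = "simple_root D i"
  let ?T = "\<lambda>p. {..nat (phi D i p)}"
  have strings: "(\<Sum>q\<in>X. h q) = (\<Sum>p\<in>?H. \<Sum>m\<in>?T p. h ((f_step i ^^ m) p))"
    for h :: "('r, 'i) monomial \<Rightarrow> (int ^ 'r) \<Rightarrow>\<^sub>0 int"
  proof -
    have "(\<Sum>q\<in>X. h q) = (\<Sum>y\<in>Sigma ?H ?T. h (case y of (p, m) \<Rightarrow> (f_step i ^^ m) p))"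
      by (rule sum.reindex_bij_betw[OF string_bij, symmetric])
    also have "\<dots> = (\<Sum>p\<in>?H. \<Sum>m\<in>?T p. h ((f_step i ^^ m) p))"
      using fin by (subst sum.Sigma) (auto intro!: sum.cong)
    finally show ?thesis .
  qed
  \<comment> \<open>The decomposition into strings is available for \<open>X\<close>, so
    \<open>Y\<close> enters through an indicator.\<close>
  have string: "(\<Sum>m\<in>?T p. if (f_step i ^^ m) p \<in> Y then demazure_exp D i (wt ((f_step i ^^ m) p)) else 0)
      = (\<Sum>m\<in>?T p. gexp (wt ((f_step i ^^ m) p)))" if p: "p \<in> ?H" for p
  proof -
    define n where "n = nat (phi D i p)"
    have n: "int n = phi D i p" using phi_nonneg[of i p] by (simp add: n_def)
    have pX: "p \<in> X" and pM: "p \<in> monomial_crystal D" and pY: "p \<in> Y" using p X hw_Y by auto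
    have pair: "pairing (simple_coroot D i) (wt p) = int n"
      using phi_diff_eps[OF pM, of i] p n by simp
    have it: "(f_step i ^^ m) p \<in> X" "phi D i ((f_step i ^^ m) p) = int n - int m"
      "eps D i ((f_step i ^^ m) p) = int m" "wt ((f_step i ^^ m) p) = wt p - int m *s ?\<alpha>" if "m \<le> n" for m
      using f_step_iterate[OF pX, of m] that n p by auto
    have op: "f_op D i ((f_step i ^^ m) p) = Some ((f_step i ^^ Suc m) p)" if "Suc m \<le> n" for m
      using f_step_props(1)[OF it(1)[of m]] it(2)[of m] that by simp
    \<comment> \<open>Below the top, membership in \<open>Y\<close> passes down by
      \<open>f_Y\<close>, because \<open>eps\<close> is nonzero there, and up by \<open>e_Y\<close>.
      Hence the first step decides.\<close>
    have in_Y: "(f_step i ^^ m) p \<in> Y \<longleftrightarrow> f_step i p \<in> Y" if "0 < m" "m \<le> n" for m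
      using that
    proof (induction m)
      case (Suc m)
      show ?case
      proof (cases "m = 0")
        case False
        have "(f_step i ^^ Suc m) p \<in> Y \<longleftrightarrow> (f_step i ^^ m) p \<in> Y"
        proof
          assume "(f_step i ^^ Suc m) p \<in> Y"
          moreover have "(f_step i ^^ m) p \<in> monomial_crystal D" using it(1)[of m] X Suc.prems by auto
          ultimately show "(f_step i ^^ m) p \<in> Y"
            using e_Y e_op_f_op(2) op[OF Suc.prems(2)] by blast
        next
          assume "(f_step i ^^ m) p \<in> Y"
          then show "(f_step i ^^ Suc m) p \<in> Y"
            using f_Y[OF _ _ op[OF Suc.prems(2)]] it(3)[of m] False Suc.prems(2) by simp
        qed
        then show ?thesis using Suc False by simp
      qed simp
    qed simp
    have gexp: "(\<Sum>m\<le>n. gexp (wt ((f_step i ^^ m) p))) = (\<Sum>m\<le>n. gexp (wt p - int m *s ?\<alpha>))"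
      using it(4) by (intro sum.cong) auto
    have "(\<Sum>m\<le>n. if (f_step i ^^ m) p \<in> Y then demazure_exp D i (wt ((f_step i ^^ m) p)) else 0)
        = (\<Sum>m\<le>n. gexp (wt p - int m *s ?\<alpha>))"
    proof (cases "f_step i p \<in> Y")
      case True
      have "(f_step i ^^ m) p \<in> Y" if "m \<le> n" for m
        using in_Y[OF _ that] True pY by (cases "m = 0") auto
      then have "(\<Sum>m\<le>n. if (f_step i ^^ m) p \<in> Y then demazure_exp D i (wt ((f_step i ^^ m) p)) else 0)
          = (\<Sum>m\<le>n. demazure_exp D i (wt p - int m *s ?\<alpha>))"
        using it(4) by (intro sum.cong) auto
      then show ?thesis using sum_demazure_exp_string[OF pair] by simp
    next
      case False
      have "(f_step i ^^ m) p \<in> Y \<longleftrightarrow> m = 0" if "m \<le> n" for m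
        using in_Y[OF _ that] False pY by (cases "m = 0") auto
      then have "(\<Sum>m\<le>n. if (f_step i ^^ m) p \<in> Y then demazure_exp D i (wt ((f_step i ^^ m) p)) else 0)
          = (\<Sum>m\<le>n. if m = 0 then demazure_exp D i (wt p) else 0)"
        by (intro sum.cong) auto
      then show ?thesis using demazure_exp_string[OF pair] by simp
    qed
    then show ?thesis unfolding n_def[symmetric] gexp .
  qed
  have "ch X = (\<Sum>p\<in>?H. \<Sum>m\<in>?T p. gexp (wt ((f_step i ^^ m) p)))"
    unfolding ch_def by (rule strings)
  also have "\<dots> = (\<Sum>p\<in>?H. \<Sum>m\<in>?T p.
      if (f_step i ^^ m) p \<in> Y then demazure_exp D i (wt ((f_step i ^^ m) p)) else 0)"
    by (intro sum.cong refl string[symmetric])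
  also have "\<dots> = (\<Sum>q\<in>X. if q \<in> Y then demazure_exp D i (wt q) else 0)"
    by (rule strings[symmetric])
  also have "\<dots> = (\<Sum>q\<in>Y. demazure_exp D i (wt q))"
    using Y fin by (intro sum.mono_neutral_cong_right) auto
  finally show ?thesis unfolding ch_def demazure_sum_gexp .
qed

end


section \<open>Extending a truncation by one element\<close>

lemma cover_up: "(cover D)\<^sup>*\<^sup>* (i, k) (i, k + 2 * int n)"
proof (induction n)
  case (Suc n)
  have "cover D (i, k + 2 * int n) (i, k + 2 * int n + 2)" by (rule cover.intros)
  with Suc show ?case by (simp add: algebra_simps rtranclp.rtrancl_into_rtrancl)
qed simp

lemma upward_closed_row:
  assumes J: "upward_closed D J" and k: "(i, k) \<in> J" and l: "(i, l) \<in> parity_pairs D" "k \<le> l"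
  shows "(i, l) \<in> J"
proof -
  have "even (l - k)" using J k l parity_diff unfolding upward_closed_def by blast
  then obtain n where "l - k = 2 * n" by (rule evenE)
  then have "l = k + 2 * int (nat n)" using l(2) by simp
  then show ?thesis using J k cover_up[of i k "nat n"] unfolding upward_closed_def by metis
qed

lemma upward_closed_adj:
  assumes "upward_closed D J" "adj D i j" "(j, k) \<in> J"
  shows "(i, k + 1) \<in> J"
  using assms cover.intros(2)[OF assms(2), of k] unfolding upward_closed_def by blast

text \<open>In row \<open>i\<close> the set \<open>J\<close> starts strictly above \<open>k\<close>,
  so an occurrence of \<open>(i, k)\<close> in \<open>S\<close> shows up as a negative exponent at
  the bottom of the row.\<close>

lemma ch_truncation_insert:
  assumes adm: "admissible D R" and J: "upward_closed D J" and R: "set_mset R \<subseteq> J"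
    and J': "upward_closed D J'" "J' = insert (i, k) J" and new: "(i, k) \<notin> J"
  shows "ch (truncation D R J') = demazure D i (ch (truncation D R J))"
proof -
  let ?p = "rep_monomial D R"
  have R': "set_mset R \<subseteq> J'" using R J'(2) by auto
  have par_k: "(i, k) \<in> parity_pairs D" using J' by (auto simp: upward_closed_def)
  note T = truncation_eq[OF adm R] and T' = truncation_eq[OF adm R']
  have row_J: "k < c" if "(i, c) \<in> J" for c
    using upward_closed_row[OF J that par_k] new by force
  \<comment> \<open>The neighbour cannot be the new element, as its vertex is not \<open>i\<close>;
    so it lies in \<open>J\<close> already.\<close>
  have adj_J: "(i, c) \<in> J" if "adj D i j" "(j, c - 1) \<in> J'" for j c
    using upward_closed_adj[OF J that(1), of "c - 1"] that J'(2) adj_irrefl[of i] by auto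
  have pM: "?p S \<in> monomial_crystal D" if "rep_dim D R S" for S
    using rep_monomial_rep_dim_in_crystal[OF adm that] .
  have low_coeff: "row_coeff D R S i c = - int (count S (i, c))"
    if S: "set_mset S \<subseteq> J'" and c: "c \<le> k" for S c
  proof -
    have nJ: "(i, c) \<notin> J" using row_J[of c] c by auto
    have "(i, c) \<notin># R" using nJ R by auto
    moreover have "(j, c - 1) \<notin># S" if "adj D i j" for j using adj_J[OF that, of c] nJ S by auto
    moreover have "(i, c - 2) \<notin># S" using row_J[of "c - 2"] c S J'(2) by auto
    ultimately show ?thesis by (simp add: row_coeff_def not_in_iff)
  qed
  have low: "k \<le> c" if S: "set_mset S \<subseteq> J'" and "expn (?p S) i c \<noteq> 0" for S c
  proof (rule ccontr)
    assume c: "\<not> k \<le> c"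
    then have "(i, c) \<notin># S" using row_J[of c] S J'(2) by auto
    then have "row_coeff D R S i c = 0" using low_coeff[OF S, of c] c by (simp add: not_in_iff)
    with that show False by (simp add: expn_rep_monomial)
  qed
  \<comment> \<open>A positive exponent at \<open>F\<close> needs \<open>(i, F)\<close> in
    \<open>R\<close> or an occupied neighbour below it; either puts \<open>(i, F)\<close> in
    \<open>J\<close>. Then \<open>F > k\<close>, and by parity \<open>F - 2\<close> is still at
    least \<open>k\<close>.\<close>
  have f_pos: "(i, F - 2) \<in> J'"
    if S: "rep_dim D R S" "set_mset S \<subseteq> J'" and pos: "row_coeff D R S i F > 0" for S F
  proof -
    have "(i, F) \<in> J"
    proof (rule ccontr)
      assume nJ: "(i, F) \<notin> J"
      then have "(i, F) \<notin># R" using R by auto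
      moreover have "(j, F - 1) \<notin># S" if "adj D i j" for j using adj_J[OF that, of F] nJ S(2) by auto
      ultimately show False using pos by (simp add: row_coeff_def not_in_iff)
    qed
    then have F: "k < F" "(i, F) \<in> parity_pairs D" using row_J J by (auto simp: upward_closed_def)
    then have "k \<le> F - 2" using parity_less_iff[OF par_k F(2)] by simp
    then show ?thesis using upward_closed_row[OF J'(1), of i k "F - 2"] J'(2) F(2) by simp
  qed
  show ?thesis
  proof (rule ch_string_extension)
    show "truncation D R J' \<subseteq> monomial_crystal D" unfolding T' using pM by auto
    show "finite (truncation D R J')" by (rule finite_truncation[OF adm R'])
    show "truncation D R J \<subseteq> truncation D R J'" unfolding T T' using J'(2) by auto
    \<comment> \<open>Raising only removes an element of \<open>S\<close>, so every support
      condition \<open>K\<close> survives; this serves for both \<open>J'\<close> and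
      \<open>J\<close>.\<close>
    have e: "q \<in> rep_monomial D R ` {S. rep_dim D R S \<and> set_mset S \<subseteq> K}"
      if p: "p \<in> rep_monomial D R ` {S. rep_dim D R S \<and> set_mset S \<subseteq> K}" "e_op D i p = Some q" for p q K
    proof -
      obtain S where S: "p = ?p S" "rep_dim D R S" "set_mset S \<subseteq> K" using p(1) by auto
      from e_op_rep_monomial[OF adm S(2)] p(2) S(1) obtain l
        where "q = ?p (S - {#(i, l)#})" "rep_dim D R (S - {#(i, l)#})" by metis
      then show ?thesis using S(3) by (auto dest: in_diffD)
    qed
    show "q \<in> truncation D R J'" if "p \<in> truncation D R J'" "e_op D i p = Some q" for p q
      using e that unfolding T' .
    show "q \<in> truncation D R J" if "p \<in> truncation D R J" "e_op D i p = Some q" for p q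
      using e that unfolding T .
    show "q \<in> truncation D R J'" if p: "p \<in> truncation D R J'" "f_op D i p = Some q" for p q
    proof -
      obtain S where S: "p = ?p S" "rep_dim D R S" "set_mset S \<subseteq> J'" using p(1) unfolding T' by auto
      from f_op_rep_monomial[OF adm S(2)] p(2) S(1) obtain F
        where F: "row_coeff D R S i F > 0" "q = ?p (add_mset (i, F - 2) S)"
          "rep_dim D R (add_mset (i, F - 2) S)" by metis
      then show ?thesis unfolding T' using f_pos[OF S(2,3) F(1)] S(3) by auto
    qed
    show "q \<in> truncation D R J"
      if p: "p \<in> truncation D R J" "eps D i p \<noteq> 0" "f_op D i p = Some q" for p q
    proof -
      obtain S where S: "p = ?p S" "rep_dim D R S" "set_mset S \<subseteq> J" using p(1) unfolding T by auto
      have S': "set_mset S \<subseteq> J'" using S(3) J'(2) by auto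
      have "f_op D i (?p S) = Some q" using p(3) S(1) by simp
      from f_op_rep_monomial[OF adm S(2) this]
      obtain F where F: "argmax_phi D (?p S) i F" "row_coeff D R S i F > 0"
          "q = ?p (add_mset (i, F - 2) S)" "rep_dim D R (add_mset (i, F - 2) S)" by metis
      \<comment> \<open>If \<open>F = k + 2\<close>, then \<open>F\<close> would be maximal with
        \<open>phi_at\<close> equal to the row sum, because no exponent at or below \<open>k\<close>
        is nonzero. That means \<open>eps\<close> is 0: the step would start at the top of a
        string.\<close>
      have "F - 2 \<noteq> k"
      proof
        assume "F - 2 = k"
        then have "F = k + 2" by simp
        have "(i, k) \<notin># S" using S(3) new by auto
        then have "expn (?p S) i k = 0"
          using low_coeff[OF S', of k] by (simp add: expn_rep_monomial not_in_iff)
        then have "phi_at (?p S) i (k + 2) = row_sum (?p S) i"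
          using phi_at_eq_row_sum[of "?p S" i k, OF low[OF S']] phi_at_step[OF pM[OF S(2)] par_k] by simp
        then show False using eps_eq[OF pM[OF S(2)] F(1)] p(2) S(1) \<open>F = k + 2\<close> by simp
      qed
      then have "(i, F - 2) \<in> J" using f_pos[OF S(2) S' F(2)] J'(2) by auto
      then show ?thesis unfolding T using F S(3) by auto
    qed
    show "p \<in> truncation D R J" if p: "p \<in> truncation D R J'" "eps D i p = 0" for p
    proof -
      obtain S where S: "p = ?p S" "rep_dim D R S" "set_mset S \<subseteq> J'" using p(1) unfolding T' by auto
      have "(i, k) \<notin># S"
      proof
        assume "(i, k) \<in># S"
        then have "expn (?p S) i k < 0" using low_coeff[OF S(3), of k] by (simp add: expn_rep_monomial)
        then have "eps D i (?p S) \<noteq> 0"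
          using eps_nonzero_if_first_neg[OF pM[OF S(2)] par_k low[OF S(3)]] by simp
        then show False using p(2) S(1) by simp
      qed
      then have "set_mset S \<subseteq> J" using S(3) J'(2) by auto
      then show ?thesis unfolding T using S by auto
    qed
  qed
qed

end

theorem theorem5p9:
  fixes D :: "('r::finite, 'i::finite) crystal_datum"
  assumes "based_root_datum D"
    and "simply_laced D"
    and "dynkin_connected D"
    and "two_colouring D"
    and "fundamental_weights D"
  shows
    "(\<forall>J. upward_closed D J \<longrightarrow> ch (truncation D {#} J) = 1) \<and>
     (\<forall>R Q J. admissible D R \<and> admissible D Q \<and> upward_closed D J \<and>
        set_mset R \<subseteq> J \<and> set_mset Q \<subseteq> bdry J \<longrightarrow>
        ch (truncation D (R + Q) J) = gexp (mset_wt D Q) * ch (truncation D R J)) \<and>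
     (\<forall>R J J' i k. admissible D R \<and> upward_closed D J \<and> set_mset R \<subseteq> J \<and>
        upward_closed D J' \<and> J' = J \<union> {(i, k)} \<and> J' - J = {(i, k)} \<longrightarrow>
        ch (truncation D R J') = demazure D i (ch (truncation D R J)))"
proof -
  interpret simply_laced_datum D
    using assms by unfold_locales
  show ?thesis
  proof (intro conjI allI impI)
    fix J show "ch (truncation D {#} J) = 1" by (rule ch_truncation_empty)
  next
    fix R Q J
    assume "admissible D R \<and> admissible D Q \<and> upward_closed D J \<and> set_mset R \<subseteq> J \<and> set_mset Q \<subseteq> bdry J"
    then show "ch (truncation D (R + Q) J) = gexp (mset_wt D Q) * ch (truncation D R J)"
      by (intro ch_truncation_bdry) auto
  next
    fix R J J' i k
    assume *: "admissible D R \<and> upward_closed D J \<and> set_mset R \<subseteq> J \<and>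
      upward_closed D J' \<and> J' = J \<union> {(i, k)} \<and> J' - J = {(i, k)}"
    then have "J' = insert (i, k) J" "(i, k) \<notin> J" by auto
    with * show "ch (truncation D R J') = demazure D i (ch (truncation D R J))"
      by (intro ch_truncation_insert) auto
  qed
qed

end
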